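(* Consider, for odd $n\ge3$, the heteroscedastic regression model $y_j=S(x_j)+\sigma_j(S)\xi_j$, $1\le j\le n$, described in the context, with $S\in W^1_r$ for some $r>0$. Let $\Lambda\subset[0,1]^n$ be any finite nonempty set and $0<\rho<1/3$. Let $(m_n)$ be integers with $1\le m_n\le n$, $\lim_{n\to\infty}m_n/\sqrt n=0$ and $\lim_{n\to\infty}m_n^2/\sqrt n=\infty$, and let $\widehat S_*$ be the procedure built with $\rho$ and with $\widehat\varsigma_n=\sum_{j=m_n+1}^n\widehat\theta_{j,n}^2$. Then for any odd $n\ge3$ $$ \mathbf E_S\|\widehat S_*-S\|_n^2\le(1+\kappa(\rho))\min_{\lambda\in\Lambda}\mathbf E_S\|\widehat S_\lambda-S\|_n^2+\frac1n\,\mathcal D_n(\rho,r), $$ where $$ \mathcal D_n(\rho,r)=\Psi_n(\rho)+\kappa_*(\rho)\big(\overline\sigma+\varsigma_n^*(r)\big)\frac{\varrho_n}{\sqrt n},\qquad \kappa(\rho)=\frac{6\rho-2\rho^2}{1-3\rho},\quad \kappa_*(\rho)=\frac{4(1-\rho^2)}{1-3\rho}, $$ $$ \overline\sigma=2(\overline\xi+\sqrt2)\sigma_*,\qquad \varsigma_n^*(r)=\frac{4r\sqrt n}{m_n^2}+\frac{4\sqrt{r\sigma_*}}{m_n}+\frac{(2+m_n)\sigma_*}{\sqrt n}. $$ Moreover, if for each $n$ the set $\Lambda$ is the set of Pinsker-type weights $\{\lambda_\alpha:\alpha\in\mathcal A_\varepsilon\}$ defined in the context, then for any $\delta>0$ and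 any $0<\rho<1/3$ $$\lim_{n\to\infty}\frac{\mathcal D_n(\rho,r)}{n^\delta}=0.$$
   Context: Model. $n$ is odd, $x_j=j/n$, $S$ is an unknown real function, and one observes $y_j=S(x_j)+\sigma_j(S)\xi_j$, $1\le j\le n$. The $(\xi_j)_{1\le j\le n}$ are i.i.d. with $\mathbf E\xi_1=0$, $\mathbf E\xi_1^2=1$, $\mathbf E\xi_1^4=\xi^*<\infty$; put $\overline\xi=\sqrt{\xi^*-1}$. The $(\sigma_l(S))_{1\le l\le n}$ are positive random variables independent of $(\xi_i)_{1\le i\le n}$, and there is a nonrandom constant $\sigma_*\ge1$ with $\max_{1\le l\le n}\sigma_l^2(S)\le\sigma_*$. The constants $\xi^*,\sigma_*$ do not depend on $n$. $\mathbf E_S$ is expectation when the regression function is $S$. Function class. $W^1_r$ is the set of 1-periodic, differentiable (in the Sobolev sense: absolutely continuous) functions $S:\mathbb R\to\mathbb R$ with $\|S\|^2+\|S'\|^2\le r$, where $\|f\|^2=\int_0^1f^2(t)\,dt$. Inner product and basis. $(f,g)_n=\frac1n\sum_{l=1}^n f(x_l)g(x_l)$, $\|f\|_n^2=(f,f)_n$. The trigonometric basis is $\phi_1=1$ and, for $j\ge2$, $\phi_j(x)=\sqrt2\cos(2\pi[j/2]x)$ for even $j$, $\phi_j(x)=\sqrt2\sin(2\pi[j/2]x)$ for odd $j$, where $[\cdot]$ is the integer part. Put $\overline\phi_j=\phi_j^2-1$. Estimators. $\widehat\theta_{j,n}=\frac1n\sum_{l=1}^n y_l\phi_j(x_l)$.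 For $\lambda=(\lambda(1),\dots,\lambda(n))\in\Lambda$, $\widehat S_\lambda=\sum_{j=1}^n\lambda(j)\widehat\theta_{j,n}\phi_j$. With $\widehat\varsigma_n$ as in the claim, put $\widetilde\theta_{j,n}=\widehat\theta_{j,n}^2-\frac1n\widehat\varsigma_n$, $|\lambda|^2=\sum_{j=1}^n\lambda^2(j)$, $\widehat P_n(\lambda)=|\lambda|^2\widehat\varsigma_n/n$, and $$J_n(\lambda)=\sum_{j=1}^n\lambda^2(j)\widehat\theta_{j,n}^2-2\sum_{j=1}^n\lambda(j)\widetilde\theta_{j,n}+\rho\,\widehat P_n(\lambda).$$ $\widehat\lambda\in\operatorname{argmin}_{\lambda\in\Lambda}J_n(\lambda)$ (any one minimizer if not unique), and $\widehat S_*=\widehat S_{\widehat\lambda}$. Constants. $\nu$ is the cardinality of $\Lambda$; $\varrho_n=\max_{\lambda\in\Lambda}\sum_{j=1}^n\lambda(j)$; for $i=1,2$, $\overline\varrho_{i,n}=\max_{\lambda\in\Lambda}\sup_{0\le x\le1}\big|\sum_{j=1}^n\lambda^i(j)\overline\phi_j(x)\big|$ (here $\lambda^i(j)$ is the $i$-th power of $\lambda(j)$); $$\Upsilon_n^*(\rho)=\frac{16\nu}{\rho}+4\overline\varrho_{1,n}\Big(1+\nu\frac{\overline\xi}{\sqrt n}\Big)+4\nu\varrho_n\frac{\overline\xi}{\sqrt n},$$ $$\Psi_n(\rho)=\frac{\rho(1-\rho)\Upsilon_n^*(\rho)+2\nu+2\rho^2(1-\rho)\overline\varrho_{2,n}}{\rho(1-3\rho)}\,\sigma_*.$$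 Pinsker-type weights. Let $k_*=k_*(n)\ge1$ and $0<\varepsilon=\varepsilon(n)\le1$ satisfy, as $n\to\infty$, $k_*\to+\infty$, $k_*/\ln n\to0$, $\varepsilon\to0$, and $n^{\delta}\varepsilon\to+\infty$ for every $\delta>0$. Let $\mathcal A_\varepsilon=\{1,\dots,k_*\}\times\{t_1,\dots,t_m\}$ with $t_i=i\varepsilon$, $m=[1/\varepsilon^2]$ (if $k_*$ is not an integer, $\{1,\dots,k_*\}$ means the positive integers not exceeding $k_*$). For $\alpha=(\beta,t)\in\mathcal A_\varepsilon$ put $A_\beta=\frac{(\beta+1)(2\beta+1)}{\pi^{2\beta}\beta}$, $\omega_\alpha=(A_\beta\,t\,n)^{1/(2\beta+1)}$, $j_0=[\omega_\alpha/\ln n]$, and define $\lambda_\alpha\in[0,1]^n$ by $$\lambda_\alpha(j)=\mathbf 1_{\{1\le j\le j_0\}}+\big(1-(j/\omega_\alpha)^\beta\big)\mathbf 1_{\{j_0<j\le\omega_\alpha\}},\qquad 1\le j\le n.$$ *)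

theory Defs
  imports "HOL-Probability.Probability"
begin

definition absolutely_continuous_on_interval :: "real \<Rightarrow> real \<Rightarrow> (real \<Rightarrow> real) \<Rightarrow> bool" where
  "absolutely_continuous_on_interval a b f \<longleftrightarrow>
     (\<forall>e>0. \<exists>d>0. \<forall>(N::nat) u v.
        (\<forall>i<N. a \<le> u i \<and> u i \<le> v i \<and> v i \<le> b) \<longrightarrow>
        disjoint_family_on (\<lambda>i. {u i<..<v i}) {..<N} \<longrightarrow>
        (\<Sum>i<N. v i - u i) < d \<longrightarrow> (\<Sum>i<N. \<bar>f (v i) - f (u i)\<bar>) < e)"

text \<open>
  \<open>S'\<close> is the almost everywhere derivative of the absolutely continuous function \<open>S\<close>; by
  Lebesgue's theorem the almost-everywhere clause only names it and does not restrict \<open>S\<close>.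
  The integrands are nonnegative, so the Henstock-Kurzweil integral is the Lebesgue integral.
\<close>

definition sobolev_ball :: "real \<Rightarrow> (real \<Rightarrow> real) set" where
  "sobolev_ball r = {S.
     (\<forall>x. S (x + 1) = S x) \<and>
     (\<forall>a b. absolutely_continuous_on_interval a b S) \<and>
     (\<exists>S'. (AE t in lborel. (S has_real_derivative S' t) (at t)) \<and>
           (\<lambda>t. (S' t)\<^sup>2) integrable_on {0..1} \<and>
           integral {0..1} (\<lambda>t. (S t)\<^sup>2) + integral {0..1} (\<lambda>t. (S' t)\<^sup>2) \<le> r)}"

text \<open>Noise variables are indexed by \<open>1, \<dots>, n\<close>; \<open>\<xi> j\<close> and \<open>\<sigma> j\<close> are irrelevant for other \<open>j\<close>.
  The random variables \<open>\<sigma> j\<close> may depend on each other and on the regression function in any way.\<close>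

locale regression_noise = prob_space M
  for M :: "'a measure" +
  fixes n :: nat
    and \<sigma> \<xi> :: "nat \<Rightarrow> 'a \<Rightarrow> real"
    and xi_star sigma_star :: real
  assumes xi_indep: "indep_vars (\<lambda>_. borel) \<xi> {1..n}"
    and xi_ident: "\<And>j. j \<in> {1..n} \<Longrightarrow> distr M borel (\<xi> j) = distr M borel (\<xi> 1)"
    and xi_mean: "expectation (\<xi> 1) = 0"
    and xi_var: "expectation (\<lambda>\<omega>. (\<xi> 1 \<omega>)\<^sup>2) = 1"
    and xi_fourth_integrable: "integrable M (\<lambda>\<omega>. (\<xi> 1 \<omega>) ^ 4)"
    and xi_fourth: "expectation (\<lambda>\<omega>. (\<xi> 1 \<omega>) ^ 4) = xi_star"
    and sigma_xi_indep:
      "indep_var (Pi\<^sub>M {1..n} (\<lambda>_. borel)) (\<lambda>\<omega>. \<lambda>j\<in>{1..n}. \<sigma> j \<omega>)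
                 (Pi\<^sub>M {1..n} (\<lambda>_. borel)) (\<lambda>\<omega>. \<lambda>j\<in>{1..n}. \<xi> j \<omega>)"
    and sigma_pos: "\<And>j. j \<in> {1..n} \<Longrightarrow> AE \<omega> in M. 0 < \<sigma> j \<omega>"
    and sigma_bound: "\<And>j. j \<in> {1..n} \<Longrightarrow> AE \<omega> in M. (\<sigma> j \<omega>)\<^sup>2 \<le> sigma_star"

definition design :: "nat \<Rightarrow> nat \<Rightarrow> real" where
  "design n j = real j / real n"

definition observation ::
  "nat \<Rightarrow> (real \<Rightarrow> real) \<Rightarrow> (nat \<Rightarrow> 'a \<Rightarrow> real) \<Rightarrow> (nat \<Rightarrow> 'a \<Rightarrow> real) \<Rightarrow> 'a \<Rightarrow> nat \<Rightarrow> real" where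
  "observation n S \<sigma> \<xi> \<omega> j = S (design n j) + \<sigma> j \<omega> * \<xi> j \<omega>"

definition inner_n :: "nat \<Rightarrow> (real \<Rightarrow> real) \<Rightarrow> (real \<Rightarrow> real) \<Rightarrow> real" where
  "inner_n n f g = (1 / real n) * (\<Sum>l=1..n. f (design n l) * g (design n l))"

definition normsq_n :: "nat \<Rightarrow> (real \<Rightarrow> real) \<Rightarrow> real" where
  "normsq_n n f = inner_n n f f"

definition trig :: "nat \<Rightarrow> real \<Rightarrow> real" where
  "trig j x =
     (if j = 1 then 1
      else if even j then sqrt 2 * cos (2 * pi * real (j div 2) * x)
      else sqrt 2 * sin (2 * pi * real (j div 2) * x))"

definition trig_bar :: "nat \<Rightarrow> real \<Rightarrow> real" where
  "trig_bar j x = (trig j x)\<^sup>2 - 1"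

definition theta_hat :: "nat \<Rightarrow> (nat \<Rightarrow> real) \<Rightarrow> nat \<Rightarrow> real" where
  "theta_hat n y j = (1 / real n) * (\<Sum>l=1..n. y l * trig j (design n l))"

definition S_hat :: "nat \<Rightarrow> (nat \<Rightarrow> real) \<Rightarrow> (nat \<Rightarrow> real) \<Rightarrow> real \<Rightarrow> real" where
  "S_hat n y w x = (\<Sum>j=1..n. w j * theta_hat n y j * trig j x)"

definition varsigma_hat :: "nat \<Rightarrow> nat \<Rightarrow> (nat \<Rightarrow> real) \<Rightarrow> real" where
  "varsigma_hat n m y = (\<Sum>j=m+1..n. (theta_hat n y j)\<^sup>2)"

definition theta_tilde :: "nat \<Rightarrow> nat \<Rightarrow> (nat \<Rightarrow> real) \<Rightarrow> nat \<Rightarrow> real" where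
  "theta_tilde n m y j = (theta_hat n y j)\<^sup>2 - varsigma_hat n m y / real n"

definition penalty_hat :: "nat \<Rightarrow> nat \<Rightarrow> (nat \<Rightarrow> real) \<Rightarrow> (nat \<Rightarrow> real) \<Rightarrow> real" where
  "penalty_hat n m y w = (\<Sum>j=1..n. (w j)\<^sup>2) * varsigma_hat n m y / real n"

definition cost :: "nat \<Rightarrow> nat \<Rightarrow> real \<Rightarrow> (nat \<Rightarrow> real) \<Rightarrow> (nat \<Rightarrow> real) \<Rightarrow> real" where
  "cost n m \<rho> y w =
     (\<Sum>j=1..n. (w j)\<^sup>2 * (theta_hat n y j)\<^sup>2) - 2 * (\<Sum>j=1..n. w j * theta_tilde n m y j)
     + \<rho> * penalty_hat n m y w"

text \<open>Weight vectors in \<open>[0,1]\<^sup>n\<close> are extensional functions on \<open>{1..n}\<close>, so that the cardinality of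
  a set of weight vectors is the intended one.\<close>

definition weight_cube :: "nat \<Rightarrow> (nat \<Rightarrow> real) set" where
  "weight_cube n = {1..n} \<rightarrow>\<^sub>E {0..1}"

text \<open>A measurable choice of a minimizer; any tie-breaking rule is allowed.\<close>

definition selects_weights ::
  "'a measure \<Rightarrow> nat \<Rightarrow> nat \<Rightarrow> real \<Rightarrow> ('a \<Rightarrow> nat \<Rightarrow> real) \<Rightarrow> (nat \<Rightarrow> real) set
     \<Rightarrow> ('a \<Rightarrow> nat \<Rightarrow> real) \<Rightarrow> bool" where
  "selects_weights M n m \<rho> y \<Lambda> lam \<longleftrightarrow>
     lam \<in> measurable M (count_space \<Lambda>) \<and>
     (\<forall>\<omega>\<in>space M. is_arg_min (cost n m \<rho> (y \<omega>)) (\<lambda>w. w \<in> \<Lambda>) (lam \<omega>))"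

definition xi_bar :: "real \<Rightarrow> real" where
  "xi_bar xi_star = sqrt (xi_star - 1)"

definition varrho :: "nat \<Rightarrow> (nat \<Rightarrow> real) set \<Rightarrow> real" where
  "varrho n \<Lambda> = Max ((\<lambda>w. \<Sum>j=1..n. w j) ` \<Lambda>)"

definition varrho_bar :: "nat \<Rightarrow> nat \<Rightarrow> (nat \<Rightarrow> real) set \<Rightarrow> real" where
  "varrho_bar i n \<Lambda> =
     Max ((\<lambda>w. SUP x\<in>{0..1}. \<bar>\<Sum>j=1..n. (w j) ^ i * trig_bar j x\<bar>) ` \<Lambda>)"

definition Upsilon_star :: "nat \<Rightarrow> (nat \<Rightarrow> real) set \<Rightarrow> real \<Rightarrow> real \<Rightarrow> real" where
  "Upsilon_star n \<Lambda> xi_star \<rho> =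
     16 * real (card \<Lambda>) / \<rho>
     + 4 * varrho_bar 1 n \<Lambda> * (1 + real (card \<Lambda>) * (xi_bar xi_star / sqrt (real n)))
     + 4 * real (card \<Lambda>) * varrho n \<Lambda> * (xi_bar xi_star / sqrt (real n))"

definition Psi :: "nat \<Rightarrow> (nat \<Rightarrow> real) set \<Rightarrow> real \<Rightarrow> real \<Rightarrow> real \<Rightarrow> real" where
  "Psi n \<Lambda> xi_star sigma_star \<rho> =
     (\<rho> * (1 - \<rho>) * Upsilon_star n \<Lambda> xi_star \<rho> + 2 * real (card \<Lambda>)
        + 2 * \<rho>\<^sup>2 * (1 - \<rho>) * varrho_bar 2 n \<Lambda>)
     / (\<rho> * (1 - 3 * \<rho>)) * sigma_star"

definition kappa :: "real \<Rightarrow> real" where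
  "kappa \<rho> = (6 * \<rho> - 2 * \<rho>\<^sup>2) / (1 - 3 * \<rho>)"

definition kappa_star :: "real \<Rightarrow> real" where
  "kappa_star \<rho> = 4 * (1 - \<rho>\<^sup>2) / (1 - 3 * \<rho>)"

definition sigma_bar :: "real \<Rightarrow> real \<Rightarrow> real" where
  "sigma_bar xi_star sigma_star = 2 * (xi_bar xi_star + sqrt 2) * sigma_star"

definition varsigma_star :: "nat \<Rightarrow> nat \<Rightarrow> real \<Rightarrow> real \<Rightarrow> real" where
  "varsigma_star n m sigma_star r =
     4 * r * sqrt (real n) / (real m)\<^sup>2 + 4 * sqrt (r * sigma_star) / real m
     + (2 + real m) * sigma_star / sqrt (real n)"

definition D_const ::
  "nat \<Rightarrow> nat \<Rightarrow> (nat \<Rightarrow> real) set \<Rightarrow> real \<Rightarrow> real \<Rightarrow> real \<Rightarrow> real \<Rightarrow> real" where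
  "D_const n m \<Lambda> xi_star sigma_star \<rho> r =
     Psi n \<Lambda> xi_star sigma_star \<rho>
     + kappa_star \<rho> * (sigma_bar xi_star sigma_star + varsigma_star n m sigma_star r)
       * (varrho n \<Lambda> / sqrt (real n))"

text \<open>The sample size \<open>n\<close> is always odd, so limits as \<open>n \<rightarrow> \<infinity>\<close> run through the odd numbers.\<close>

definition odd_sequentially :: "nat filter" where
  "odd_sequentially = inf sequentially (principal {n. odd n})"

definition pinsker_sequences :: "(nat \<Rightarrow> real) \<Rightarrow> (nat \<Rightarrow> real) \<Rightarrow> bool" where
  "pinsker_sequences k \<epsilon> \<longleftrightarrow>
     (\<forall>n. odd n \<longrightarrow> n \<ge> 3 \<longrightarrow> 1 \<le> k n \<and> 0 < \<epsilon> n \<and> \<epsilon> n \<le> 1) \<and>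
     filterlim k at_top odd_sequentially \<and>
     ((\<lambda>n. k n / ln (real n)) \<longlongrightarrow> 0) odd_sequentially \<and>
     (\<epsilon> \<longlongrightarrow> 0) odd_sequentially \<and>
     (\<forall>\<delta>>0. filterlim (\<lambda>n. real n powr \<delta> * \<epsilon> n) at_top odd_sequentially)"

definition pinsker_index :: "real \<Rightarrow> real \<Rightarrow> (nat \<times> real) set" where
  "pinsker_index k \<epsilon> =
     {\<beta>. 1 \<le> \<beta> \<and> real \<beta> \<le> k} \<times> (\<lambda>i. real i * \<epsilon>) ` {1..nat \<lfloor>1 / \<epsilon>\<^sup>2\<rfloor>}"

definition pinsker_A :: "nat \<Rightarrow> real" where
  "pinsker_A \<beta> = (real \<beta> + 1) * (2 * real \<beta> + 1) / (pi ^ (2 * \<beta>) * real \<beta>)"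

definition pinsker_omega :: "nat \<Rightarrow> nat \<times> real \<Rightarrow> real" where
  "pinsker_omega n = (\<lambda>(\<beta>, t). (pinsker_A \<beta> * t * real n) powr (1 / (2 * real \<beta> + 1)))"

definition pinsker_j0 :: "nat \<Rightarrow> nat \<times> real \<Rightarrow> nat" where
  "pinsker_j0 n \<alpha> = nat \<lfloor>pinsker_omega n \<alpha> / ln (real n)\<rfloor>"

definition pinsker_weight :: "nat \<Rightarrow> nat \<times> real \<Rightarrow> nat \<Rightarrow> real" where
  "pinsker_weight n \<alpha> = (\<lambda>j\<in>{1..n}.
     of_bool (1 \<le> j \<and> j \<le> pinsker_j0 n \<alpha>)
     + (1 - (real j / pinsker_omega n \<alpha>) ^ fst \<alpha>)
       * of_bool (pinsker_j0 n \<alpha> < j \<and> real j \<le> pinsker_omega n \<alpha>))"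

definition pinsker_weights :: "nat \<Rightarrow> real \<Rightarrow> real \<Rightarrow> (nat \<Rightarrow> real) set" where
  "pinsker_weights n k \<epsilon> = pinsker_weight n ` pinsker_index k \<epsilon>"

end

theory Submission
  imports Defs "HOL-Real_Asymp.Real_Asymp"
begin

text \<open>
  Write \<open>\<theta>\<^sub>j = (S, \<phi>\<^sub>j)\<^sub>n\<close> and \<open>\<zeta>\<^sub>j\<close> for the noise in the \<open>j\<close>-th empirical coefficient.
  For odd \<open>n\<close> the basis is orthonormal on the design points, so the loss of \<open>\<lambda>\<close> is
  \<open>\<Sum>\<^sub>j (\<lambda>(j) (\<theta>\<^sub>j + \<zeta>\<^sub>j) - \<theta>\<^sub>j)\<^sup>2\<close>. It differs from the cost \<open>J\<^sub>n(\<lambda>)\<close> by a constant, a form linear in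
  the noise, a quadratic form in the noise, and a multiple of the error of the variance estimator. Comparing a
  minimiser of the cost with a fixed \<open>\<lambda>\<^sub>0\<close>, the linear form is absorbed into the two losses, the
  off-diagonal part of the quadratic form into the true penalty \<open>\<rho> |\<lambda>|\<^sup>2 \<varsigma> / n\<close>; the remainders
  are normalised squares, summed over the finite set of weights instead of maximised, and their second
  moments are explicit. The variance estimator errs by the tail \<open>\<Sum>\<^sub>j\<^sub>>\<^sub>m \<theta>\<^sub>j\<^sup>2\<close>, which is
  bounded by applying Parseval's identity to the increments of \<open>S\<close> between design points.
\<close>

section \<open>Discrete orthogonality of the trigonometric basis\<close>

text \<open>The minimiser depends on the noise, while moment bounds hold only for weights fixed in
  advance; replacing a remainder by its sum over \<open>\<Lambda>\<close> is what brings in the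
  factor \<open>card \<Lambda>\<close>. The standard deviations may depend on each other and may be
  arbitrarily small, so the moment bounds rest on their joint independence from the errors and on
  the orthogonality of the errors, of their pairwise products and of their centred squares.
  Absorbing the off-diagonal form costs one true penalty for each of the two weights compared. That
  of the minimiser cancels; that of the fixed weight is doubled and charged to its own risk, whose
  variance part equals |w|^2 times the mean noise level up to a \<open>varrho_bar 2\<close> term.
  After multiplication by 1 - \<rho>, the coefficients of the two losses are 1 - 3 \<rho> and 1 + 3
  \<rho> - 2 \<rho>^2, with quotient 1 + \<open>kappa \<rho>\<close>. For the variance estimator,
  Parseval makes the total noise energy diagonal in the errors, so only its first \<open>m\<close>
  coefficients have to be estimated separately. In the Pinsker case everything follows from three
  bounds uniform over the family: on its cardinality, on \<open>varrho\<close> and on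
  \<open>varrho_bar\<close>.\<close>

lemma sum_cis_design:
  fixes a :: int
  assumes "0 < n"
  shows "(\<Sum>l=1..n. cis (2 * pi * a * design n l)) = (if int n dvd a then of_nat n else 0)"
proof -
  define z where "z = cis (2 * pi * a / n)"
  have pow: "cis (2 * pi * a * design n l) = z ^ l" for l
    by (simp add: z_def design_def Complex.DeMoivre field_simps)
  show ?thesis
  proof (cases "int n dvd a")
    case True
    then obtain k where k: "a = int n * k" by blast
    have "2 * pi * a / n = 2 * pi * k" using assms by (simp add: k)
    then have "z = 1" by (simp add: z_def complex_eq_iff cos_int_2pin sin_int_2pin)
    then show ?thesis using True by (simp add: pow)
  next
    case False
    have "z ^ n = cis (2 * pi * a)"
      using assms by (simp add: z_def Complex.DeMoivre)
    also have "\<dots> = 1" by (simp add: complex_eq_iff cos_int_2pin sin_int_2pin)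
    finally have zn: "z ^ n = 1" .
    have "z \<noteq> 1"
    proof
      assume "z = 1"
      then have "cos (2 * pi * a / n) = 1" by (simp add: z_def complex_eq_iff)
      then obtain k :: int where "2 * pi * a / n = real_of_int k * 2 * pi" using cos_one_2pi_int by blast
      then have "real_of_int a = real_of_int (k * int n)" using assms by (simp add: field_simps)
      then have "a = k * int n" using of_int_eq_iff by blast
      then show False using False by simp
    qed
    moreover have "(\<Sum>l=1..n. z ^ l) = z * (\<Sum>l<n. z ^ l)"
      by (simp add: sum_distrib_left sum.atLeast1_atMost_eq)
    ultimately show ?thesis using False zn by (simp add: pow geometric_sum)
  qed
qed

lemma sum_cos_design:
  fixes a :: int
  assumes "0 < n"
  shows "(\<Sum>l=1..n. cos (2 * pi * a * design n l)) = (if int n dvd a then real n else 0)"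
  using arg_cong[OF sum_cis_design[OF assms, of a], of Re] by (auto split: if_splits)

lemma sum_sin_design:
  fixes a :: int
  assumes "0 < n"
  shows "(\<Sum>l=1..n. sin (2 * pi * a * design n l)) = 0"
  using arg_cong[OF sum_cis_design[OF assms, of a], of Im] by (auto split: if_splits)

text \<open>The frequency is cast through \<open>int\<close> to match \<open>sum_cos_design\<close>,
  which must also accept differences of frequencies.\<close>

lemma trig_alt:
  "trig j x = (if j = 1 then 1
     else if even j then sqrt 2 * cos (2 * pi * of_int (int (j div 2)) * x)
     else sqrt 2 * sin (2 * pi * of_int (int (j div 2)) * x))"
  by (simp add: trig_def)

text \<open>Product-to-sum formulas reduce each case to sums of cosines or sines at the frequencies
  a - b and a + b, and such a cosine sum is nonzero only when \<open>n\<close> divides the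
  frequency.\<close>

lemma trig_orthonormal:
  assumes n: "odd n" and i: "i \<in> {1..n}" and j: "j \<in> {1..n}"
  shows "(\<Sum>l=1..n. trig i (design n l) * trig j (design n l)) = (if i = j then real n else 0)"
proof -
  have n0: "0 < n" using n by (cases n) auto
  note C = sum_cos_design[OF n0] and Z = sum_sin_design[OF n0]
  define a b where "a = int (i div 2)" and "b = int (j div 2)"
  \<comment> \<open>Oddness enters here. For even \<open>n\<close> the index \<open>n\<close> would
    have frequency exactly n/2; the strict bound keeps a - b and a + b strictly between -n and n, so
    divisibility by \<open>n\<close> means being 0.\<close>
  have ab: "0 \<le> a" "0 \<le> b" "2 * a < int n" "2 * b < int n"
    using i j n unfolding a_def b_def atLeastAtMost_iff by presburger+
  have pos: "0 < a" if "i \<noteq> 1" using that i unfolding a_def by auto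
  have pos': "0 < b" if "j \<noteq> 1" using that j unfolding b_def by auto
  have nd: "\<not> int n dvd c" if "0 < \<bar>c\<bar>" "\<bar>c\<bar> < int n" for c
    using that zdvd_not_zless[of "\<bar>c\<bar>" "int n"] by simp
  have d1: "int n dvd a \<longleftrightarrow> a = 0" using ab nd[of a] by (cases "a = 0") auto
  have d2: "int n dvd b \<longleftrightarrow> b = 0" using ab nd[of b] by (cases "b = 0") auto
  have d3: "int n dvd a - b \<longleftrightarrow> a = b" using ab nd[of "a - b"] by (cases "a = b") auto
  have d4: "int n dvd a + b \<longleftrightarrow> a + b = 0" using ab nd[of "a + b"] by (cases "a + b = 0") auto
  have d5: "\<not> int n dvd a + b" if "0 < a" using ab that by (simp add: d4)
  have cc: "(\<Sum>l=1..n. 2 * cos (2 * pi * a * design n l) * cos (2 * pi * b * design n l))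
      = (\<Sum>l=1..n. cos (2 * pi * (a - b) * design n l)) + (\<Sum>l=1..n. cos (2 * pi * (a + b) * design n l))"
    by (simp flip: sum.distrib add: cos_times_cos algebra_simps add_divide_distrib diff_divide_distrib)
  have ss: "(\<Sum>l=1..n. 2 * sin (2 * pi * a * design n l) * sin (2 * pi * b * design n l))
      = (\<Sum>l=1..n. cos (2 * pi * (a - b) * design n l)) - (\<Sum>l=1..n. cos (2 * pi * (a + b) * design n l))"
    by (simp flip: sum_subtractf add: sin_times_sin algebra_simps add_divide_distrib diff_divide_distrib)
  have sc: "(\<Sum>l=1..n. 2 * sin (2 * pi * a * design n l) * cos (2 * pi * b * design n l))
      = (\<Sum>l=1..n. sin (2 * pi * (a + b) * design n l)) + (\<Sum>l=1..n. sin (2 * pi * (a - b) * design n l))"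
    by (simp flip: sum.distrib add: sin_add sin_diff algebra_simps)
  have cs: "(\<Sum>l=1..n. 2 * cos (2 * pi * a * design n l) * sin (2 * pi * b * design n l))
      = (\<Sum>l=1..n. sin (2 * pi * (a + b) * design n l)) - (\<Sum>l=1..n. sin (2 * pi * (a - b) * design n l))"
    by (simp flip: sum_subtractf add: sin_add sin_diff algebra_simps)
  have sq: "sqrt 2 * u * (sqrt 2 * v) = 2 * u * v" for u v :: real by simp
  have ij: "i = j \<longleftrightarrow> a = b \<and> even i = even j" if "i \<noteq> 1" "j \<noteq> 1"
  proof -
    have "i = 2 * (i div 2) + i mod 2" "j = 2 * (j div 2) + j mod 2" by auto
    then show ?thesis unfolding a_def b_def
      by (metis of_nat_eq_iff even_iff_mod_2_eq_zero not_mod_2_eq_0_eq_1)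
  qed
  note defs = trig_alt a_def[symmetric] b_def[symmetric]
  consider "i = 1" "j = 1" | "i = 1" "j \<noteq> 1" "even j" | "i = 1" "j \<noteq> 1" "odd j"
    | "i \<noteq> 1" "j = 1" "even i" | "i \<noteq> 1" "j = 1" "odd i"
    | "i \<noteq> 1" "j \<noteq> 1" "even i" "even j" | "i \<noteq> 1" "j \<noteq> 1" "even i" "odd j"
    | "i \<noteq> 1" "j \<noteq> 1" "odd i" "even j" | "i \<noteq> 1" "j \<noteq> 1" "odd i" "odd j"
    by blast
  then show ?thesis
  proof cases
    case 1 then show ?thesis by (simp add: defs)
  next
    case 2 then show ?thesis using pos' C[of b] d2 by (simp add: defs sum_distrib_left[symmetric])
  next
    case 3 then show ?thesis using Z[of b] by (simp add: defs sum_distrib_left[symmetric])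
  next
    case 4 then show ?thesis using pos C[of a] d1 by (simp add: defs sum_distrib_left[symmetric])
  next
    case 5 then show ?thesis using Z[of a] by (simp add: defs sum_distrib_left[symmetric])
  next
    case 6 then show ?thesis using pos d5 d3 ij C[of "a - b"] C[of "a + b"] cc
      by (simp add: defs sq)
  next
    case 7 then show ?thesis using Z[of "a - b"] Z[of "a + b"] cs by (auto simp add: defs sq)
  next
    case 8 then show ?thesis using Z[of "a - b"] Z[of "a + b"] sc by (auto simp add: defs sq)
  next
    case 9 then show ?thesis using pos d5 d3 ij C[of "a - b"] C[of "a + b"] ss
      by (simp add: defs sq)
  qed
qed

text \<open>Groups the indices by frequency: 2 k and 2 k + 1 are the cosine and the sine of
  frequency k, and index 1 is the constant.\<close>

lemma sum_pairs_odd: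
  fixes f :: "nat \<Rightarrow> real"
  shows "(\<Sum>j=1..2 * p + 1. f j) = f 1 + (\<Sum>k=1..p. f (2 * k) + f (2 * k + 1))"
  by (induction p) (simp_all add: numeral_eq_Suc)

lemma trig_even: "1 \<le> k \<Longrightarrow> trig (2 * k) x = sqrt 2 * cos (2 * pi * k * x)"
  and trig_odd: "1 \<le> k \<Longrightarrow> trig (2 * k + 1) x = sqrt 2 * sin (2 * pi * k * x)"
  by (simp_all add: trig_def)

text \<open>The cosine and sine products of one frequency add up to a cosine of the difference of
  the two points. As a function of the frequency this cosine is even and \<open>n\<close>-periodic,
  so the constant plus twice the first \<open>p\<close> terms is the sum over all \<open>n\<close>
  frequencies.\<close>

lemma trig_complete:
  assumes n: "odd n" and l: "l \<in> {1..n}" and k: "k \<in> {1..n}"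
  shows "(\<Sum>j=1..n. trig j (design n l) * trig j (design n k)) = (if l = k then real n else 0)"
proof -
  have n0: "0 < n" using n by (cases n) auto
  obtain p where p: "n = 2 * p + 1" using n oddE by blast
  define d where "d = int l - int k"
  have dd: "design n l - design n k = d / n" by (simp add: design_def d_def diff_divide_distrib)
  let ?c = "\<lambda>i::nat. cos (2 * pi * i * (d / n))"
  have refl: "?c (n - i) = ?c i" if "i \<le> n" for i
  proof -
    have "2 * pi * real (n - i) * (d / n) = 2 * pi * d - 2 * pi * i * (d / n)"
      using n0 that by (simp add: of_nat_diff field_simps)
    then show ?thesis by (simp add: cos_diff cos_int_2pin sin_int_2pin)
  qed
  have "(\<Sum>j=1..n. trig j (design n l) * trig j (design n k)) =
      1 + (\<Sum>i=1..p. trig (2 * i) (design n l) * trig (2 * i) (design n k)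
        + trig (2 * i + 1) (design n l) * trig (2 * i + 1) (design n k))"
    unfolding p by (subst sum_pairs_odd) (simp add: trig_def)
  also have "\<dots> = 1 + (\<Sum>i=1..p. 2 * ?c i)"
  proof -
    have "trig (2 * i) (design n l) * trig (2 * i) (design n k)
        + trig (2 * i + 1) (design n l) * trig (2 * i + 1) (design n k) = 2 * ?c i"
      if "i \<in> {1..p}" for i
    proof -
      have "cos (2 * pi * i * design n l) * cos (2 * pi * i * design n k)
          + sin (2 * pi * i * design n l) * sin (2 * pi * i * design n k) = ?c i"
        by (simp add: cos_diff[symmetric] dd[symmetric] right_diff_distrib)
      moreover have "sqrt 2 * u * (sqrt 2 * v) = 2 * (u * v)" for u v :: real by simp
      ultimately show ?thesis using that by (simp only: trig_even trig_odd atLeastAtMost_iff distrib_left[symmetric])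
    qed
    then show ?thesis by simp
  qed
  also have "\<dots> = (\<Sum>i=1..n. ?c i)"
  proof -
    have "(\<Sum>i=p+1..2*p. ?c i) = (\<Sum>i=1..p. ?c i)"
      by (rule sum.reindex_bij_witness[where i = "\<lambda>i. n - i" and j = "\<lambda>i. n - i"])
         (use refl in \<open>auto simp: p\<close>)
    moreover have "(\<Sum>i=1..n. ?c i) = (\<Sum>i=1..p. ?c i) + (\<Sum>i=p+1..2*p. ?c i) + ?c n"
    proof -
      have "{1..n} = insert n ({1..p} \<union> {p+1..2*p})" by (auto simp: p)
      then show ?thesis by (simp add: p sum.union_disjoint)
    qed
    moreover have "?c n = 1" using refl[of n] by simp
    ultimately show ?thesis by (simp add: sum_distrib_left[symmetric])
  qed
  \<comment> \<open>Frequency and point change roles: i * (d / n) = d * (i / n), so the sum over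
    frequencies is read as a sum over design points.\<close>
  also have "\<dots> = (\<Sum>i=1..n. cos (2 * pi * d * design n i))"
    by (simp add: design_def mult_ac)
  also have "\<dots> = (if int n dvd d then real n else 0)"
    by (rule sum_cos_design[OF n0])
  finally have eq: "(\<Sum>j=1..n. trig j (design n l) * trig j (design n k)) = (if int n dvd d then real n else 0)" .
  have "\<bar>d\<bar> < int n" using l k by (auto simp: d_def)
  then have "int n dvd d \<longleftrightarrow> l = k"
    using l k zdvd_not_zless[of "\<bar>d\<bar>" "int n"] by (cases "l = k") (auto simp: d_def)
  with eq show ?thesis by simp
qed

text \<open>Follows from \<open>trig_complete\<close> by expanding the square. It is stated for
  arbitrary values at the design points because it is applied to the residual of an estimate, to the
  noise vector and to the increments of \<open>S\<close>.\<close>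

lemma trig_parseval:
  fixes f :: "nat \<Rightarrow> real"
  assumes n: "odd n"
  shows "(\<Sum>j=1..n. (1 / n * (\<Sum>l=1..n. f l * trig j (design n l)))\<^sup>2) = 1 / n * (\<Sum>l=1..n. (f l)\<^sup>2)"
proof -
  have n0: "0 < n" using n by (cases n) auto
  have "(\<Sum>j=1..n. (1 / n * (\<Sum>l=1..n. f l * trig j (design n l)))\<^sup>2)
      = 1 / n\<^sup>2 * (\<Sum>j=1..n. \<Sum>l=1..n. \<Sum>k=1..n. f l * f k * (trig j (design n l) * trig j (design n k)))"
    by (simp add: power2_eq_square sum_product sum_distrib_left sum_divide_distrib mult_ac)
  also have "(\<Sum>j=1..n. \<Sum>l=1..n. \<Sum>k=1..n. f l * f k * (trig j (design n l) * trig j (design n k)))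
     = (\<Sum>l=1..n. \<Sum>k=1..n. f l * f k * (\<Sum>j=1..n. trig j (design n l) * trig j (design n k)))"
    by (subst sum.swap, rule sum.cong[OF refl], subst sum.swap) (simp add: sum_distrib_left)
  also have "\<dots> = (\<Sum>l=1..n. n * (f l)\<^sup>2)"
    using n by (intro sum.cong refl) (simp add: trig_complete if_distrib[of "\<lambda>x. _ * x"] sum.delta' power2_eq_square cong: if_cong del: One_nat_def)
  also have "1 / n\<^sup>2 * \<dots> = 1 / n * (\<Sum>l=1..n. (f l)\<^sup>2)"
    using n0 by (simp add: sum_distrib_left[symmetric] power2_eq_square)
  finally show ?thesis .
qed

text \<open>The converse direction of Parseval, from \<open>trig_orthonormal\<close>; it bounds
  variances of linear noise forms and the rows of \<open>kernel\<close>.\<close>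

lemma trig_synthesis_normsq:
  fixes c :: "nat \<Rightarrow> real"
  assumes n: "odd n"
  shows "(\<Sum>l=1..n. (\<Sum>j=1..n. c j * trig j (design n l))\<^sup>2) = n * (\<Sum>j=1..n. (c j)\<^sup>2)"
proof -
  have "(\<Sum>l=1..n. (\<Sum>j=1..n. c j * trig j (design n l))\<^sup>2)
      = (\<Sum>l=1..n. \<Sum>i=1..n. \<Sum>j=1..n. c i * c j * (trig i (design n l) * trig j (design n l)))"
    by (simp add: power2_eq_square sum_product mult_ac)
  also have "\<dots> = (\<Sum>i=1..n. \<Sum>j=1..n. c i * c j * (\<Sum>l=1..n. trig i (design n l) * trig j (design n l)))"
    by (subst sum.swap, rule sum.cong[OF refl], subst sum.swap) (simp add: sum_distrib_left)
  also have "\<dots> = (\<Sum>i=1..n. n * (c i)\<^sup>2)"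
    using n by (intro sum.cong refl) (simp add: trig_orthonormal if_distrib[of "\<lambda>x. _ * x"] sum.delta' power2_eq_square cong: if_cong del: One_nat_def)
  finally show ?thesis by (simp add: sum_distrib_left)
qed

lemma trig_coefficient:
  fixes c :: "nat \<Rightarrow> real"
  assumes n: "odd n" and i: "i \<in> {1..n}"
  shows "1 / n * (\<Sum>l=1..n. (\<Sum>j=1..n. c j * trig j (design n l)) * trig i (design n l)) = c i"
proof -
  have n0: "0 < n" using n by (cases n) auto
  have "(\<Sum>l=1..n. (\<Sum>j=1..n. c j * trig j (design n l)) * trig i (design n l))
      = (\<Sum>j=1..n. c j * (\<Sum>l=1..n. trig j (design n l) * trig i (design n l)))"
    unfolding sum_distrib_left sum_distrib_right by (subst sum.swap) (simp add: mult_ac)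
  also have "\<dots> = (\<Sum>j=1..n. if j = i then n * c j else 0)"
    using n i by (intro sum.cong refl) (simp add: trig_orthonormal del: One_nat_def)
  also have "\<dots> = n * c i"
    using i by simp
  finally show ?thesis using n0 by simp
qed

section \<open>Sobolev functions on the design points\<close>

lemma absolutely_continuous_on_interval_finite:
  fixes u v :: "'i \<Rightarrow> real"
  assumes "absolutely_continuous_on_interval a b f" and "0 < e"
  obtains d where "0 < d"
    and "\<And>(P :: 'i set) u v. finite P \<Longrightarrow> (\<And>i. i \<in> P \<Longrightarrow> a \<le> u i \<and> u i \<le> v i \<and> v i \<le> b) \<Longrightarrow>
      disjoint_family_on (\<lambda>i. {u i<..<v i}) P \<Longrightarrow> (\<Sum>i\<in>P. v i - u i) < d \<Longrightarrow>
      (\<Sum>i\<in>P. \<bar>f (v i) - f (u i)\<bar>) < e"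
proof -
  obtain d where d: "0 < d" "\<forall>(N::nat) u v. (\<forall>i<N. a \<le> u i \<and> u i \<le> v i \<and> v i \<le> b) \<longrightarrow>
        disjoint_family_on (\<lambda>i. {u i<..<v i}) {..<N} \<longrightarrow>
        (\<Sum>i<N. v i - u i) < d \<longrightarrow> (\<Sum>i<N. \<bar>f (v i) - f (u i)\<bar>) < e"
    using assms unfolding absolutely_continuous_on_interval_def by blast
  show thesis
  proof (rule that[OF d(1)])
    fix P :: "'i set" and u v
    assume fin: "finite P" and P: "\<And>i. i \<in> P \<Longrightarrow> a \<le> u i \<and> u i \<le> v i \<and> v i \<le> b"
      and disj: "disjoint_family_on (\<lambda>i. {u i<..<v i}) P" and sm: "(\<Sum>i\<in>P. v i - u i) < d"
    \<comment> \<open>The definition numbers its intervals by an initial segment of the naturals,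
      whereas a tagged division is a set of pairs; an enumeration translates between the
      two.\<close>
    obtain h where h: "bij_betw h {..<card P} P"
      using fin ex_bij_betw_nat_finite[OF fin] by (auto simp: atLeast0LessThan)
    have hP: "h i \<in> P" if "i < card P" for i using h that by (auto simp: bij_betw_def)
    have "(\<Sum>i<card P. \<bar>f (v (h i)) - f (u (h i))\<bar>) < e"
    proof (rule d(2)[THEN spec, of "card P", THEN spec, of "\<lambda>i. u (h i)", THEN spec,
          of "\<lambda>i. v (h i)", THEN mp, THEN mp, THEN mp])
      show "\<forall>i<card P. a \<le> u (h i) \<and> u (h i) \<le> v (h i) \<and> v (h i) \<le> b" using P hP by blast
      show "disjoint_family_on (\<lambda>i. {u (h i)<..<v (h i)}) {..<card P}"
        using disj h hP unfolding disjoint_family_on_def bij_betw_def inj_on_def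
        by (metis lessThan_iff)
      show "(\<Sum>i<card P. v (h i) - u (h i)) < d"
        using sm sum.reindex_bij_betw[OF h, of "\<lambda>i. v i - u i"] by simp
    qed
    then show "(\<Sum>i\<in>P. \<bar>f (v i) - f (u i)\<bar>) < e"
      using sum.reindex_bij_betw[OF h, of "\<lambda>i. \<bar>f (v i) - f (u i)\<bar>"] by simp
  qed
qed

text \<open>Lebesgue's fundamental theorem, directly for the gauge integral. Cells tagged outside
  the exceptional null set are controlled by differentiability at the tag; cells tagged inside it
  are confined by the gauge to an open set of small measure, where absolute continuity makes the
  total increment of \<open>f\<close> small. Each group gets half of the allowed error.\<close>

lemma absolutely_continuous_has_integral:
  fixes f f' :: "real \<Rightarrow> real"
  assumes ac: "absolutely_continuous_on_interval a b f" and "a \<le> b"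
    and deriv: "AE t in lborel. (f has_real_derivative f' t) (at t)"
  shows "(f' has_integral f b - f a) {a..b}"
proof -
  obtain N where N: "\<And>x. x \<notin> N \<Longrightarrow> (f has_real_derivative f' x) (at x)" "N \<in> null_sets lborel"
    using AE_E3[OF deriv] by auto
  have neg: "negligible N"
    using N(2) by (simp add: negligible_iff_null_sets null_sets_completionI)
  \<comment> \<open>With value 0 on \<open>N\<close>, a cell tagged in \<open>N\<close> contributes
    nothing to the Riemann sum, and its error is just the increment of \<open>f\<close>.\<close>
  define g where "g x = (if x \<in> N then 0 else f' x)" for x
  have "(g has_integral f b - f a) {a..b}"
    unfolding has_integral_factor_content_real
  proof (cases "a = b")
    case True
    show "\<forall>e>0. \<exists>d. gauge d \<and> (\<forall>p. p tagged_division_of {a..b} \<and> d fine p \<longrightarrow>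
      norm (sum (\<lambda>(x,k). measure lborel k *\<^sub>R g x) p - (f b - f a)) \<le> e * measure lborel {a..b})"
      using has_integral_factor_content_real[of g "0" a b] True by auto
  next
    case False
    then have ab: "a < b" using \<open>a \<le> b\<close> by simp
    show "\<forall>e>0. \<exists>d. gauge d \<and> (\<forall>p. p tagged_division_of {a..b} \<and> d fine p \<longrightarrow>
      norm (sum (\<lambda>(x,k). measure lborel k *\<^sub>R g x) p - (f b - f a)) \<le> e * measure lborel {a..b})"
    proof (intro allI impI)
      fix e :: real assume e: "0 < e"
      have pos: "0 < e / 2 * (b - a)" using e ab by simp
      obtain \<delta> where \<delta>: "0 < \<delta>"
        and acd: "\<And>(P :: (real \<times> real set) set) u v. finite P \<Longrightarrow>
          (\<And>i. i \<in> P \<Longrightarrow> a \<le> u i \<and> u i \<le> v i \<and> v i \<le> b) \<Longrightarrow>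
          disjoint_family_on (\<lambda>i. {u i<..<v i}) P \<Longrightarrow> (\<Sum>i\<in>P. v i - u i) < \<delta> \<Longrightarrow>
          (\<Sum>i\<in>P. \<bar>f (v i) - f (u i)\<bar>) < e / 2 * (b - a)"
        by (rule absolutely_continuous_on_interval_finite[OF ac pos, where ?'i = "real \<times> real set"], rule that)
          (assumption, blast)
      have "N \<in> sets lebesgue" using neg by (simp add: negligible_iff_null_sets null_sets_def)
      then obtain U where U: "open U" "N \<subseteq> U" "(U - N) \<in> lmeasurable" "emeasure lebesgue (U - N) < ennreal \<delta>"
        using \<delta> by (rule sets_lebesgue_outer_open)
      \<comment> \<open>Outer regularity bounds only the part of \<open>U\<close> outside
        \<open>N\<close>; since \<open>N\<close> is null, \<open>U\<close> itself is small.\<close>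
      have "emeasure lborel U = emeasure lebesgue U" using U(1) by simp
      also have "\<dots> = emeasure lebesgue (U - N)"
        using neg U(1) by (intro emeasure_Diff_null_set[symmetric]) (auto simp: negligible_iff_null_sets)
      finally have Um: "emeasure lborel U < ennreal \<delta>" using U(4) by simp
      \<comment> \<open>The radius of the gauge at \<open>x\<close>: it keeps the cell inside
        \<open>U\<close> at an exceptional tag, and makes the linear approximation accurate up to
        slope e / 2 at any other tag.\<close>
      have "\<exists>d>0. (x \<in> N \<longrightarrow> ball x d \<subseteq> U) \<and>
          (x \<notin> N \<longrightarrow> (\<forall>y. \<bar>y - x\<bar> < d \<longrightarrow> \<bar>f y - f x - f' x * (y - x)\<bar> \<le> e / 2 * \<bar>y - x\<bar>))" for x
      proof (cases "x \<in> N")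
        case True
        then show ?thesis using U(1,2) by (meson open_contains_ball subsetD)
      next
        case False
        then have "(f has_derivative (*) (f' x)) (at x)"
          using N(1) by (simp add: has_field_derivative_def)
        then have "\<exists>d>0. \<forall>y. norm (y - x) < d \<longrightarrow> norm (f y - f x - f' x * (y - x)) \<le> e / 2 * norm (y - x)"
          using e unfolding has_derivative_at_alt by (metis half_gt_zero)
        then show ?thesis using False by simp
      qed
      then obtain d where d: "\<And>x. 0 < d x" "\<And>x. x \<in> N \<Longrightarrow> ball x (d x) \<subseteq> U"
        "\<And>x y. x \<notin> N \<Longrightarrow> \<bar>y - x\<bar> < d x \<Longrightarrow> \<bar>f y - f x - f' x * (y - x)\<bar> \<le> e / 2 * \<bar>y - x\<bar>"
        by metis
      show "\<exists>d. gauge d \<and> (\<forall>p. p tagged_division_of {a..b} \<and> d fine p \<longrightarrow>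
        norm (sum (\<lambda>(x,k). measure lborel k *\<^sub>R g x) p - (f b - f a)) \<le> e * measure lborel {a..b})"
      proof (rule exI, safe)
        show "gauge (\<lambda>x. ball x (d x))" using d(1) gauge_ball_dependent by blast
      next
        fix p assume p: "p tagged_division_of {a..b}" and fine: "(\<lambda>x. ball x (d x)) fine p"
        note tag = tagged_division_ofD[OF p]
        have K: "\<exists>u v. K = {u..v} \<and> a \<le> u \<and> u \<le> x \<and> x \<le> v \<and> v \<le> b \<and> Inf K = u \<and> Sup K = v \<and> measure lborel K = v - u
             \<and> {u..v} \<subseteq> ball x (d x)"
          if xk: "(x, K) \<in> p" for x K
        proof -
          obtain u v where uv: "K = cbox u v" using tag(4)[OF xk] by blast
          have "x \<in> K" "K \<subseteq> {a..b}" "K \<subseteq> ball x (d x)" using tag(2,3)[OF xk] fine xk by auto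
          then show ?thesis unfolding uv by (intro exI[of _ u] exI[of _ v]) auto
        qed
        let ?A = "{q \<in> p. fst q \<in> N}" and ?B = "{q \<in> p. fst q \<notin> N}"
        let ?u = "\<lambda>q. Inf (snd q) :: real" and ?v = "\<lambda>q. Sup (snd q) :: real"
        have fin: "finite ?A" "finite ?B" using tag(1) by auto
        have Sf: "f b - f a = (\<Sum>q\<in>p. f (?v q) - f (?u q))" and Sx: "b - a = (\<Sum>q\<in>p. ?v q - ?u q)"
          using additive_tagged_division_1[OF \<open>a \<le> b\<close> p, of f]
            additive_tagged_division_1[OF \<open>a \<le> b\<close> p, of "\<lambda>x. x"]
          by (simp_all add: case_prod_unfold)
        have "norm (sum (\<lambda>(x,k). measure lborel k *\<^sub>R g x) p - (f b - f a))
            = \<bar>\<Sum>q\<in>p. measure lborel (snd q) * g (fst q) - (f (?v q) - f (?u q))\<bar>"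
          unfolding Sf by (simp add: sum_subtractf case_prod_unfold)
        also have "\<dots> \<le> (\<Sum>q\<in>p. \<bar>measure lborel (snd q) * g (fst q) - (f (?v q) - f (?u q))\<bar>)"
          by (rule sum_abs)
        also have "\<dots> = (\<Sum>q\<in>?A. \<bar>measure lborel (snd q) * g (fst q) - (f (?v q) - f (?u q))\<bar>)
            + (\<Sum>q\<in>?B. \<bar>measure lborel (snd q) * g (fst q) - (f (?v q) - f (?u q))\<bar>)"
        proof -
          have "p = ?A \<union> ?B" by blast
          moreover have "sum F (?A \<union> ?B) = sum F ?A + sum F ?B" for F :: "real \<times> real set \<Rightarrow> real"
            using fin by (intro sum.union_disjoint) auto
          ultimately show ?thesis by metis
        qed
        also have "(\<Sum>q\<in>?A. \<bar>measure lborel (snd q) * g (fst q) - (f (?v q) - f (?u q))\<bar>)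
            = (\<Sum>q\<in>?A. \<bar>f (?v q) - f (?u q)\<bar>)"
          by (intro sum.cong) (auto simp: g_def)
        also have "\<dots> < e / 2 * (b - a)"
        proof (rule acd[OF fin(1)])
          show "a \<le> ?u q \<and> ?u q \<le> ?v q \<and> ?v q \<le> b" if "q \<in> ?A" for q
            using K[of "fst q" "snd q"] that by auto
          show disj: "disjoint_family_on (\<lambda>q. {?u q<..<?v q}) ?A"
            unfolding disjoint_family_on_def
          proof (intro ballI impI)
            fix q q' assume q: "q \<in> ?A" "q' \<in> ?A" "q \<noteq> q'"
            have sub: "{?u q<..<?v q} \<subseteq> interior (snd q)" if "q \<in> p" for q
              using K[of "fst q" "snd q"] that by (metis interior_atLeastAtMost_real order_refl prod.collapse)
            have "interior (snd q) \<inter> interior (snd q') = {}"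
              using q tag(5)[of "fst q" "snd q" "fst q'" "snd q'"] by simp
            then show "{?u q<..<?v q} \<inter> {?u q'<..<?v q'} = {}"
              using sub[of q] sub[of q'] q by blast
          qed
          \<comment> \<open>The total length is the measure of a disjoint union of open intervals,
            all contained in \<open>U\<close>.\<close>
          have "(\<Sum>q\<in>?A. ?v q - ?u q) = (\<Sum>q\<in>?A. measure lborel {?u q<..<?v q})"
            using K by (intro sum.cong refl) fastforce
          also have "\<dots> = measure lborel (\<Union>q\<in>?A. {?u q<..<?v q})"
          proof (rule measure_finite_Union[symmetric, OF fin(1) _ disj])
            show "emeasure lborel {?u q<..<?v q} \<noteq> \<infinity>" for q
              by (cases "?u q \<le> ?v q") auto
          qed auto
          also have "\<dots> < \<delta>"
          proof -
            have "(\<Union>q\<in>?A. {?u q<..<?v q}) \<subseteq> U"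
            proof safe
              fix x K' y assume *: "(x, K') \<in> p" "fst (x, K') \<in> N" "y \<in> {?u (x, K')<..<?v (x, K')}"
              then show "y \<in> U" using K[OF *(1)] d(2)[of x] by fastforce
            qed
            then have "emeasure lborel (\<Union>q\<in>?A. {?u q<..<?v q}) \<le> emeasure lborel U"
              using U(1) by (intro emeasure_mono) auto
            then have "emeasure lborel (\<Union>q\<in>?A. {?u q<..<?v q}) < ennreal \<delta>" using Um by simp
            moreover from this have "emeasure lborel (\<Union>q\<in>?A. {?u q<..<?v q}) \<noteq> \<top>"
              by (metis ennreal_less_top order_less_trans less_irrefl)
            ultimately show ?thesis
              by (simp add: emeasure_eq_ennreal_measure ennreal_less_iff)
          qed
          finally show "(\<Sum>q\<in>?A. ?v q - ?u q) < \<delta>" .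
        qed
        also have "(\<Sum>q\<in>?B. \<bar>measure lborel (snd q) * g (fst q) - (f (?v q) - f (?u q))\<bar>)
            \<le> (\<Sum>q\<in>?B. e / 2 * (?v q - ?u q))"
        proof (rule sum_mono)
          fix q assume q: "q \<in> ?B"
          obtain x K' where xk: "q = (x, K')" by (cases q)
          then obtain u v where uv: "K' = {u..v}" "a \<le> u" "u \<le> x" "x \<le> v" "v \<le> b" "Inf K' = u" "Sup K' = v"
            "measure lborel K' = v - u" "{u..v} \<subseteq> ball x (d x)" using K[of x K'] q by auto
          have x: "x \<notin> N" using q xk by simp
          have "u \<in> {u..v}" "v \<in> {u..v}" using uv by auto
          then have "u \<in> ball x (d x)" "v \<in> ball x (d x)" using uv(9) by blast+
          then have "\<bar>u - x\<bar> < d x" "\<bar>v - x\<bar> < d x" by (simp_all add: dist_real_def abs_minus_commute)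
          then have "\<bar>f u - f x - f' x * (u - x)\<bar> \<le> e / 2 * \<bar>u - x\<bar>" "\<bar>f v - f x - f' x * (v - x)\<bar> \<le> e / 2 * \<bar>v - x\<bar>"
            using d(3)[OF x] by blast+
          \<comment> \<open>The error is split at the tag. Since the tag lies between
            \<open>u\<close> and \<open>v\<close>, the distances from it to the endpoints add up to
            v - u.\<close>
          moreover have "(v - u) * f' x - (f v - f u)
              = (f u - f x - f' x * (u - x)) - (f v - f x - f' x * (v - x))" by (simp add: algebra_simps)
          ultimately have "\<bar>(v - u) * f' x - (f v - f u)\<bar> \<le> e / 2 * \<bar>u - x\<bar> + e / 2 * \<bar>v - x\<bar>"
            by linarith
          also have "\<dots> = e / 2 * (v - u)" using uv(3,4) by (simp add: distrib_left[symmetric] del: times_divide_eq_left)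
          finally show "\<bar>measure lborel (snd q) * g (fst q) - (f (?v q) - f (?u q))\<bar> \<le> e / 2 * (?v q - ?u q)"
            using uv x by (simp add: xk g_def)
        qed
        also have "\<dots> \<le> (\<Sum>q\<in>p. e / 2 * (?v q - ?u q))"
        proof (rule sum_mono2[OF tag(1)])
          show "0 \<le> e / 2 * (?v q - ?u q)" if "q \<in> p - ?B" for q
            using K[of "fst q" "snd q"] that e by auto
        qed auto
        also have "\<dots> = e / 2 * (b - a)" by (simp add: Sx sum_distrib_left)
        finally show "norm (sum (\<lambda>(x,k). measure lborel k *\<^sub>R g x) p - (f b - f a)) \<le> e * measure lborel {a..b}"
          using ab by simp
      qed
    qed
  qed
  then show ?thesis
    by (rule has_integral_spike[OF neg, rotated]) (simp add: g_def)
qed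

text \<open>Cauchy-Schwarz for the integral of \<open>f'\<close>, obtained by integrating (f' - c)^2
  >= 0 with c the mean slope.\<close>

lemma absolutely_continuous_increment_sq_le:
  fixes f f' :: "real \<Rightarrow> real"
  assumes "absolutely_continuous_on_interval a b f" and "a \<le> b"
    and "AE t in lborel. (f has_real_derivative f' t) (at t)"
    and int: "(\<lambda>t. (f' t)\<^sup>2) integrable_on {a..b}"
  shows "(f b - f a)\<^sup>2 \<le> (b - a) * integral {a..b} (\<lambda>t. (f' t)\<^sup>2)"
proof (cases "a = b")
  case False
  then have ab: "a < b" using assms by simp
  define c where "c = (f b - f a) / (b - a)"
  have c: "f b - f a = c * (b - a)" using ab by (simp add: c_def)
  have "((\<lambda>t. (f' t)\<^sup>2 - 2 * c * f' t + c\<^sup>2) has_integral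
      integral {a..b} (\<lambda>t. (f' t)\<^sup>2) - 2 * c * (f b - f a) + c\<^sup>2 * (b - a)) {a..b}"
    using absolutely_continuous_has_integral[OF assms(1-3)] ab int
      has_integral_const_real[of "c\<^sup>2" a b]
    by (intro has_integral_add has_integral_diff has_integral_mult_right)
       (auto simp: integrable_integral mult.commute)
  then have "0 \<le> integral {a..b} (\<lambda>t. (f' t)\<^sup>2) - 2 * c * (f b - f a) + c\<^sup>2 * (b - a)"
  proof (rule has_integral_nonneg)
    show "0 \<le> (f' t)\<^sup>2 - 2 * c * f' t + c\<^sup>2" for t
      using zero_le_power2[of "f' t - c"] by (simp add: power2_diff algebra_simps)
  qed
  then have "c\<^sup>2 * (b - a) \<le> integral {a..b} (\<lambda>t. (f' t)\<^sup>2)"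
    unfolding c by (simp add: power2_eq_square algebra_simps)
  then have "(b - a) * (c\<^sup>2 * (b - a)) \<le> (b - a) * integral {a..b} (\<lambda>t. (f' t)\<^sup>2)"
    using ab by (intro mult_left_mono) auto
  then show ?thesis unfolding c by (simp add: power2_eq_square mult_ac)
qed simp

text \<open>Cauchy-Schwarz on each cell gains the cell width 1/n, and the energies of the cells add
  up to that of [0, 1].\<close>

lemma sobolev_increments:
  assumes S: "S \<in> sobolev_ball r" and n: "0 < n"
  shows "(\<Sum>l=1..n. (S (design n l) - S (design n (l - 1)))\<^sup>2) \<le> r / n"
proof -
  obtain S' where S': "AE t in lborel. (S has_real_derivative S' t) (at t)"
    "(\<lambda>t. (S' t)\<^sup>2) integrable_on {0..1}"
    "integral {0..1} (\<lambda>t. (S t)\<^sup>2) + integral {0..1} (\<lambda>t. (S' t)\<^sup>2) \<le> r"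
    and ac: "\<And>a b. absolutely_continuous_on_interval a b S"
    using S unfolding sobolev_ball_def by blast
  let ?I = "\<lambda>a b. integral {a..b} (\<lambda>t. (S' t)\<^sup>2)"
  have int: "(\<lambda>t. (S' t)\<^sup>2) integrable_on {a..b}" if "0 \<le> a" "b \<le> 1" for a b
    using integrable_subinterval_real[OF S'(2), of a b] that by simp
  have d01: "0 \<le> design n l" "l \<le> n \<Longrightarrow> design n l \<le> 1" "design n l \<le> design n (Suc l)" for l
    using n by (auto simp: design_def field_simps)
  have "(\<Sum>l=1..q. (S (design n l) - S (design n (l - 1)))\<^sup>2) \<le> 1 / n * ?I 0 (design n q)" if "q \<le> n" for q
    using that
  proof (induction q)
    case 0 then show ?case by (simp add: design_def)
  next
    case (Suc q)
    have "(S (design n (Suc q)) - S (design n q))\<^sup>2 \<le> (design n (Suc q) - design n q) * ?I (design n q) (design n (Suc q))"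
      using Suc.prems d01 by (intro absolutely_continuous_increment_sq_le ac S' int) auto
    also have "design n (Suc q) - design n q = 1 / n" by (simp add: design_def add_divide_distrib)
    finally have "(\<Sum>l=1..Suc q. (S (design n l) - S (design n (l - 1)))\<^sup>2)
        \<le> 1 / n * (?I 0 (design n q) + ?I (design n q) (design n (Suc q)))"
      using Suc by (simp add: field_simps)
    also have "?I 0 (design n q) + ?I (design n q) (design n (Suc q)) = ?I 0 (design n (Suc q))"
      using Suc.prems d01 by (intro Henstock_Kurzweil_Integration.integral_combine int) auto
    finally show ?case .
  qed
  from this[of n] have "(\<Sum>l=1..n. (S (design n l) - S (design n (l - 1)))\<^sup>2) \<le> 1 / n * ?I 0 1"
    using n by (simp add: design_def)
  also have "?I 0 1 \<le> r"
  proof -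
    \<comment> \<open>\<open>integral\<close> is 0 on a function that is not integrable, so the sign
      is right in either case.\<close>
    have "0 \<le> integral {0..1} (\<lambda>t. (S t)\<^sup>2)"
      by (cases "(\<lambda>t. (S t)\<^sup>2) integrable_on {0..1}") (auto simp: integral_nonneg not_integrable_integral)
    then show ?thesis using S'(3) by simp
  qed
  finally show ?thesis using n by (simp add: field_simps)
qed

section \<open>Decay of the empirical Fourier coefficients\<close>

lemma sin_ge_chord:
  assumes "0 \<le> x" "x \<le> pi / 2"
  shows "2 / pi * x \<le> sin x"
proof -
  \<comment> \<open>Jordan's inequality: a concave function lies above its chord, here the one from
    0 to pi / 2.\<close>
  have "convex_on {0..pi / 2} (\<lambda>x. - sin x)"
  proof (rule f''_ge0_imp_convex)
    show "((\<lambda>x. - sin x) has_real_derivative - cos x) (at x)" for x :: real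
      by (auto intro!: derivative_eq_intros)
    show "((\<lambda>x. - cos x) has_real_derivative sin x) (at x)" for x :: real
      by (auto intro!: derivative_eq_intros)
    show "0 \<le> sin x" if "x \<in> {0..pi / 2}" for x
      using that by (intro sin_ge_zero) auto
  qed auto
  from convex_onD[OF this, of "2 / pi * x" 0 "pi / 2"] show ?thesis
    using assms by (simp add: field_simps)
qed

text \<open>Moves a shift by one design point from \<open>S\<close> to the test function.
  Periodicity identifies the boundary terms at 0 and 1.\<close>

lemma sum_shift_periodic:
  fixes S f :: "real \<Rightarrow> real"
  assumes n: "0 < n" and S: "\<And>x. S (x + 1) = S x" and f: "\<And>x. f (x + 1) = f x"
  shows "(\<Sum>l=1..n. S (design n (l - 1)) * f (design n l)) = (\<Sum>l=1..n. S (design n l) * f (design n l + 1 / n))"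
proof -
  define F where "F l = S (design n l) * f (design n l + 1 / n)" for l
  have "S 1 = S 0" "f (1 + 1 / n) = f (1 / n)" using S[of 0] f[of "1 / n"] by (simp_all add: add.commute)
  then have F: "F n = F 0" using n by (simp add: F_def design_def)
  have step: "design n (Suc l) = design n l + 1 / n" for l by (simp add: design_def add_divide_distrib)
  have "(\<Sum>l<n. F (Suc l)) - (\<Sum>l<n. F l) = 0"
    using sum_lessThan_telescope[of F n] F by (simp add: sum_subtractf)
  then show ?thesis by (simp add: sum.atLeast1_atMost_eq F_def step)
qed

lemma trig_periodic: "trig j (x + 1) = trig j x"
proof -
  have "2 * pi * real k * (x + 1) = 2 * pi * real k * x + 2 * real k * pi" for k
    by (simp add: algebra_simps)
  moreover have "cos (a + 2 * real k * pi) = cos a" "sin (a + 2 * real k * pi) = sin a" for a k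
    using cos_int_2pin[of "int k"] sin_int_2pin[of "int k"] by (simp_all add: cos_add sin_add mult_ac)
  ultimately show ?thesis by (simp add: trig_def)
qed

text \<open>Shifting the argument by \<open>1 / n\<close> rotates each cosine-sine pair of coefficients, so the
  increments of \<open>S\<close> have the coefficients of \<open>S\<close> multiplied by \<open>2 sin (\<pi> k / n) \<ge> 4 k / n\<close> at
  frequency \<open>k\<close>; Parseval's identity for the increments then controls the tail.\<close>

lemma sobolev_tail_le:
  assumes S: "S \<in> sobolev_ball r" and n: "odd n"
  shows "(real m)\<^sup>2 * (\<Sum>j=m+1..n. (inner_n n S (trig j))\<^sup>2) \<le> r / 4"
proof -
  have n0: "0 < n" using n by (cases n) auto
  obtain p where p: "n = 2 * p + 1" using n oddE by blast
  have per: "S (x + 1) = S x" for x using S by (simp add: sobolev_ball_def)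
  define \<theta> where "\<theta> j = inner_n n S (trig j)" for j
  define g where "g l = S (design n l) - S (design n (l - 1))" for l
  define G where "G j = 1 / n * (\<Sum>l=1..n. g l * trig j (design n l))" for j
  have \<theta>_sum: "(\<Sum>l=1..n. S (design n l) * trig j (design n l)) = n * \<theta> j" for j
    using n0 by (simp add: \<theta>_def inner_n_def)
  have G: "G j = \<theta> j - 1 / n * (\<Sum>l=1..n. S (design n l) * trig j (design n l + 1 / n))" for j
  proof -
    have "(\<Sum>l=1..n. g l * trig j (design n l))
        = n * \<theta> j - (\<Sum>l=1..n. S (design n (l - 1)) * trig j (design n l))"
      unfolding g_def \<theta>_sum[symmetric] by (simp add: left_diff_distrib sum_subtractf)
    then show ?thesis
      unfolding G_def sum_shift_periodic[of n S "trig j", OF n0 per trig_periodic] using n0 by (simp add: right_diff_distrib)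
  qed
  have pair: "4 * (real k)\<^sup>2 * ((\<theta> (2 * k))\<^sup>2 + (\<theta> (2 * k + 1))\<^sup>2)
      \<le> (real n)\<^sup>2 / 4 * ((G (2 * k))\<^sup>2 + (G (2 * k + 1))\<^sup>2)" if k: "k \<in> {1..p}" for k
  proof -
    define y where "y = pi * k / n"
    define c s where "c = cos (2 * y)" and "s = sin (2 * y)"
    have arg: "2 * pi * real k * (x + 1 / n) = 2 * pi * real k * x + 2 * y" for x
      by (simp add: y_def field_simps)
    have k1: "1 \<le> k" using k by simp
    have e: "trig (2 * k) (x + 1 / n) = c * trig (2 * k) x - s * trig (2 * k + 1) x" for x
      unfolding trig_even[OF k1] trig_odd[OF k1] arg c_def s_def by (simp add: cos_add algebra_simps)
    have o: "trig (2 * k + 1) (x + 1 / n) = c * trig (2 * k + 1) x + s * trig (2 * k) x" for x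
      unfolding trig_even[OF k1] trig_odd[OF k1] arg c_def s_def by (simp add: sin_add algebra_simps)
    have Ge: "G (2 * k) = (1 - c) * \<theta> (2 * k) + s * \<theta> (2 * k + 1)"
    proof -
      have "(\<Sum>l=1..n. S (design n l) * trig (2 * k) (design n l + 1 / n))
          = c * (\<Sum>l=1..n. S (design n l) * trig (2 * k) (design n l))
            - s * (\<Sum>l=1..n. S (design n l) * trig (2 * k + 1) (design n l))"
        unfolding e sum_distrib_left by (simp flip: sum_subtractf add: algebra_simps)
      then show ?thesis unfolding G \<theta>_sum using n0 by (simp add: field_simps)
    qed
    have Go: "G (2 * k + 1) = (1 - c) * \<theta> (2 * k + 1) - s * \<theta> (2 * k)"
    proof -
      have "(\<Sum>l=1..n. S (design n l) * trig (2 * k + 1) (design n l + 1 / n))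
          = c * (\<Sum>l=1..n. S (design n l) * trig (2 * k + 1) (design n l))
            + s * (\<Sum>l=1..n. S (design n l) * trig (2 * k) (design n l))"
        unfolding o sum_distrib_left by (simp flip: sum.distrib add: algebra_simps)
      then show ?thesis unfolding G \<theta>_sum using n0 by (simp add: field_simps)
    qed
    have cs: "c\<^sup>2 + s\<^sup>2 = 1" by (simp add: c_def s_def)
    \<comment> \<open>The pair of coefficients is acted on by the matrix with entries 1 - c and s,
      -s, a rotation scaled by the square root of (1 - c)^2 + s^2 = 2 (1 - c) = 4 sin^2 y.\<close>
    have "(G (2 * k))\<^sup>2 + (G (2 * k + 1))\<^sup>2
        = ((1 - c)\<^sup>2 + s\<^sup>2) * ((\<theta> (2 * k))\<^sup>2 + (\<theta> (2 * k + 1))\<^sup>2)"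
      unfolding Ge Go by (simp add: power2_eq_square algebra_simps)
    also have "(1 - c)\<^sup>2 + s\<^sup>2 = 2 * (1 - c)" using cs by (simp add: power2_eq_square algebra_simps)
    also have "\<dots> = 4 * (sin y)\<^sup>2" unfolding c_def by (simp add: cos_double_sin)
    finally have GG: "(G (2 * k))\<^sup>2 + (G (2 * k + 1))\<^sup>2
        = 4 * (sin y)\<^sup>2 * ((\<theta> (2 * k))\<^sup>2 + (\<theta> (2 * k + 1))\<^sup>2)" .
    \<comment> \<open>Frequencies stay below n/2, so \<open>y\<close> stays in the range of Jordan's
      inequality.\<close>
    have "2 * k \<le> n" using k p by simp
    then have "2 * real k \<le> real n" by (metis of_nat_le_iff of_nat_mult of_nat_numeral)
    then have "y \<le> pi / 2" using n0 by (simp add: y_def field_simps)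
    then have "2 / pi * y \<le> sin y" by (intro sin_ge_chord) (simp_all add: y_def)
    then have "2 * k / n \<le> sin y" by (simp add: y_def)
    then have "(2 * k / n)\<^sup>2 \<le> (sin y)\<^sup>2" by (intro power_mono) auto
    then have "4 * (real k)\<^sup>2 \<le> (real n)\<^sup>2 * (sin y)\<^sup>2"
      using n0 by (simp add: power_divide power_mult_distrib field_simps)
    then have "4 * (real k)\<^sup>2 * ((\<theta> (2 * k))\<^sup>2 + (\<theta> (2 * k + 1))\<^sup>2)
        \<le> (real n)\<^sup>2 * (sin y)\<^sup>2 * ((\<theta> (2 * k))\<^sup>2 + (\<theta> (2 * k + 1))\<^sup>2)"
      by (intro mult_right_mono) auto
    then show ?thesis unfolding GG by simp
  qed
  have "(real m)\<^sup>2 * (\<Sum>j=m+1..n. (\<theta> j)\<^sup>2) \<le> (\<Sum>j=m+1..n. 4 * (real (j div 2))\<^sup>2 * (\<theta> j)\<^sup>2)"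
    unfolding sum_distrib_left
  proof (intro sum_mono mult_right_mono)
    fix j assume "j \<in> {m+1..n}"
    \<comment> \<open>Halving loses at most 1, which the start of the tail at m + 1
      compensates.\<close>
    then have "m \<le> 2 * (j div 2)" by simp presburger
    then have "real m \<le> 2 * real (j div 2)" by (metis of_nat_le_iff of_nat_mult of_nat_numeral)
    then have "(real m)\<^sup>2 \<le> (2 * real (j div 2))\<^sup>2" by (intro power_mono) auto
    then show "(real m)\<^sup>2 \<le> 4 * (real (j div 2))\<^sup>2" by (simp add: power_mult_distrib)
  qed auto
  also have "\<dots> \<le> (\<Sum>j=1..n. 4 * (real (j div 2))\<^sup>2 * (\<theta> j)\<^sup>2)"
    by (intro sum_mono2) auto
  \<comment> \<open>Index 1 has frequency 1 div 2 = 0 and drops out.\<close>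
  also have "\<dots> = (\<Sum>k=1..p. 4 * (real k)\<^sup>2 * ((\<theta> (2 * k))\<^sup>2 + (\<theta> (2 * k + 1))\<^sup>2))"
    unfolding p sum_pairs_odd by (simp add: distrib_left)
  also have "\<dots> \<le> (\<Sum>k=1..p. (real n)\<^sup>2 / 4 * ((G (2 * k))\<^sup>2 + (G (2 * k + 1))\<^sup>2))"
    by (intro sum_mono pair)
  also have "\<dots> \<le> (real n)\<^sup>2 / 4 * (\<Sum>j=1..n. (G j)\<^sup>2)"
    unfolding p sum_pairs_odd sum_distrib_left[symmetric] by (intro mult_left_mono) auto
  also have "(\<Sum>j=1..n. (G j)\<^sup>2) = 1 / n * (\<Sum>l=1..n. (g l)\<^sup>2)"
    unfolding G_def by (rule trig_parseval[OF n])
  also have "(\<Sum>l=1..n. (g l)\<^sup>2) \<le> r / n"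
    unfolding g_def by (rule sobolev_increments[OF S n0])
  finally show ?thesis using n0 unfolding \<theta>_def by (simp add: power2_eq_square mult_left_mono)
qed

section \<open>Moments of the noise\<close>

text \<open>The variance of |f| is nonnegative. This turns second moments of noise forms into bounds
  on their mean absolute values.\<close>

lemma (in prob_space) expectation_abs_le_sqrt:
  fixes f :: "'a \<Rightarrow> real"
  assumes [measurable]: "f \<in> borel_measurable M" and f2: "integrable M (\<lambda>\<omega>. (f \<omega>)\<^sup>2)"
    and le: "expectation (\<lambda>\<omega>. (f \<omega>)\<^sup>2) \<le> c"
  shows "integrable M (\<lambda>\<omega>. \<bar>f \<omega>\<bar>)" "expectation (\<lambda>\<omega>. \<bar>f \<omega>\<bar>) \<le> sqrt c"
proof -
  have f1: "integrable M f" using f2 by (rule square_integrable_imp_integrable[rotated]) simp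
  then show i: "integrable M (\<lambda>\<omega>. \<bar>f \<omega>\<bar>)" by simp
  have "0 \<le> variance (\<lambda>\<omega>. \<bar>f \<omega>\<bar>)" by (rule variance_positive)
  then have "(expectation (\<lambda>\<omega>. \<bar>f \<omega>\<bar>))\<^sup>2 \<le> expectation (\<lambda>\<omega>. (f \<omega>)\<^sup>2)"
    using variance_eq[OF i] f2 by simp
  then show "expectation (\<lambda>\<omega>. \<bar>f \<omega>\<bar>) \<le> sqrt c"
    using le by (intro real_le_rsqrt) simp
qed

text \<open>Independence factorises each cross term, and orthogonality of the \<open>G i\<close>
  then removes it, whatever the dependence among the \<open>A i\<close>. The linear, centred-square
  and off-diagonal forms in the noise are all instances, with the standard deviations in
  \<open>X\<close> and the errors in \<open>Y\<close>.\<close>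

lemma (in prob_space) second_moment_orthogonal:
  fixes A :: "'i \<Rightarrow> 'b \<Rightarrow> real" and G :: "'i \<Rightarrow> 'b \<Rightarrow> real"
  assumes ind: "indep_var N1 X N2 Y" and fin: "finite I"
    and A: "\<And>i. i \<in> I \<Longrightarrow> A i \<in> borel_measurable N1"
    and G: "\<And>i. i \<in> I \<Longrightarrow> G i \<in> borel_measurable N2"
    and A2: "\<And>i. i \<in> I \<Longrightarrow> integrable M (\<lambda>\<omega>. (A i (X \<omega>))\<^sup>2)"
    and GG: "\<And>i j. i \<in> I \<Longrightarrow> j \<in> I \<Longrightarrow> integrable M (\<lambda>\<omega>. G i (Y \<omega>) * G j (Y \<omega>))"
    and orth: "\<And>i j. i \<in> I \<Longrightarrow> j \<in> I \<Longrightarrow>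
      expectation (\<lambda>\<omega>. G i (Y \<omega>) * G j (Y \<omega>)) = (if i = j then c else 0)"
  shows "integrable M (\<lambda>\<omega>. (\<Sum>i\<in>I. A i (X \<omega>) * G i (Y \<omega>))\<^sup>2)"
    and "expectation (\<lambda>\<omega>. (\<Sum>i\<in>I. A i (X \<omega>) * G i (Y \<omega>))\<^sup>2) = c * (\<Sum>i\<in>I. expectation (\<lambda>\<omega>. (A i (X \<omega>))\<^sup>2))"
proof -
  have X: "random_variable N1 X" and Y: "random_variable N2 Y"
    using indep_var_rv1[OF ind] indep_var_rv2[OF ind] .
  have AX: "(\<lambda>\<omega>. A i (X \<omega>)) \<in> borel_measurable M" if "i \<in> I" for i
    using measurable_compose[OF X A[OF that]] .
  have AA: "integrable M (\<lambda>\<omega>. A i (X \<omega>) * A j (X \<omega>))" if "i \<in> I" "j \<in> I" for i j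
  proof (rule Bochner_Integration.integrable_bound)
    show "integrable M (\<lambda>\<omega>. (A i (X \<omega>))\<^sup>2 + (A j (X \<omega>))\<^sup>2)" using A2 that by simp
    show "(\<lambda>\<omega>. A i (X \<omega>) * A j (X \<omega>)) \<in> borel_measurable M" using AX that by simp
    have "\<bar>a * b\<bar> \<le> a\<^sup>2 + b\<^sup>2" for a b :: real
      using sum_squares_bound[of a b] sum_squares_bound[of a "- b"] by (simp add: abs_le_iff)
    then show "AE \<omega> in M. norm (A i (X \<omega>) * A j (X \<omega>)) \<le> norm ((A i (X \<omega>))\<^sup>2 + (A j (X \<omega>))\<^sup>2)"
      by simp
  qed
  have ind2: "indep_var borel (\<lambda>\<omega>. A i (X \<omega>) * A j (X \<omega>)) borel (\<lambda>\<omega>. G i (Y \<omega>) * G j (Y \<omega>))"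
    if "i \<in> I" "j \<in> I" for i j
    using indep_var_compose[OF ind, of "\<lambda>s. A i s * A j s" borel "\<lambda>s. G i s * G j s" borel] A G that
    by (simp add: comp_def)
  note int = indep_var_integrable[OF ind2 AA GG] and mean = indep_var_lebesgue_integral[OF ind2 AA GG]
  have sq: "(\<Sum>i\<in>I. A i (X \<omega>) * G i (Y \<omega>))\<^sup>2
      = (\<Sum>i\<in>I. \<Sum>j\<in>I. A i (X \<omega>) * A j (X \<omega>) * (G i (Y \<omega>) * G j (Y \<omega>)))" for \<omega>
    by (simp add: power2_eq_square sum_product mult_ac)
  show "integrable M (\<lambda>\<omega>. (\<Sum>i\<in>I. A i (X \<omega>) * G i (Y \<omega>))\<^sup>2)"
    unfolding sq using int by (intro Bochner_Integration.integrable_sum) auto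
  have "expectation (\<lambda>\<omega>. (\<Sum>i\<in>I. A i (X \<omega>) * G i (Y \<omega>))\<^sup>2)
      = (\<Sum>i\<in>I. \<Sum>j\<in>I. expectation (\<lambda>\<omega>. A i (X \<omega>) * A j (X \<omega>) * (G i (Y \<omega>) * G j (Y \<omega>))))"
    unfolding sq using int
    by (subst Bochner_Integration.integral_sum; (intro sum.cong refl Bochner_Integration.integral_sum Bochner_Integration.integrable_sum)?) auto
  also have "\<dots> = (\<Sum>i\<in>I. \<Sum>j\<in>I. if i = j then c * expectation (\<lambda>\<omega>. (A i (X \<omega>))\<^sup>2) else 0)"
    by (intro sum.cong refl) (auto simp: mean orth power2_eq_square)
  also have "\<dots> = c * (\<Sum>i\<in>I. expectation (\<lambda>\<omega>. (A i (X \<omega>))\<^sup>2))"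
    using fin by (simp add: sum.delta sum_distrib_left)
  finally show "expectation (\<lambda>\<omega>. (\<Sum>i\<in>I. A i (X \<omega>) * G i (Y \<omega>))\<^sup>2) = c * (\<Sum>i\<in>I. expectation (\<lambda>\<omega>. (A i (X \<omega>))\<^sup>2))" .
qed

locale odd_regression_noise = regression_noise +
  assumes n_odd: "odd n"
begin

lemma n_pos: "0 < n" using n_odd by (cases n) auto

lemma one_in: "1 \<in> {1..n}" using n_pos by simp

lemma xi_measurable: "j \<in> {1..n} \<Longrightarrow> \<xi> j \<in> borel_measurable M"
  using xi_indep by (simp add: indep_vars_def)

lemma sigma_measurable:
  assumes "j \<in> {1..n}"
  shows "\<sigma> j \<in> borel_measurable M"
proof -
  have "(\<lambda>\<omega>. (\<lambda>j\<in>{1..n}. \<sigma> j \<omega>) j) \<in> borel_measurable M"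
    by (rule measurable_compose[OF indep_var_rv1[OF sigma_xi_indep] measurable_component_singleton[OF assms]])
  then show ?thesis using assms by simp
qed

section \<open>Mixed moments of the errors\<close>

lemma xi1_power_integrable:
  assumes "k \<le> 4"
  shows "integrable M (\<lambda>\<omega>. \<xi> 1 \<omega> ^ k)"
proof (rule Bochner_Integration.integrable_bound)
  show "integrable M (\<lambda>\<omega>. 1 + \<xi> 1 \<omega> ^ 4)" using xi_fourth_integrable by simp
  show "(\<lambda>\<omega>. \<xi> 1 \<omega> ^ k) \<in> borel_measurable M" using xi_measurable[OF one_in] by simp
  have "\<bar>x ^ k\<bar> \<le> 1 + x ^ 4" for x :: real
  proof (cases "\<bar>x\<bar> \<le> 1")
    case True
    then have "\<bar>x\<bar> ^ k \<le> 1" by (simp add: power_le_one)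
    then show ?thesis by (simp add: power_abs add_increasing2)
  next
    case False
    then have "\<bar>x\<bar> ^ k \<le> \<bar>x\<bar> ^ 4" using assms by (intro power_increasing) auto
    then show ?thesis by (simp add: power_abs)
  qed
  then show "AE \<omega> in M. norm (\<xi> 1 \<omega> ^ k) \<le> norm (1 + \<xi> 1 \<omega> ^ 4)"
    by (simp add: add_nonneg_nonneg)
qed

lemma xi_power:
  assumes j: "j \<in> {1..n}"
  shows "k \<le> 4 \<Longrightarrow> integrable M (\<lambda>\<omega>. \<xi> j \<omega> ^ k)"
    and "expectation (\<lambda>\<omega>. \<xi> j \<omega> ^ k) = expectation (\<lambda>\<omega>. \<xi> 1 \<omega> ^ k)"
proof -
  show "integrable M (\<lambda>\<omega>. \<xi> j \<omega> ^ k)" if "k \<le> 4"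
    using integrable_distr_eq[OF xi_measurable[OF j], of "\<lambda>x. x ^ k"]
      integrable_distr_eq[OF xi_measurable[OF one_in], of "\<lambda>x. x ^ k"] xi_ident[OF j]
      xi1_power_integrable[OF that] by simp
  show "expectation (\<lambda>\<omega>. \<xi> j \<omega> ^ k) = expectation (\<lambda>\<omega>. \<xi> 1 \<omega> ^ k)"
    using integral_distr[OF xi_measurable[OF j], of "\<lambda>x. x ^ k"]
      integral_distr[OF xi_measurable[OF one_in], of "\<lambda>x. x ^ k"] xi_ident[OF j] by simp
qed

lemma xi_monomial:
  assumes e: "\<And>i. e i \<le> 4"
  shows "integrable M (\<lambda>\<omega>. \<Prod>i=1..n. \<xi> i \<omega> ^ e i)"
    and "expectation (\<lambda>\<omega>. \<Prod>i=1..n. \<xi> i \<omega> ^ e i) = (\<Prod>i=1..n. expectation (\<lambda>\<omega>. \<xi> 1 \<omega> ^ e i))"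
proof -
  have ind: "indep_vars (\<lambda>_. borel) (\<lambda>i \<omega>. \<xi> i \<omega> ^ e i) {1..n}"
    by (rule indep_vars_compose2[OF xi_indep]) simp
  show "integrable M (\<lambda>\<omega>. \<Prod>i=1..n. \<xi> i \<omega> ^ e i)"
    using e xi_power(1) by (intro indep_vars_integrable ind) auto
  have "expectation (\<lambda>\<omega>. \<Prod>i=1..n. \<xi> i \<omega> ^ e i) = (\<Prod>i=1..n. expectation (\<lambda>\<omega>. \<xi> i \<omega> ^ e i))"
    using e xi_power(1) by (intro indep_vars_lebesgue_integral ind) auto
  also have "\<dots> = (\<Prod>i=1..n. expectation (\<lambda>\<omega>. \<xi> 1 \<omega> ^ e i))"
    by (intro prod.cong refl xi_power(2))
  finally show "expectation (\<lambda>\<omega>. \<Prod>i=1..n. \<xi> i \<omega> ^ e i) = (\<Prod>i=1..n. expectation (\<lambda>\<omega>. \<xi> 1 \<omega> ^ e i))" .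
qed

lemma xi1_moments:
  "expectation (\<lambda>\<omega>. \<xi> 1 \<omega> ^ 0) = 1" "expectation (\<lambda>\<omega>. \<xi> 1 \<omega> ^ Suc 0) = 0"
  "expectation (\<lambda>\<omega>. \<xi> 1 \<omega> ^ 2) = 1" "expectation (\<lambda>\<omega>. \<xi> 1 \<omega> ^ 4) = xi_star"
  using xi_mean xi_var xi_fourth by (simp_all add: prob_space)

text \<open>\<open>e\<close> counts the occurrences of an index among the four factors, so all
  patterns of coincidence become one product over \<open>{1..n}\<close>, to which independence
  applies.\<close>

lemma xi_quadruple:
  assumes abcd: "a \<in> {1..n}" "b \<in> {1..n}" "c \<in> {1..n}" "d \<in> {1..n}"
  defines "e \<equiv> \<lambda>i. of_bool (i = a) + of_bool (i = b) + of_bool (i = c) + of_bool (i = d) :: nat"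
  shows "integrable M (\<lambda>\<omega>. \<xi> a \<omega> * \<xi> b \<omega> * \<xi> c \<omega> * \<xi> d \<omega>)"
    and "expectation (\<lambda>\<omega>. \<xi> a \<omega> * \<xi> b \<omega> * \<xi> c \<omega> * \<xi> d \<omega>) = (\<Prod>i=1..n. expectation (\<lambda>\<omega>. \<xi> 1 \<omega> ^ e i))"
proof -
  have single: "(\<Prod>i=1..n. f i ^ of_bool (i = l)) = f l" if "l \<in> {1..n}" for l and f :: "nat \<Rightarrow> real"
  proof -
    have "(\<Prod>i=1..n. f i ^ of_bool (i = l)) = (\<Prod>i=1..n. if i = l then f i else 1)"
      by (intro prod.cong) auto
    then show ?thesis using that by simp
  qed
  have eq: "(\<lambda>\<omega>. \<xi> a \<omega> * \<xi> b \<omega> * \<xi> c \<omega> * \<xi> d \<omega>) = (\<lambda>\<omega>. \<Prod>i=1..n. \<xi> i \<omega> ^ e i)"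
    unfolding e_def power_add prod.distrib using abcd by (simp only: single)
  have e4: "e i \<le> 4" for i by (simp add: e_def)
  show "integrable M (\<lambda>\<omega>. \<xi> a \<omega> * \<xi> b \<omega> * \<xi> c \<omega> * \<xi> d \<omega>)"
    and "expectation (\<lambda>\<omega>. \<xi> a \<omega> * \<xi> b \<omega> * \<xi> c \<omega> * \<xi> d \<omega>) = (\<Prod>i=1..n. expectation (\<lambda>\<omega>. \<xi> 1 \<omega> ^ e i))"
    unfolding eq using e4 by (rule xi_monomial)+
qed

text \<open>If the two increasing pairs differ, some index occurs exactly once and its mean 0
  annihilates the product; if they agree, every index occurs 0 or 2 times.\<close>

lemma xi_pairs_orthogonal:
  assumes "l \<in> {1..n}" "k \<in> {1..n}" "l' \<in> {1..n}" "k' \<in> {1..n}" "l < k" "l' < k'"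
  shows "expectation (\<lambda>\<omega>. \<xi> l \<omega> * \<xi> k \<omega> * \<xi> l' \<omega> * \<xi> k' \<omega>) = (if (l, k) = (l', k') then 1 else 0)"
proof -
  let ?e = "\<lambda>i. of_bool (i = l) + of_bool (i = k) + of_bool (i = l') + of_bool (i = k') :: nat"
  note E = xi_quadruple(2)[OF assms(1-4)]
  show ?thesis
  proof (cases "(l, k) = (l', k')")
    case True
    have "(\<Prod>i=1..n. expectation (\<lambda>\<omega>. \<xi> 1 \<omega> ^ ?e i)) = 1"
    proof (intro prod.neutral ballI)
      fix i
      have "?e i = 0 \<or> ?e i = 2" using True assms(5) by auto
      then show "expectation (\<lambda>\<omega>. \<xi> 1 \<omega> ^ ?e i) = 1" using xi1_moments by metis
    qed
    then show ?thesis using E True by simp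
  next
    case False
    then have "l \<noteq> l' \<and> l \<noteq> k' \<or> k \<noteq> l' \<and> k \<noteq> k'" using assms(5,6) by auto
    then have "\<exists>i\<in>{1..n}. ?e i = 1"
    proof
      assume "l \<noteq> l' \<and> l \<noteq> k'"
      then show ?thesis using assms by (intro bexI[of _ l]) auto
    next
      assume "k \<noteq> l' \<and> k \<noteq> k'"
      then show ?thesis using assms by (intro bexI[of _ k]) auto
    qed
    then obtain i where i: "i \<in> {1..n}" "?e i = 1" by blast
    then have "(\<Prod>i=1..n. expectation (\<lambda>\<omega>. \<xi> 1 \<omega> ^ ?e i)) = 0"
      using xi1_moments(2) by (intro prod_zero bexI[of _ i]) auto
    then show ?thesis unfolding E if_not_P[OF False] .
  qed
qed

lemma xi_squares:
  assumes l: "l \<in> {1..n}" and k: "k \<in> {1..n}"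
  shows "integrable M (\<lambda>\<omega>. ((\<xi> l \<omega>)\<^sup>2 - 1) * ((\<xi> k \<omega>)\<^sup>2 - 1))"
    and "expectation (\<lambda>\<omega>. ((\<xi> l \<omega>)\<^sup>2 - 1) * ((\<xi> k \<omega>)\<^sup>2 - 1)) = (if l = k then xi_star - 1 else 0)"
proof -
  let ?e = "\<lambda>i. of_bool (i = l) + of_bool (i = l) + of_bool (i = k) + of_bool (i = k) :: nat"
  note Q = xi_quadruple[OF l l k k]
  have eq: "(\<lambda>\<omega>. ((\<xi> l \<omega>)\<^sup>2 - 1) * ((\<xi> k \<omega>)\<^sup>2 - 1))
      = (\<lambda>\<omega>. \<xi> l \<omega> * \<xi> l \<omega> * \<xi> k \<omega> * \<xi> k \<omega> - (\<xi> l \<omega>)\<^sup>2 - (\<xi> k \<omega>)\<^sup>2 + 1)"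
    by (simp add: power2_eq_square algebra_simps)
  have sq: "integrable M (\<lambda>\<omega>. (\<xi> j \<omega>)\<^sup>2)" "expectation (\<lambda>\<omega>. (\<xi> j \<omega>)\<^sup>2) = 1" if "j \<in> {1..n}" for j
    using xi_power[OF that, of 2] xi1_moments by simp_all
  show "integrable M (\<lambda>\<omega>. ((\<xi> l \<omega>)\<^sup>2 - 1) * ((\<xi> k \<omega>)\<^sup>2 - 1))"
    unfolding eq using Q(1) sq l k by simp
  have "expectation (\<lambda>\<omega>. ((\<xi> l \<omega>)\<^sup>2 - 1) * ((\<xi> k \<omega>)\<^sup>2 - 1))
      = expectation (\<lambda>\<omega>. \<xi> l \<omega> * \<xi> l \<omega> * \<xi> k \<omega> * \<xi> k \<omega>) - 1"
    unfolding eq using Q(1) sq l k by (simp add: prob_space)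
  also have "\<dots> = (if l = k then xi_star - 1 else 0)"
  proof (cases "l = k")
    case True
    have "expectation (\<lambda>\<omega>. \<xi> l \<omega> * \<xi> l \<omega> * \<xi> k \<omega> * \<xi> k \<omega>) = expectation (\<lambda>\<omega>. \<xi> l \<omega> ^ 4)"
      using True by (intro Bochner_Integration.integral_cong) (auto simp: power4_eq_xxxx)
    then show ?thesis using xi_power(2)[OF l, of 4] xi1_moments True by simp
  next
    case False
    have "(\<Prod>i=1..n. expectation (\<lambda>\<omega>. \<xi> 1 \<omega> ^ ?e i)) = 1"
    proof (intro prod.neutral ballI)
      fix i
      have "?e i = 0 \<or> ?e i = 2" using False by auto
      then show "expectation (\<lambda>\<omega>. \<xi> 1 \<omega> ^ ?e i) = 1" using xi1_moments by metis
    qed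
    then show ?thesis using Q(2) False by simp
  qed
  finally show "expectation (\<lambda>\<omega>. ((\<xi> l \<omega>)\<^sup>2 - 1) * ((\<xi> k \<omega>)\<^sup>2 - 1)) = (if l = k then xi_star - 1 else 0)" .
qed

text \<open>The variance of the squared error is nonnegative; hence the square of
  \<open>xi_bar xi_star\<close> is indeed xi_star - 1.\<close>

lemma xi_star_ge_1: "1 \<le> xi_star"
proof -
  have "0 \<le> expectation (\<lambda>\<omega>. ((\<xi> 1 \<omega>)\<^sup>2 - 1) * ((\<xi> 1 \<omega>)\<^sup>2 - 1))"
    by (intro integral_nonneg_AE AE_I2) simp
  then show ?thesis unfolding xi_squares(2)[OF one_in one_in] by simp
qed

lemma xi_products:
  assumes "l \<in> {1..n}" "k \<in> {1..n}"
  shows "integrable M (\<lambda>\<omega>. \<xi> l \<omega> * \<xi> k \<omega>)"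
    and "expectation (\<lambda>\<omega>. \<xi> l \<omega> * \<xi> k \<omega>) = (if l = k then 1 else 0)"
proof -
  have int: "integrable M (\<xi> j)" "expectation (\<xi> j) = 0" "integrable M (\<lambda>\<omega>. (\<xi> j \<omega>)\<^sup>2)" "expectation (\<lambda>\<omega>. (\<xi> j \<omega>)\<^sup>2) = 1"
    if "j \<in> {1..n}" for j
    using xi_power[OF that, of 1] xi_power[OF that, of 2] xi1_moments by simp_all
  have ind: "indep_var borel (\<xi> l) borel (\<xi> k)" if "l \<noteq> k"
  proof -
    have "indep_vars (\<lambda>_. borel) \<xi> (insert l {k})"
      using xi_indep assms by (intro indep_vars_subset[OF xi_indep]) auto
    then show ?thesis using indep_vars_prod[of "{k}" l \<xi>] that by simp
  qed
  show "integrable M (\<lambda>\<omega>. \<xi> l \<omega> * \<xi> k \<omega>)"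
    using int assms indep_var_integrable[OF ind] by (cases "l = k") (auto simp: power2_eq_square)
  show "expectation (\<lambda>\<omega>. \<xi> l \<omega> * \<xi> k \<omega>) = (if l = k then 1 else 0)"
    using int assms indep_var_lebesgue_integral[OF ind] by (cases "l = k") (auto simp: power2_eq_square)
qed

section \<open>Second moments of linear and quadratic forms in the noise\<close>

lemma sigma_sq_bound: "AE \<omega> in M. \<forall>j\<in>{1..n}. 0 < \<sigma> j \<omega> \<and> (\<sigma> j \<omega>)\<^sup>2 \<le> sigma_star"
  using sigma_pos sigma_bound by (intro AE_finite_allI AE_conjI) auto

lemma sigma_star_pos: "0 < sigma_star"
proof -
  have "AE \<omega> in M. 0 < sigma_star"
    using sigma_sq_bound
  proof (rule AE_mp, intro AE_I2 impI)
    fix \<omega> assume "\<forall>j\<in>{1..n}. 0 < \<sigma> j \<omega> \<and> (\<sigma> j \<omega>)\<^sup>2 \<le> sigma_star"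
    then show "0 < sigma_star" using one_in by (meson less_le_trans zero_less_power)
  qed
  then show ?thesis by simp
qed

lemma sigma_sq:
  assumes "j \<in> {1..n}"
  shows "integrable M (\<lambda>\<omega>. (\<sigma> j \<omega>)\<^sup>2)" and "expectation (\<lambda>\<omega>. (\<sigma> j \<omega>)\<^sup>2) \<le> sigma_star"
proof -
  show i: "integrable M (\<lambda>\<omega>. (\<sigma> j \<omega>)\<^sup>2)"
    using sigma_bound[OF assms] sigma_measurable[OF assms] by (intro integrable_const_bound[of _ sigma_star]) auto
  show "expectation (\<lambda>\<omega>. (\<sigma> j \<omega>)\<^sup>2) \<le> sigma_star"
    using integral_mono_AE[OF i _ sigma_bound[OF assms]] by (simp add: prob_space)
qed

lemma linear_form_second_moment:
  shows "integrable M (\<lambda>\<omega>. (\<Sum>l=1..n. c l * \<sigma> l \<omega> * \<xi> l \<omega>)\<^sup>2)"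
    and "expectation (\<lambda>\<omega>. (\<Sum>l=1..n. c l * \<sigma> l \<omega> * \<xi> l \<omega>)\<^sup>2) = (\<Sum>l=1..n. (c l)\<^sup>2 * expectation (\<lambda>\<omega>. (\<sigma> l \<omega>)\<^sup>2))"
proof -
  \<comment> \<open>The form is rewritten through coordinates of the restricted vectors, because
    independence is assumed for these vectors as elements of the product space.\<close>
  have eq: "(\<Sum>l=1..n. c l * \<sigma> l \<omega> * \<xi> l \<omega>)
      = (\<Sum>l\<in>{1..n}. (c l * (\<lambda>j\<in>{1..n}. \<sigma> j \<omega>) l) * (\<lambda>j\<in>{1..n}. \<xi> j \<omega>) l)" for \<omega>
    by (intro sum.cong) auto
  note * = second_moment_orthogonal[OF sigma_xi_indep, of "{1..n}" "\<lambda>l s. c l * s l" "\<lambda>l x. x l" 1]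
  show "integrable M (\<lambda>\<omega>. (\<Sum>l=1..n. c l * \<sigma> l \<omega> * \<xi> l \<omega>)\<^sup>2)"
    unfolding eq using xi_products sigma_sq(1) by (intro *(1)) (auto simp: power_mult_distrib)
  have "expectation (\<lambda>\<omega>. (\<Sum>l=1..n. c l * \<sigma> l \<omega> * \<xi> l \<omega>)\<^sup>2)
      = 1 * (\<Sum>l\<in>{1..n}. expectation (\<lambda>\<omega>. (c l * (\<lambda>j\<in>{1..n}. \<sigma> j \<omega>) l)\<^sup>2))"
    unfolding eq using xi_products sigma_sq(1) by (intro *(2)) (auto simp: power_mult_distrib)
  then show "expectation (\<lambda>\<omega>. (\<Sum>l=1..n. c l * \<sigma> l \<omega> * \<xi> l \<omega>)\<^sup>2) = (\<Sum>l=1..n. (c l)\<^sup>2 * expectation (\<lambda>\<omega>. (\<sigma> l \<omega>)\<^sup>2))"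
    by (simp add: power_mult_distrib)
qed

lemma linear_form_mean:
  "integrable M (\<lambda>\<omega>. \<Sum>l=1..n. c l * \<sigma> l \<omega> * \<xi> l \<omega>)"
  "expectation (\<lambda>\<omega>. \<Sum>l=1..n. c l * \<sigma> l \<omega> * \<xi> l \<omega>) = 0"
proof -
  have s: "integrable M (\<sigma> l)" and x: "integrable M (\<xi> l)" "expectation (\<xi> l) = 0" if l: "l \<in> {1..n}" for l
    using square_integrable_imp_integrable[OF sigma_measurable sigma_sq(1)] xi_power[OF l, of 1] xi1_moments l by simp_all
  have ind: "indep_var borel (\<sigma> l) borel (\<xi> l)" if l: "l \<in> {1..n}" for l
    using indep_var_compose[OF sigma_xi_indep, of "\<lambda>s. s l" borel "\<lambda>s. s l" borel] l by (simp add: comp_def)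
  have eq: "c l * \<sigma> l \<omega> * \<xi> l \<omega> = c l * (\<sigma> l \<omega> * \<xi> l \<omega>)" for l \<omega> by simp
  note i = indep_var_integrable[OF ind s x(1)] and m = indep_var_lebesgue_integral[OF ind s x(1)]
  show "integrable M (\<lambda>\<omega>. \<Sum>l=1..n. c l * \<sigma> l \<omega> * \<xi> l \<omega>)"
    unfolding eq using i by (intro Bochner_Integration.integrable_sum integrable_mult_right) auto
  show "expectation (\<lambda>\<omega>. \<Sum>l=1..n. c l * \<sigma> l \<omega> * \<xi> l \<omega>) = 0"
    unfolding eq using i by (subst Bochner_Integration.integral_sum) (auto simp: m x)
qed

lemma centered_square_form_second_moment:
  shows "integrable M (\<lambda>\<omega>. (\<Sum>l=1..n. c l * (\<sigma> l \<omega>)\<^sup>2 * ((\<xi> l \<omega>)\<^sup>2 - 1))\<^sup>2)"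
    and "expectation (\<lambda>\<omega>. (\<Sum>l=1..n. c l * (\<sigma> l \<omega>)\<^sup>2 * ((\<xi> l \<omega>)\<^sup>2 - 1))\<^sup>2)
      \<le> (xi_star - 1) * sigma_star\<^sup>2 * (\<Sum>l=1..n. (c l)\<^sup>2)"
proof -
  have eq: "(\<Sum>l=1..n. c l * (\<sigma> l \<omega>)\<^sup>2 * ((\<xi> l \<omega>)\<^sup>2 - 1))
      = (\<Sum>l\<in>{1..n}. (c l * ((\<lambda>j\<in>{1..n}. \<sigma> j \<omega>) l)\<^sup>2) * (((\<lambda>j\<in>{1..n}. \<xi> j \<omega>) l)\<^sup>2 - 1))" for \<omega>
    by (intro sum.cong) auto
  have s4: "integrable M (\<lambda>\<omega>. (c l * (\<sigma> l \<omega>)\<^sup>2)\<^sup>2)"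
      "expectation (\<lambda>\<omega>. (c l * (\<sigma> l \<omega>)\<^sup>2)\<^sup>2) \<le> (c l)\<^sup>2 * sigma_star\<^sup>2" if l: "l \<in> {1..n}" for l
  proof -
    have "AE \<omega> in M. ((\<sigma> l \<omega>)\<^sup>2)\<^sup>2 \<le> sigma_star\<^sup>2"
      using sigma_bound[OF l] by eventually_elim (intro power_mono, auto)
    then have b: "AE \<omega> in M. (c l * (\<sigma> l \<omega>)\<^sup>2)\<^sup>2 \<le> (c l)\<^sup>2 * sigma_star\<^sup>2"
      by eventually_elim (auto simp: power_mult_distrib intro!: mult_left_mono)
    show i: "integrable M (\<lambda>\<omega>. (c l * (\<sigma> l \<omega>)\<^sup>2)\<^sup>2)"
      using b sigma_measurable[OF l] by (intro integrable_const_bound[of _ "(c l)\<^sup>2 * sigma_star\<^sup>2"]) auto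
    show "expectation (\<lambda>\<omega>. (c l * (\<sigma> l \<omega>)\<^sup>2)\<^sup>2) \<le> (c l)\<^sup>2 * sigma_star\<^sup>2"
      using integral_mono_AE[OF i _ b] by (simp add: prob_space)
  qed
  note * = second_moment_orthogonal[OF sigma_xi_indep, of "{1..n}" "\<lambda>l s. c l * (s l)\<^sup>2" "\<lambda>l x. (x l)\<^sup>2 - 1" "xi_star - 1"]
  show "integrable M (\<lambda>\<omega>. (\<Sum>l=1..n. c l * (\<sigma> l \<omega>)\<^sup>2 * ((\<xi> l \<omega>)\<^sup>2 - 1))\<^sup>2)"
    unfolding eq using xi_squares s4(1) by (intro *(1)) auto
  have "expectation (\<lambda>\<omega>. (\<Sum>l=1..n. c l * (\<sigma> l \<omega>)\<^sup>2 * ((\<xi> l \<omega>)\<^sup>2 - 1))\<^sup>2)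
      = (xi_star - 1) * (\<Sum>l\<in>{1..n}. expectation (\<lambda>\<omega>. (c l * ((\<lambda>j\<in>{1..n}. \<sigma> j \<omega>) l)\<^sup>2)\<^sup>2))"
    unfolding eq using xi_squares s4(1) by (intro *(2)) auto
  also have "\<dots> \<le> (xi_star - 1) * (\<Sum>l=1..n. (c l)\<^sup>2 * sigma_star\<^sup>2)"
    using xi_star_ge_1 s4(2) by (intro mult_left_mono sum_mono) auto
  also have "\<dots> = (xi_star - 1) * sigma_star\<^sup>2 * (\<Sum>l=1..n. (c l)\<^sup>2)"
    unfolding sum_distrib_right[symmetric] by (simp only: mult_ac)
  finally show "expectation (\<lambda>\<omega>. (\<Sum>l=1..n. c l * (\<sigma> l \<omega>)\<^sup>2 * ((\<xi> l \<omega>)\<^sup>2 - 1))\<^sup>2)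
      \<le> (xi_star - 1) * sigma_star\<^sup>2 * (\<Sum>l=1..n. (c l)\<^sup>2)" .
qed

text \<open>Dividing by \<open>\<Sum>\<^sub>i \<sigma>\<^sub>i\<^sup>2\<close> makes the second moment bounded by a constant
  although this sum has no deterministic lower bound.\<close>

lemma off_diagonal_form_second_moment:
  fixes c :: "nat \<times> nat \<Rightarrow> real"
  assumes C: "\<And>l. l \<in> {1..n} \<Longrightarrow> (\<Sum>k=1..n. (c (l, k))\<^sup>2) \<le> C"
  defines "P \<equiv> {(l, k). l \<in> {1..n} \<and> k \<in> {1..n} \<and> l < k}"
    and "V \<equiv> \<lambda>\<omega>. \<Sum>i=1..n. (\<sigma> i \<omega>)\<^sup>2"
  shows "integrable M (\<lambda>\<omega>. (\<Sum>(l, k)\<in>P. c (l, k) * \<sigma> l \<omega> * \<sigma> k \<omega> * (\<xi> l \<omega> * \<xi> k \<omega>))\<^sup>2 / V \<omega>)"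
    and "expectation (\<lambda>\<omega>. (\<Sum>(l, k)\<in>P. c (l, k) * \<sigma> l \<omega> * \<sigma> k \<omega> * (\<xi> l \<omega> * \<xi> k \<omega>))\<^sup>2 / V \<omega>)
      \<le> sigma_star * C"
proof -
  \<comment> \<open>The normaliser depends on the standard deviations alone, so its square root can
    be moved into the coefficient and stays independent of the errors.\<close>
  let ?A = "\<lambda>q s. c q * s (fst q) * s (snd q) / sqrt (\<Sum>i\<in>{1..n}. (s i)\<^sup>2)"
  let ?G = "\<lambda>q x. x (fst q) * x (snd q) :: real"
  let ?s = "\<lambda>\<omega>. \<lambda>j\<in>{1..n}. \<sigma> j \<omega>" and ?x = "\<lambda>\<omega>. \<lambda>j\<in>{1..n}. \<xi> j \<omega>"
  have V0: "0 \<le> V \<omega>" for \<omega> by (simp add: V_def sum_nonneg)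
  have Vs: "(\<Sum>i\<in>{1..n}. (?s \<omega> i)\<^sup>2) = V \<omega>" for \<omega> unfolding V_def by (intro sum.cong) auto
  have P: "fst q \<in> {1..n}" "snd q \<in> {1..n}" "fst q < snd q" if "q \<in> P" for q
    using that by (auto simp: P_def)
  have finP: "finite P" by (rule finite_subset[of _ "{1..n} \<times> {1..n}"]) (auto simp: P_def)
  have eq: "(\<Sum>(l, k)\<in>P. c (l, k) * \<sigma> l \<omega> * \<sigma> k \<omega> * (\<xi> l \<omega> * \<xi> k \<omega>))\<^sup>2 / V \<omega>
      = (\<Sum>q\<in>P. ?A q (?s \<omega>) * ?G q (?x \<omega>))\<^sup>2" for \<omega>
  proof -
    have "(\<Sum>q\<in>P. ?A q (?s \<omega>) * ?G q (?x \<omega>))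
       = (\<Sum>(l, k)\<in>P. c (l, k) * \<sigma> l \<omega> * \<sigma> k \<omega> * (\<xi> l \<omega> * \<xi> k \<omega>)) / sqrt (V \<omega>)"
      unfolding sum_divide_distrib Vs using P by (intro sum.cong refl) (auto simp: case_prod_unfold)
    then show ?thesis using V0[of \<omega>] by (simp add: power_divide)
  qed
  have Asq: "(?A q (?s \<omega>))\<^sup>2 = (c q)\<^sup>2 * ((\<sigma> (fst q) \<omega>)\<^sup>2 * (\<sigma> (snd q) \<omega>)\<^sup>2 / V \<omega>)" if "q \<in> P" for q \<omega>
    using P[OF that] V0[of \<omega>] unfolding Vs by (simp add: power_divide power_mult_distrib)
  have Abound: "(\<sigma> l \<omega>)\<^sup>2 * (\<sigma> k \<omega>)\<^sup>2 / V \<omega> \<le> sigma_star * ((\<sigma> l \<omega>)\<^sup>2 / V \<omega>)"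
    if "\<forall>j\<in>{1..n}. 0 < \<sigma> j \<omega> \<and> (\<sigma> j \<omega>)\<^sup>2 \<le> sigma_star" "k \<in> {1..n}" for l k \<omega>
  proof -
    have "(\<sigma> l \<omega>)\<^sup>2 * (\<sigma> k \<omega>)\<^sup>2 / V \<omega> \<le> (\<sigma> l \<omega>)\<^sup>2 * sigma_star / V \<omega>"
      using that V0[of \<omega>] by (intro divide_right_mono mult_left_mono) auto
    then show ?thesis by (simp add: mult_ac)
  qed
  \<comment> \<open>This also covers V = 0, where the quotient is 0.\<close>
  have frac: "(\<sigma> l \<omega>)\<^sup>2 / V \<omega> \<le> 1" if "l \<in> {1..n}" for l \<omega>
  proof -
    have "(\<sigma> l \<omega>)\<^sup>2 \<le> V \<omega>" unfolding V_def using that by (intro member_le_sum) auto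
    then show ?thesis using V0[of \<omega>] by (auto simp: divide_le_eq_1)
  qed
  have Vmeas: "V \<in> borel_measurable M"
    unfolding V_def using sigma_measurable by (intro borel_measurable_sum borel_measurable_power) auto
  have Ai: "integrable M (\<lambda>\<omega>. (?A q (?s \<omega>))\<^sup>2)" if q: "q \<in> P" for q
    unfolding Asq[OF q]
  proof (intro integrable_mult_right integrable_const_bound[of _ sigma_star])
    show "AE \<omega> in M. norm ((\<sigma> (fst q) \<omega>)\<^sup>2 * (\<sigma> (snd q) \<omega>)\<^sup>2 / V \<omega>) \<le> sigma_star"
      using sigma_sq_bound
    proof eventually_elim
      case (elim \<omega>)
      have "(\<sigma> (fst q) \<omega>)\<^sup>2 * (\<sigma> (snd q) \<omega>)\<^sup>2 / V \<omega> \<le> sigma_star * ((\<sigma> (fst q) \<omega>)\<^sup>2 / V \<omega>)"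
        using Abound[OF elim] P[OF q] by blast
      also have "\<dots> \<le> sigma_star * 1" using sigma_star_pos frac P[OF q] by (intro mult_left_mono) auto
      finally show ?case using V0[of \<omega>] by simp
    qed
    show "(\<lambda>\<omega>. (\<sigma> (fst q) \<omega>)\<^sup>2 * (\<sigma> (snd q) \<omega>)\<^sup>2 / V \<omega>) \<in> borel_measurable M"
      using Vmeas sigma_measurable P[OF q] by (intro borel_measurable_divide borel_measurable_times borel_measurable_power) auto
  qed
  have GG: "integrable M (\<lambda>\<omega>. ?G q (?x \<omega>) * ?G q' (?x \<omega>))"
    "expectation (\<lambda>\<omega>. ?G q (?x \<omega>) * ?G q' (?x \<omega>)) = (if q = q' then 1 else 0)"
    if q: "q \<in> P" "q' \<in> P" for q q'
    using xi_quadruple(1)[of "fst q" "snd q" "fst q'" "snd q'"]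
      xi_pairs_orthogonal[of "fst q" "snd q" "fst q'" "snd q'"] P[OF q(1)] P[OF q(2)]
    by (simp_all add: mult.assoc prod_eq_iff)
  note comp = measurable_component_singleton[of _ "{1..n}" "\<lambda>_. borel :: real measure"]
  have Am: "?A q \<in> borel_measurable (Pi\<^sub>M {1..n} (\<lambda>_. borel))" and Gm: "?G q \<in> borel_measurable (Pi\<^sub>M {1..n} (\<lambda>_. borel))"
    if q: "q \<in> P" for q
    using P[OF q]
    by (intro borel_measurable_divide borel_measurable_times borel_measurable_sum borel_measurable_power
        borel_measurable_const borel_measurable_sqrt measurable_compose[OF _ borel_measurable_sqrt] comp; simp)+
  note * = second_moment_orthogonal[OF sigma_xi_indep finP, of ?A ?G 1, OF Am Gm Ai GG]
  show "integrable M (\<lambda>\<omega>. (\<Sum>(l, k)\<in>P. c (l, k) * \<sigma> l \<omega> * \<sigma> k \<omega> * (\<xi> l \<omega> * \<xi> k \<omega>))\<^sup>2 / V \<omega>)"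
    unfolding eq by (rule *(1))
  have "expectation (\<lambda>\<omega>. (\<Sum>(l, k)\<in>P. c (l, k) * \<sigma> l \<omega> * \<sigma> k \<omega> * (\<xi> l \<omega> * \<xi> k \<omega>))\<^sup>2 / V \<omega>)
      = (\<Sum>q\<in>P. expectation (\<lambda>\<omega>. (?A q (?s \<omega>))\<^sup>2))"
    unfolding eq using *(2) by simp
  also have "\<dots> = expectation (\<lambda>\<omega>. \<Sum>q\<in>P. (?A q (?s \<omega>))\<^sup>2)"
    using Ai by (intro Bochner_Integration.integral_sum[symmetric]) auto
  also have "\<dots> \<le> expectation (\<lambda>\<omega>. sigma_star * C)"
  proof (rule integral_mono_AE)
    show "integrable M (\<lambda>\<omega>. \<Sum>q\<in>P. (?A q (?s \<omega>))\<^sup>2)" using Ai by (intro Bochner_Integration.integrable_sum) auto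
    show "AE \<omega> in M. (\<Sum>q\<in>P. (?A q (?s \<omega>))\<^sup>2) \<le> sigma_star * C"
      using sigma_sq_bound
    proof eventually_elim
      case (elim \<omega>)
      have Vpos: "0 < V \<omega>" unfolding V_def using elim n_pos by (intro sum_pos zero_less_power) auto
      have "(\<Sum>q\<in>P. (?A q (?s \<omega>))\<^sup>2) = (\<Sum>q\<in>P. (c q)\<^sup>2 * ((\<sigma> (fst q) \<omega>)\<^sup>2 * (\<sigma> (snd q) \<omega>)\<^sup>2 / V \<omega>))"
        by (intro sum.cong refl Asq)
      also have "\<dots> \<le> (\<Sum>q\<in>P. (c q)\<^sup>2 * (sigma_star * ((\<sigma> (fst q) \<omega>)\<^sup>2 / V \<omega>)))"
        using Abound[OF elim] P by (intro sum_mono mult_left_mono) auto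
      \<comment> \<open>Passing from the triangle to the full square gives complete rows, to which
        the bound \<open>C\<close> applies; the remaining fractions of \<open>V\<close> add up to
        1.\<close>
      also have "\<dots> \<le> (\<Sum>q\<in>{1..n}\<times>{1..n}. (c q)\<^sup>2 * (sigma_star * ((\<sigma> (fst q) \<omega>)\<^sup>2 / V \<omega>)))"
        using sigma_star_pos Vpos by (intro sum_mono2) (auto simp: P_def)
      also have "\<dots> = (\<Sum>l=1..n. sigma_star * ((\<sigma> l \<omega>)\<^sup>2 / V \<omega>) * (\<Sum>k=1..n. (c (l, k))\<^sup>2))"
        unfolding sum_distrib_left sum.cartesian_product by (intro sum.cong) (auto simp: mult_ac)
      also have "\<dots> \<le> (\<Sum>l=1..n. sigma_star * ((\<sigma> l \<omega>)\<^sup>2 / V \<omega>) * C)"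
        using C sigma_star_pos Vpos by (intro sum_mono mult_left_mono) auto
      also have "\<dots> = sigma_star * C * ((\<Sum>l=1..n. (\<sigma> l \<omega>)\<^sup>2) / V \<omega>)"
        by (simp add: sum_distrib_left sum_divide_distrib mult_ac)
      also have "\<dots> = sigma_star * C" using Vpos unfolding V_def by simp
      finally show ?case .
    qed
  qed simp
  also have "\<dots> = sigma_star * C" by (simp add: prob_space)
  finally show "expectation (\<lambda>\<omega>. (\<Sum>(l, k)\<in>P. c (l, k) * \<sigma> l \<omega> * \<sigma> k \<omega> * (\<xi> l \<omega> * \<xi> k \<omega>))\<^sup>2 / V \<omega>)
      \<le> sigma_star * C" .
qed

end

section \<open>The oracle inequality\<close>

lemma double_sum_symmetric:
  fixes F :: "nat \<Rightarrow> nat \<Rightarrow> real"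
  assumes sym: "\<And>l k. F l k = F k l"
  shows "(\<Sum>l=1..n. \<Sum>k=1..n. F l k)
    = (\<Sum>l=1..n. F l l) + 2 * (\<Sum>(l, k)\<in>{(l, k). l \<in> {1..n} \<and> k \<in> {1..n} \<and> l < k}. F l k)"
proof -
  let ?D = "{(l, k). l \<in> {1..n} \<and> k \<in> {1..n} \<and> l = k}"
  let ?P = "{(l, k). l \<in> {1..n} \<and> k \<in> {1..n} \<and> l < k}"
  let ?Q = "{(l, k). l \<in> {1..n} \<and> k \<in> {1..n} \<and> k < l}"
  have fin: "finite ?D" "finite ?P" "finite ?Q"
    by (rule finite_subset[of _ "{1..n} \<times> {1..n}"]; auto)+
  have "(\<Sum>l=1..n. \<Sum>k=1..n. F l k) = (\<Sum>(l, k)\<in>{1..n}\<times>{1..n}. F l k)"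
    by (rule sum.cartesian_product)
  also have "{1..n} \<times> {1..n} = ?D \<union> (?P \<union> ?Q)" by auto
  also have "(\<Sum>(l, k)\<in>?D \<union> (?P \<union> ?Q). F l k)
      = (\<Sum>(l, k)\<in>?D. F l k) + ((\<Sum>(l, k)\<in>?P. F l k) + (\<Sum>(l, k)\<in>?Q. F l k))"
    using fin by (subst sum.union_disjoint; (subst sum.union_disjoint)?) auto
  also have "(\<Sum>(l, k)\<in>?D. F l k) = (\<Sum>l=1..n. F l l)"
    by (rule sum.reindex_bij_witness[where i = "\<lambda>l. (l, l)" and j = fst]) auto
  also have "(\<Sum>(l, k)\<in>?Q. F l k) = (\<Sum>(l, k)\<in>?P. F l k)"
    by (rule sum.reindex_bij_witness[where i = prod.swap and j = prod.swap]) (auto simp: sym)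
  finally show ?thesis by simp
qed

text \<open>The case s = 0 is meant to be covered: the right-hand side is then 0 because x / 0 = 0,
  so \<open>M\<close> is required to vanish with \<open>s\<close>.\<close>

lemma young_quotient:
  fixes a s M :: real
  assumes "0 < a" "0 \<le> s" "s = 0 \<Longrightarrow> M = 0"
  shows "2 * \<bar>M\<bar> \<le> a * s + M\<^sup>2 / (a * s)"
proof (cases "s = 0")
  case False
  then have as: "0 < a * s" using assms by simp
  have "2 * \<bar>M\<bar> * (a * s) \<le> (a * s)\<^sup>2 + M\<^sup>2"
    using sum_squares_bound[of "\<bar>M\<bar>" "a * s"] by simp
  then have "2 * \<bar>M\<bar> \<le> ((a * s)\<^sup>2 + M\<^sup>2) / (a * s)"
    using as by (simp add: pos_le_divide_eq)
  also have "\<dots> = a * s + M\<^sup>2 / (a * s)" using as by (simp add: add_divide_distrib power2_eq_square)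
  finally show ?thesis .
qed (use assms in simp)

text \<open>Companion of \<open>young_quotient\<close>: a moment bound proportional to the
  normaliser leaves a constant, also when the normaliser vanishes and the quotient is 0.\<close>

lemma ratio_le:
  fixes a c s x :: real
  assumes "0 < a" "0 \<le> c" "0 \<le> s" "x \<le> c * s"
  shows "x / (a * s) \<le> c / a"
proof (cases "s = 0")
  case False
  then have "x / (a * s) \<le> c * s / (a * s)" using assms by (intro divide_right_mono) auto
  then show ?thesis using False by simp
qed (use assms in simp)

text \<open>The signal energy \<open>\<Sum> x\<^sup>2 \<theta>\<^sup>2\<close> is compared with its empirical version, which the two losses dominate.\<close>

lemma linear_term_le:
  fixes \<theta> \<zeta> w u :: "nat \<Rightarrow> real" and I :: "nat set"
  assumes I: "finite I" and \<rho>: "0 < \<rho>" "\<rho> < 1"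
  defines "s \<equiv> \<Sum>j\<in>I. (w j - u j)\<^sup>2 * (\<theta> j)\<^sup>2"
  shows "2 * (\<Sum>j\<in>I. (w j - u j) * \<theta> j * \<zeta> j)
    \<le> 2 * \<rho> / (1 - \<rho>) * ((\<Sum>j\<in>I. (w j * (\<theta> j + \<zeta> j) - \<theta> j)\<^sup>2) + (\<Sum>j\<in>I. (u j * (\<theta> j + \<zeta> j) - \<theta> j)\<^sup>2))
      + (\<Sum>j\<in>I. (w j - u j) * \<theta> j * \<zeta> j)\<^sup>2 / (\<rho> * s)
      + (\<Sum>j\<in>I. (w j - u j)\<^sup>2 * \<theta> j * \<zeta> j)\<^sup>2 / ((1 - \<rho>) * s)"
proof -
  define a where "a = (\<Sum>j\<in>I. (w j - u j) * \<theta> j * \<zeta> j)"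
  define b where "b = (\<Sum>j\<in>I. (w j - u j)\<^sup>2 * \<theta> j * \<zeta> j)"
  define E where "E = (\<Sum>j\<in>I. (w j * (\<theta> j + \<zeta> j) - \<theta> j)\<^sup>2) + (\<Sum>j\<in>I. (u j * (\<theta> j + \<zeta> j) - \<theta> j)\<^sup>2)"
  have s0: "0 \<le> s" unfolding s_def by (intro sum_nonneg) simp
  have zero: "(w j - u j) * \<theta> j = 0" if "s = 0" "j \<in> I" for j
  proof -
    have "\<forall>j\<in>I. (w j - u j)\<^sup>2 * (\<theta> j)\<^sup>2 = 0"
      using that(1) sum_nonneg_eq_0_iff[OF I, of "\<lambda>j. (w j - u j)\<^sup>2 * (\<theta> j)\<^sup>2"] unfolding s_def by simp
    then show ?thesis using that(2) by auto
  qed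
  have a0: "a = 0" if "s = 0" unfolding a_def using zero[OF that] by (intro sum.neutral ballI) simp
  have b0: "b = 0" if "s = 0"
    unfolding b_def using zero[OF that] by (intro sum.neutral ballI) (simp add: power2_eq_square)
  \<comment> \<open>Expanding the square of \<theta> + \<zeta> and dropping the pure noise part
    shows that the signal energy \<open>s\<close> exceeds the empirical energy by at most -2
    b.\<close>
  have "s + 2 * b \<le> (\<Sum>j\<in>I. (w j - u j)\<^sup>2 * (\<theta> j + \<zeta> j)\<^sup>2)"
    unfolding s_def b_def sum_distrib_left sum.distrib[symmetric]
  proof (rule sum_mono)
    fix j
    have "0 \<le> (w j - u j)\<^sup>2 * (\<zeta> j)\<^sup>2" by simp
    then show "(w j - u j)\<^sup>2 * (\<theta> j)\<^sup>2 + 2 * ((w j - u j)\<^sup>2 * \<theta> j * \<zeta> j) \<le> (w j - u j)\<^sup>2 * (\<theta> j + \<zeta> j)\<^sup>2"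
      by (simp add: power2_sum distrib_left mult_ac)
  qed
  \<comment> \<open>(w - u) (\<theta> + \<zeta>) is the difference of the residuals of
    \<open>w\<close> and \<open>u\<close>, since \<theta> cancels.\<close>
  also have "\<dots> \<le> 2 * E"
    unfolding E_def sum.distrib[symmetric] sum_distrib_left
  proof (rule sum_mono)
    fix j
    have "(c - d)\<^sup>2 \<le> 2 * (c\<^sup>2 + d\<^sup>2)" for c d :: real
      using zero_le_power2[of "c + d"] by (simp add: power2_sum power2_diff)
    from this[of "w j * (\<theta> j + \<zeta> j) - \<theta> j" "u j * (\<theta> j + \<zeta> j) - \<theta> j"]
    show "(w j - u j)\<^sup>2 * (\<theta> j + \<zeta> j)\<^sup>2
        \<le> 2 * ((w j * (\<theta> j + \<zeta> j) - \<theta> j)\<^sup>2 + (u j * (\<theta> j + \<zeta> j) - \<theta> j)\<^sup>2)"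
      by (simp add: power_mult_distrib[symmetric] left_diff_distrib)
  qed
  finally have "s + 2 * b \<le> 2 * E" .
  \<comment> \<open>The share \<rho> s returns to the left and leaves (1 - \<rho>) s; this is the
    origin of 2 \<rho> / (1 - \<rho>) and of the second quotient in the claim.\<close>
  moreover have "- 2 * b \<le> \<rho> * s + b\<^sup>2 / (\<rho> * s)"
    using young_quotient[OF \<rho>(1) s0 b0] by linarith
  moreover have "(1 - \<rho>) * s = s - \<rho> * s" by (simp add: left_diff_distrib)
  ultimately have "(1 - \<rho>) * s \<le> 2 * E + b\<^sup>2 / (\<rho> * s)" by linarith
  then have "s \<le> (2 * E + b\<^sup>2 / (\<rho> * s)) / (1 - \<rho>)"
    using \<rho> by (simp add: pos_le_divide_eq mult.commute)
  then have "\<rho> * s \<le> \<rho> * ((2 * E + b\<^sup>2 / (\<rho> * s)) / (1 - \<rho>))"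
    using \<rho> by (intro mult_left_mono) auto
  also have "\<dots> = 2 * \<rho> / (1 - \<rho>) * E + b\<^sup>2 / ((1 - \<rho>) * s)"
  proof -
    have "\<rho> * (b\<^sup>2 / (\<rho> * s)) = b\<^sup>2 / s" using \<rho> by simp
    then show ?thesis
      by (simp only: times_divide_eq_right distrib_left add_divide_distrib)
         (simp add: mult_ac)
  qed
  finally have "\<rho> * s \<le> 2 * \<rho> / (1 - \<rho>) * E + b\<^sup>2 / ((1 - \<rho>) * s)" .
  moreover have "2 * a \<le> \<rho> * s + a\<^sup>2 / (\<rho> * s)"
    using young_quotient[OF \<rho>(1) s0 a0] by linarith
  ultimately show ?thesis unfolding a_def b_def E_def by linarith
qed

lemma abs_trig_bar_le: "\<bar>trig_bar j x\<bar> \<le> 1"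
proof -
  have "0 \<le> (trig j x)\<^sup>2" "(trig j x)\<^sup>2 \<le> 2"
    using abs_cos_le_one abs_sin_le_one by (auto simp: trig_def power_mult_distrib abs_square_le_1)
  then show ?thesis by (auto simp: trig_bar_def abs_le_iff)
qed

lemma varrho_bar_ge:
  assumes "finite \<Lambda>" "w \<in> \<Lambda>" "x \<in> {0..1}"
  shows "\<bar>\<Sum>j=1..n. (w j) ^ i * trig_bar j x\<bar> \<le> varrho_bar i n \<Lambda>"
proof -
  have "\<bar>\<Sum>j=1..n. (w j) ^ i * trig_bar j x\<bar> \<le> (\<Sum>j=1..n. \<bar>w j ^ i\<bar>)" for x
    using abs_trig_bar_le
    by (intro order_trans[OF sum_abs] sum_mono) (auto simp: abs_mult intro: mult_left_le)
  then have "bdd_above ((\<lambda>x. \<bar>\<Sum>j=1..n. (w j) ^ i * trig_bar j x\<bar>) ` {0..1})"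
    by (intro bdd_aboveI2)
  then have "\<bar>\<Sum>j=1..n. (w j) ^ i * trig_bar j x\<bar> \<le> (SUP x\<in>{0..1}. \<bar>\<Sum>j=1..n. (w j) ^ i * trig_bar j x\<bar>)"
    using assms(3) by (rule cSUP_upper[rotated])
  also have "\<dots> \<le> varrho_bar i n \<Lambda>"
    unfolding varrho_bar_def using assms by (intro Max_ge) auto
  finally show ?thesis .
qed

lemma varrho_ge: "finite \<Lambda> \<Longrightarrow> w \<in> \<Lambda> \<Longrightarrow> (\<Sum>j=1..n. w j) \<le> varrho n \<Lambda>"
  unfolding varrho_def by (intro Max_ge) auto

lemma design_in_unit: "l \<in> {1..n} \<Longrightarrow> design n l \<in> {0..1}"
  by (simp add: design_def divide_le_eq_1)

section \<open>Loss, cost and the decomposition of the noise\<close>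

locale regression_model = odd_regression_noise +
  fixes S :: "real \<Rightarrow> real"
begin

definition theta :: "nat \<Rightarrow> real" where
  "theta j = inner_n n S (trig j)"

definition zeta :: "'a \<Rightarrow> nat \<Rightarrow> real" where
  "zeta \<omega> j = (\<Sum>l=1..n. trig j (design n l) / n * \<sigma> l \<omega> * \<xi> l \<omega>)"

text \<open>The average of the noise variances divided once more by \<open>n\<close>;
  \<open>varsigma_hat\<close> divided by \<open>n\<close> is its estimator.\<close>

definition noise_level :: "'a \<Rightarrow> real" where
  "noise_level \<omega> = (\<Sum>l=1..n. (\<sigma> l \<omega>)\<^sup>2) / (real n)\<^sup>2"

definition loss :: "(nat \<Rightarrow> real) \<Rightarrow> 'a \<Rightarrow> real" where
  "loss w \<omega> = normsq_n n (\<lambda>x. S_hat n (observation n S \<sigma> \<xi> \<omega>) w x - S x)"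

text \<open>Divided by n^2, this is the matrix of the quadratic form \<Sum> w_j \<zeta>_j^2 in the
  products of standard deviation and error.\<close>

definition kernel :: "(nat \<Rightarrow> real) \<Rightarrow> nat \<Rightarrow> nat \<Rightarrow> real" where
  "kernel w l k = (\<Sum>j=1..n. w j * trig j (design n l) * trig j (design n k))"

definition diagonal_form :: "(nat \<Rightarrow> real) \<Rightarrow> 'a \<Rightarrow> real" where
  "diagonal_form w \<omega> = (\<Sum>l=1..n. kernel w l l / (real n)\<^sup>2 * (\<sigma> l \<omega>)\<^sup>2 * ((\<xi> l \<omega>)\<^sup>2 - 1))"

definition off_diagonal_form :: "(nat \<Rightarrow> real) \<Rightarrow> 'a \<Rightarrow> real" where
  "off_diagonal_form w \<omega> = (\<Sum>(l, k)\<in>{(l, k). l \<in> {1..n} \<and> k \<in> {1..n} \<and> l < k}.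
     2 * kernel w l k / (real n)\<^sup>2 * \<sigma> l \<omega> * \<sigma> k \<omega> * (\<xi> l \<omega> * \<xi> k \<omega>))"

text \<open>The effect of unequal variances on the quadratic form: it vanishes for constant standard
  deviations, because each squared basis function averages to 1 over the design.\<close>

definition bias_form :: "(nat \<Rightarrow> real) \<Rightarrow> 'a \<Rightarrow> real" where
  "bias_form w \<omega> = (\<Sum>l=1..n. (\<sigma> l \<omega>)\<^sup>2 / (real n)\<^sup>2 * (\<Sum>j=1..n. w j * trig_bar j (design n l)))"

lemma theta_hat_eq: "theta_hat n (observation n S \<sigma> \<xi> \<omega>) j = theta j + zeta \<omega> j"
  unfolding theta_hat_def theta_def inner_n_def zeta_def observation_def
  by (simp add: distrib_right sum.distrib distrib_left sum_distrib_left mult_ac)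

text \<open>Parseval for the residual at the design points, whose \<open>i\<close>-th coefficient is
  the weighted empirical coefficient minus the true one.\<close>

lemma loss_eq: "loss w \<omega> = (\<Sum>j=1..n. (w j * (theta j + zeta \<omega> j) - theta j)\<^sup>2)"
proof -
  define f where "f l = S_hat n (observation n S \<sigma> \<xi> \<omega>) w (design n l) - S (design n l)" for l
  have "1 / n * (\<Sum>l=1..n. f l * trig i (design n l)) = w i * (theta i + zeta \<omega> i) - theta i"
    if "i \<in> {1..n}" for i
  proof -
    have "(\<Sum>l=1..n. f l * trig i (design n l))
        = (\<Sum>l=1..n. (\<Sum>j=1..n. w j * (theta j + zeta \<omega> j) * trig j (design n l)) * trig i (design n l))
          - (\<Sum>l=1..n. S (design n l) * trig i (design n l))"
      by (simp add: f_def S_hat_def theta_hat_eq left_diff_distrib sum_subtractf)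
    then show ?thesis
      using trig_coefficient[OF n_odd that, of "\<lambda>j. w j * (theta j + zeta \<omega> j)"]
      by (simp add: right_diff_distrib theta_def inner_n_def)
  qed
  then have "(\<Sum>j=1..n. (w j * (theta j + zeta \<omega> j) - theta j)\<^sup>2)
      = (\<Sum>j=1..n. (1 / n * (\<Sum>l=1..n. f l * trig j (design n l)))\<^sup>2)" by simp
  also have "\<dots> = 1 / n * (\<Sum>l=1..n. (f l)\<^sup>2)" by (rule trig_parseval[OF n_odd])
  also have "\<dots> = loss w \<omega>" by (simp add: loss_def normsq_n_def inner_n_def f_def power2_eq_square)
  finally show ?thesis by simp
qed

lemma loss_nonneg: "0 \<le> loss w \<omega>"
  unfolding loss_eq by (intro sum_nonneg) simp

lemma zeta_combination:
  "(\<Sum>j=1..n. b j * zeta \<omega> j) = (\<Sum>l=1..n. (\<Sum>j=1..n. b j * trig j (design n l)) / n * \<sigma> l \<omega> * \<xi> l \<omega>)"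
proof -
  have "(\<Sum>j=1..n. b j * zeta \<omega> j) = (\<Sum>j=1..n. \<Sum>l=1..n. b j * trig j (design n l) / n * \<sigma> l \<omega> * \<xi> l \<omega>)"
    by (simp add: zeta_def sum_distrib_left mult_ac)
  also have "\<dots> = (\<Sum>l=1..n. \<Sum>j=1..n. b j * trig j (design n l) / n * \<sigma> l \<omega> * \<xi> l \<omega>)"
    by (rule sum.swap)
  finally show ?thesis by (simp add: sum_distrib_right sum_divide_distrib)
qed

text \<open>The \<open>zeta\<close> may be correlated when the variances differ, but bounding each
  mean variance by \<open>sigma_star\<close> before using \<open>trig_synthesis_normsq\<close> gives
  the bound for uncorrelated coefficients of variance sigma_star / n.\<close>

lemma zeta_combination_second_moment:
  shows "integrable M (\<lambda>\<omega>. (\<Sum>j=1..n. b j * zeta \<omega> j)\<^sup>2)"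
    and "expectation (\<lambda>\<omega>. (\<Sum>j=1..n. b j * zeta \<omega> j)\<^sup>2) \<le> sigma_star / n * (\<Sum>j=1..n. (b j)\<^sup>2)"
proof -
  show "integrable M (\<lambda>\<omega>. (\<Sum>j=1..n. b j * zeta \<omega> j)\<^sup>2)"
    unfolding zeta_combination by (rule linear_form_second_moment)
  have "expectation (\<lambda>\<omega>. (\<Sum>j=1..n. b j * zeta \<omega> j)\<^sup>2)
      = (\<Sum>l=1..n. ((\<Sum>j=1..n. b j * trig j (design n l)) / n)\<^sup>2 * expectation (\<lambda>\<omega>. (\<sigma> l \<omega>)\<^sup>2))"
    unfolding zeta_combination by (rule linear_form_second_moment)
  also have "\<dots> \<le> (\<Sum>l=1..n. ((\<Sum>j=1..n. b j * trig j (design n l)) / n)\<^sup>2 * sigma_star)"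
    using sigma_sq(2) by (intro sum_mono mult_left_mono) auto
  also have "\<dots> = sigma_star / (real n)\<^sup>2 * (\<Sum>l=1..n. (\<Sum>j=1..n. b j * trig j (design n l))\<^sup>2)"
    by (simp add: power_divide sum_distrib_left mult_ac)
  also have "\<dots> = sigma_star / n * (\<Sum>j=1..n. (b j)\<^sup>2)"
    using n_pos unfolding trig_synthesis_normsq[OF n_odd] by (simp add: power2_eq_square)
  finally show "expectation (\<lambda>\<omega>. (\<Sum>j=1..n. b j * zeta \<omega> j)\<^sup>2) \<le> sigma_star / n * (\<Sum>j=1..n. (b j)\<^sup>2)" .
qed

lemma zeta_moments:
  shows "integrable M (\<lambda>\<omega>. zeta \<omega> j)" "expectation (\<lambda>\<omega>. zeta \<omega> j) = 0" "integrable M (\<lambda>\<omega>. (zeta \<omega> j)\<^sup>2)"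
    and "expectation (\<lambda>\<omega>. (zeta \<omega> j)\<^sup>2) = (\<Sum>l=1..n. (trig j (design n l))\<^sup>2 / (real n)\<^sup>2 * expectation (\<lambda>\<omega>. (\<sigma> l \<omega>)\<^sup>2))"
  using linear_form_mean[of "\<lambda>l. trig j (design n l) / n"] linear_form_second_moment[of "\<lambda>l. trig j (design n l) / n"]
  unfolding zeta_def power_divide by blast+

lemma zeta_sq_le:
  assumes "j \<in> {1..n}"
  shows "expectation (\<lambda>\<omega>. (zeta \<omega> j)\<^sup>2) \<le> sigma_star / n"
proof -
  have "(\<Sum>i=1..n. of_bool (i = j) * zeta \<omega> i) = zeta \<omega> j" for \<omega>
    using assms by (simp add: of_bool_def if_distrib[of "\<lambda>x. x * _"] cong: if_cong)
  moreover have "(\<Sum>i=1..n. (of_bool (i = j) :: real)\<^sup>2) = 1"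
    using assms by (simp add: of_bool_def if_distrib[of "\<lambda>x. x\<^sup>2"] cong: if_cong)
  ultimately show ?thesis
    using zeta_combination_second_moment(2)[of "\<lambda>i. of_bool (i = j)"] by simp
qed

lemma zeta_measurable: "(\<lambda>\<omega>. zeta \<omega> j) \<in> borel_measurable M"
  using zeta_moments(1) by blast

lemma noise_level_moments:
  shows "integrable M noise_level" "expectation noise_level = (\<Sum>l=1..n. expectation (\<lambda>\<omega>. (\<sigma> l \<omega>)\<^sup>2)) / (real n)\<^sup>2"
    "expectation noise_level \<le> sigma_star / n"
proof -
  show "integrable M noise_level"
    unfolding noise_level_def[abs_def] using sigma_sq(1) by (intro integrable_divide Bochner_Integration.integrable_sum) auto
  show eq: "expectation noise_level = (\<Sum>l=1..n. expectation (\<lambda>\<omega>. (\<sigma> l \<omega>)\<^sup>2)) / (real n)\<^sup>2"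
    unfolding noise_level_def[abs_def] using sigma_sq(1)
    by simp
  have "(\<Sum>l=1..n. expectation (\<lambda>\<omega>. (\<sigma> l \<omega>)\<^sup>2)) \<le> (\<Sum>l=1..n. sigma_star)"
    using sigma_sq(2) by (intro sum_mono) auto
  then show "expectation noise_level \<le> sigma_star / n"
    unfolding eq using n_pos by (simp add: power2_eq_square field_simps)
qed

lemma noise_level_nonneg: "0 \<le> noise_level \<omega>"
  unfolding noise_level_def by (intro divide_nonneg_nonneg sum_nonneg) auto

lemma loss_moments:
  shows "integrable M (loss w)"
    and "expectation (loss w) = (\<Sum>j=1..n. ((1 - w j) * theta j)\<^sup>2) + (\<Sum>j=1..n. (w j)\<^sup>2 * expectation (\<lambda>\<omega>. (zeta \<omega> j)\<^sup>2))"
proof -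
  have eq: "loss w = (\<lambda>\<omega>. \<Sum>j=1..n. ((1 - w j) * theta j)\<^sup>2 + (w j)\<^sup>2 * (zeta \<omega> j)\<^sup>2 - 2 * (1 - w j) * theta j * w j * zeta \<omega> j)"
    unfolding loss_eq by (auto intro!: ext sum.cong simp: power2_eq_square algebra_simps)
  show "integrable M (loss w)"
    unfolding eq using zeta_moments by simp
  show "expectation (loss w) = (\<Sum>j=1..n. ((1 - w j) * theta j)\<^sup>2) + (\<Sum>j=1..n. (w j)\<^sup>2 * expectation (\<lambda>\<omega>. (zeta \<omega> j)\<^sup>2))"
    unfolding eq using zeta_moments by (simp add: prob_space sum.distrib)
qed

text \<open>On the diagonal, the squared error is 1 plus its centred part, and the squared basis
  function is 1 plus \<open>trig_bar\<close>. The product of the two units is the noise-level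
  term.\<close>

lemma quadratic_noise_decomposition:
  "(\<Sum>j=1..n. w j * (zeta \<omega> j)\<^sup>2)
    = diagonal_form w \<omega> + off_diagonal_form w \<omega> + bias_form w \<omega> + (\<Sum>j=1..n. w j) * noise_level \<omega>"
proof -
  define F where "F l k = kernel w l k / (real n)\<^sup>2 * \<sigma> l \<omega> * \<sigma> k \<omega> * (\<xi> l \<omega> * \<xi> k \<omega>)" for l k
  have "(\<Sum>j=1..n. w j * (zeta \<omega> j)\<^sup>2)
      = (\<Sum>j=1..n. \<Sum>l=1..n. \<Sum>k=1..n. w j * trig j (design n l) * trig j (design n k)
          / (real n)\<^sup>2 * \<sigma> l \<omega> * \<sigma> k \<omega> * (\<xi> l \<omega> * \<xi> k \<omega>))"
    by (simp add: zeta_def power2_eq_square sum_product sum_distrib_left mult_ac)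
  also have "\<dots> = (\<Sum>l=1..n. \<Sum>k=1..n. F l k)"
    by (subst sum.swap, rule sum.cong[OF refl], subst sum.swap)
       (simp add: F_def kernel_def sum_distrib_right sum_divide_distrib)
  also have "\<dots> = (\<Sum>l=1..n. F l l) + 2 * (\<Sum>(l, k)\<in>{(l, k). l \<in> {1..n} \<and> k \<in> {1..n} \<and> l < k}. F l k)"
    by (rule double_sum_symmetric) (simp add: F_def kernel_def mult_ac)
  also have "2 * (\<Sum>(l, k)\<in>{(l, k). l \<in> {1..n} \<and> k \<in> {1..n} \<and> l < k}. F l k) = off_diagonal_form w \<omega>"
    unfolding off_diagonal_form_def sum_distrib_left by (intro sum.cong refl) (auto simp: F_def)
  also have "(\<Sum>l=1..n. F l l) = diagonal_form w \<omega> + bias_form w \<omega> + (\<Sum>j=1..n. w j) * noise_level \<omega>"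
  proof -
    have kernel: "kernel w l l = (\<Sum>j=1..n. w j * trig_bar j (design n l)) + (\<Sum>j=1..n. w j)" for l
      by (simp add: kernel_def trig_bar_def sum.distrib[symmetric] power2_eq_square algebra_simps)
    have "F l l = kernel w l l / (real n)\<^sup>2 * (\<sigma> l \<omega>)\<^sup>2 * ((\<xi> l \<omega>)\<^sup>2 - 1)
        + (\<sigma> l \<omega>)\<^sup>2 / (real n)\<^sup>2 * (\<Sum>j=1..n. w j * trig_bar j (design n l))
        + (\<Sum>j=1..n. w j) * ((\<sigma> l \<omega>)\<^sup>2 / (real n)\<^sup>2)" for l
    proof -
      have "F l l = kernel w l l / (real n)\<^sup>2 * (\<sigma> l \<omega>)\<^sup>2 * ((\<xi> l \<omega>)\<^sup>2 - 1) + kernel w l l / (real n)\<^sup>2 * (\<sigma> l \<omega>)\<^sup>2"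
        by (simp add: F_def power2_eq_square algebra_simps diff_divide_distrib)
      moreover have "kernel w l l / (real n)\<^sup>2 * (\<sigma> l \<omega>)\<^sup>2 = (\<sigma> l \<omega>)\<^sup>2 / (real n)\<^sup>2 * (\<Sum>j=1..n. w j * trig_bar j (design n l))
        + (\<Sum>j=1..n. w j) * ((\<sigma> l \<omega>)\<^sup>2 / (real n)\<^sup>2)"
        unfolding kernel by (simp add: add_divide_distrib distrib_left distrib_right mult.commute)
      ultimately show ?thesis by linarith
    qed
    then show ?thesis
      by (simp add: diagonal_form_def bias_form_def noise_level_def sum.distrib sum_distrib_left sum_divide_distrib)
  qed
  finally show ?thesis by simp
qed

text \<open>The cost puts \<open>theta_tilde\<close> where the loss has \<theta> (\<theta> +
  \<zeta>). The squared empirical coefficient exceeds that product by \<theta> \<zeta> + \<zeta>^2,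
  and the centring by \<open>varsigma_hat\<close> is compared with the true
  \<open>noise_level\<close>. The penalty is likewise split into its true value, kept as the last
  term for later absorption, and an estimation error.\<close>

lemma loss_cost_identity:
  "loss w \<omega> = cost n m \<rho> (observation n S \<sigma> \<xi> \<omega>) w + (\<Sum>j=1..n. (theta j)\<^sup>2)
    + 2 * (\<Sum>j=1..n. w j * theta j * zeta \<omega> j)
    + 2 * diagonal_form w \<omega> + 2 * off_diagonal_form w \<omega> + 2 * bias_form w \<omega>
    + (2 * (\<Sum>j=1..n. w j) + \<rho> * (\<Sum>j=1..n. (w j)\<^sup>2))
      * (noise_level \<omega> - varsigma_hat n m (observation n S \<sigma> \<xi> \<omega>) / n)
    - \<rho> * (\<Sum>j=1..n. (w j)\<^sup>2) * noise_level \<omega>"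
proof -
  define vs where "vs = varsigma_hat n m (observation n S \<sigma> \<xi> \<omega>) / n"
  have "loss w \<omega> - (\<Sum>j=1..n. (w j)\<^sup>2 * (theta j + zeta \<omega> j)\<^sup>2)
      = (\<Sum>j=1..n. (theta j)\<^sup>2 + 2 * (w j * theta j * zeta \<omega> j) + 2 * (w j * (zeta \<omega> j)\<^sup>2) - 2 * (w j * (theta j + zeta \<omega> j)\<^sup>2))"
    unfolding loss_eq sum_subtractf[symmetric]
    by (intro sum.cong refl) (simp add: power2_eq_square algebra_simps)
  also have "\<dots> = (\<Sum>j=1..n. (theta j)\<^sup>2) + 2 * (\<Sum>j=1..n. w j * theta j * zeta \<omega> j)
      + 2 * (\<Sum>j=1..n. w j * (zeta \<omega> j)\<^sup>2) - 2 * (\<Sum>j=1..n. w j * (theta j + zeta \<omega> j)\<^sup>2)"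
    by (simp only: sum.distrib sum_subtractf sum_distrib_left)
  finally have loss: "loss w \<omega> = (\<Sum>j=1..n. (w j)\<^sup>2 * (theta j + zeta \<omega> j)\<^sup>2) + (\<Sum>j=1..n. (theta j)\<^sup>2)
      + 2 * (\<Sum>j=1..n. w j * theta j * zeta \<omega> j)
      + 2 * (\<Sum>j=1..n. w j * (zeta \<omega> j)\<^sup>2) - 2 * (\<Sum>j=1..n. w j * (theta j + zeta \<omega> j)\<^sup>2)" by simp
  have "(\<Sum>j=1..n. w j * theta_tilde n m (observation n S \<sigma> \<xi> \<omega>) j)
      = (\<Sum>j=1..n. w j * (theta j + zeta \<omega> j)\<^sup>2) - (\<Sum>j=1..n. w j) * vs"
    unfolding theta_tilde_def theta_hat_eq vs_def[symmetric]
    by (simp add: right_diff_distrib sum_subtractf sum_distrib_right)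
  then have cost: "cost n m \<rho> (observation n S \<sigma> \<xi> \<omega>) w
      = (\<Sum>j=1..n. (w j)\<^sup>2 * (theta j + zeta \<omega> j)\<^sup>2)
        - 2 * ((\<Sum>j=1..n. w j * (theta j + zeta \<omega> j)\<^sup>2) - (\<Sum>j=1..n. w j) * vs)
        + \<rho> * ((\<Sum>j=1..n. (w j)\<^sup>2) * vs)"
    unfolding cost_def penalty_hat_def theta_hat_eq by (simp add: vs_def)
  show ?thesis
    unfolding loss cost quadratic_noise_decomposition vs_def[symmetric] by (simp add: algebra_simps)
qed

text \<open>The degenerate case demanded by \<open>young_quotient\<close>: the normaliser vanishes
  only if all standard deviations or all weights do.\<close>

lemma off_diagonal_form_zero:
  assumes "noise_level \<omega> * (\<Sum>j=1..n. (w j)\<^sup>2) = 0"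
  shows "off_diagonal_form w \<omega> = 0"
proof (cases "noise_level \<omega> = 0")
  case True
  then have "(\<Sum>l=1..n. (\<sigma> l \<omega>)\<^sup>2) = 0" using n_pos by (simp add: noise_level_def)
  then have "\<forall>l\<in>{1..n}. \<sigma> l \<omega> = 0" by (simp add: sum_nonneg_eq_0_iff)
  then show ?thesis unfolding off_diagonal_form_def by (intro sum.neutral) auto
next
  case False
  then have "(\<Sum>j=1..n. (w j)\<^sup>2) = 0" using assms by simp
  then have "\<forall>j\<in>{1..n}. w j = 0" by (simp add: sum_nonneg_eq_0_iff)
  then have "kernel w l k = 0" for l k unfolding kernel_def by (intro sum.neutral) auto
  then show ?thesis unfolding off_diagonal_form_def by (intro sum.neutral) auto
qed

lemma bias_form_le:
  assumes "finite \<Lambda>" "w \<in> \<Lambda>"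
  shows "\<bar>bias_form w \<omega>\<bar> \<le> varrho_bar 1 n \<Lambda> * noise_level \<omega>"
proof -
  have "\<bar>bias_form w \<omega>\<bar> \<le> (\<Sum>l=1..n. (\<sigma> l \<omega>)\<^sup>2 / (real n)\<^sup>2 * varrho_bar 1 n \<Lambda>)"
    unfolding bias_form_def
    using varrho_bar_ge[OF assms design_in_unit, where n = n and i = 1]
    by (intro order_trans[OF sum_abs] sum_mono) (auto simp: abs_mult intro!: mult_left_mono divide_right_mono)
  also have "\<dots> = varrho_bar 1 n \<Lambda> * noise_level \<omega>"
    by (simp add: noise_level_def sum_distrib_left sum_divide_distrib mult_ac)
  finally show ?thesis .
qed

lemma weight_bounds:
  assumes "\<Lambda> \<subseteq> weight_cube n" "finite \<Lambda>" "w \<in> \<Lambda>"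
  shows "j \<in> {1..n} \<Longrightarrow> 0 \<le> w j \<and> w j \<le> 1"
    and "0 \<le> (\<Sum>j=1..n. w j)" "(\<Sum>j=1..n. w j) \<le> varrho n \<Lambda>"
    and "0 \<le> (\<Sum>j=1..n. (w j)\<^sup>2)" "(\<Sum>j=1..n. (w j)\<^sup>2) \<le> varrho n \<Lambda>"
proof -
  show b: "0 \<le> w j \<and> w j \<le> 1" if "j \<in> {1..n}" for j
    using assms that by (force simp: weight_cube_def PiE_def Pi_def)
  show "0 \<le> (\<Sum>j=1..n. w j)" using b by (intro sum_nonneg) auto
  show L: "(\<Sum>j=1..n. w j) \<le> varrho n \<Lambda>" using assms by (intro varrho_ge)
  show "0 \<le> (\<Sum>j=1..n. (w j)\<^sup>2)" by (intro sum_nonneg) auto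
  have "(\<Sum>j=1..n. (w j)\<^sup>2) \<le> (\<Sum>j=1..n. w j)"
    using b by (intro sum_mono) (simp add: power2_eq_square mult_left_le)
  then show "(\<Sum>j=1..n. (w j)\<^sup>2) \<le> varrho n \<Lambda>" using L by simp
qed

section \<open>Remainders and the pointwise comparison\<close>

definition linear_remainder :: "real \<Rightarrow> (nat \<Rightarrow> real) \<Rightarrow> (nat \<Rightarrow> real) \<Rightarrow> 'a \<Rightarrow> real" where
  "linear_remainder \<rho> u w \<omega> =
     (\<Sum>j=1..n. (w j - u j) * theta j * zeta \<omega> j)\<^sup>2 / (\<rho> * (\<Sum>j=1..n. (w j - u j)\<^sup>2 * (theta j)\<^sup>2))
     + (\<Sum>j=1..n. (w j - u j)\<^sup>2 * theta j * zeta \<omega> j)\<^sup>2 / ((1 - \<rho>) * (\<Sum>j=1..n. (w j - u j)\<^sup>2 * (theta j)\<^sup>2))"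

text \<open>In contrast to \<open>linear_remainder\<close>, whose denominators are nonrandom, the
  normaliser here is random through \<open>noise_level\<close>.\<close>

definition off_diagonal_remainder :: "real \<Rightarrow> (nat \<Rightarrow> real) \<Rightarrow> 'a \<Rightarrow> real" where
  "off_diagonal_remainder \<rho> w \<omega> =
     (off_diagonal_form w \<omega>)\<^sup>2 / (\<rho> * (noise_level \<omega> * (\<Sum>j=1..n. (w j)\<^sup>2)))"

definition variance_error :: "nat \<Rightarrow> 'a \<Rightarrow> real" where
  "variance_error m \<omega> = \<bar>noise_level \<omega> - varsigma_hat n m (observation n S \<sigma> \<xi> \<omega>) / n\<bar>"

text \<open>\<open>w\<close> stands for the selected weight and may depend on \<omega>, so every
  noise term of \<open>w\<close> that is not absorbed is dominated by a sum or a maximum over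
  \<open>\<Lambda>\<close>. What remains involves only fixed weights and can be integrated.\<close>

lemma pointwise_oracle_inequality:
  assumes \<Lambda>: "\<Lambda> \<subseteq> weight_cube n" "finite \<Lambda>" and w: "w \<in> \<Lambda>" and u: "u \<in> \<Lambda>"
    and \<rho>: "0 < \<rho>" "\<rho> < 1"
    and cost: "cost n m \<rho> (observation n S \<sigma> \<xi> \<omega>) w \<le> cost n m \<rho> (observation n S \<sigma> \<xi> \<omega>) u"
  shows "(1 - 2 * \<rho> / (1 - \<rho>)) * loss w \<omega> \<le> (1 + 2 * \<rho> / (1 - \<rho>)) * loss u \<omega>
    + (\<Sum>w\<in>\<Lambda>. linear_remainder \<rho> u w \<omega>) + 4 * (\<Sum>w\<in>\<Lambda>. \<bar>diagonal_form w \<omega>\<bar>)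
    + 2 * (\<Sum>w\<in>\<Lambda>. off_diagonal_remainder \<rho> w \<omega>)
    + 4 * varrho_bar 1 n \<Lambda> * noise_level \<omega> + (2 + \<rho>) * varrho n \<Lambda> * variance_error m \<omega>
    + 2 * \<rho> * (\<Sum>j=1..n. (u j)\<^sup>2) * noise_level \<omega>"
proof -
  define v where "v = noise_level \<omega>"
  define e where "e = v - varsigma_hat n m (observation n S \<sigma> \<xi> \<omega>) / n"
  define Lw Lu Qw Qu where "Lw = (\<Sum>j=1..n. w j)" and "Lu = (\<Sum>j=1..n. u j)"
    and "Qw = (\<Sum>j=1..n. (w j)\<^sup>2)" and "Qu = (\<Sum>j=1..n. (u j)\<^sup>2)"
  note wb = weight_bounds[OF \<Lambda> w] and ub = weight_bounds[OF \<Lambda> u]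
  have lin: "2 * (\<Sum>j=1..n. (w j - u j) * theta j * zeta \<omega> j)
      \<le> 2 * \<rho> / (1 - \<rho>) * (loss w \<omega> + loss u \<omega>) + (\<Sum>w\<in>\<Lambda>. linear_remainder \<rho> u w \<omega>)"
  proof -
    have "linear_remainder \<rho> u w \<omega> \<le> (\<Sum>w\<in>\<Lambda>. linear_remainder \<rho> u w \<omega>)"
    proof (rule member_le_sum[OF w _ \<Lambda>(2)])
      show "0 \<le> linear_remainder \<rho> u w \<omega>" for w
        unfolding linear_remainder_def using \<rho>
        by (intro add_nonneg_nonneg divide_nonneg_nonneg mult_nonneg_nonneg sum_nonneg) auto
    qed
    then show ?thesis
      using linear_term_le[of "{1..n}" \<rho> w u theta "zeta \<omega>", folded loss_eq] \<rho>
      unfolding linear_remainder_def by simp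
  qed
  have lin_diff: "(\<Sum>j=1..n. (w j - u j) * theta j * zeta \<omega> j)
      = (\<Sum>j=1..n. w j * theta j * zeta \<omega> j) - (\<Sum>j=1..n. u j * theta j * zeta \<omega> j)"
    by (simp add: left_diff_distrib sum_subtractf)
  define dsum where "dsum = (\<Sum>w\<in>\<Lambda>. \<bar>diagonal_form w \<omega>\<bar>)"
  have diag: "\<bar>diagonal_form w' \<omega>\<bar> \<le> dsum" if "w' \<in> \<Lambda>" for w'
    unfolding dsum_def using that \<Lambda>(2) by (intro member_le_sum) auto
  have offd: "2 * \<bar>off_diagonal_form w' \<omega>\<bar> \<le> \<rho> * (v * (\<Sum>j=1..n. (w' j)\<^sup>2)) + (\<Sum>w\<in>\<Lambda>. off_diagonal_remainder \<rho> w \<omega>)"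
    if w': "w' \<in> \<Lambda>" for w'
  proof -
    have nn: "0 \<le> noise_level \<omega> * (\<Sum>j=1..n. (w j)\<^sup>2)" for w :: "nat \<Rightarrow> real"
      using noise_level_nonneg by (intro mult_nonneg_nonneg sum_nonneg) auto
    have "off_diagonal_remainder \<rho> w' \<omega> \<le> (\<Sum>w\<in>\<Lambda>. off_diagonal_remainder \<rho> w \<omega>)"
    proof (rule member_le_sum[OF w' _ \<Lambda>(2)])
      show "0 \<le> off_diagonal_remainder \<rho> w \<omega>" for w
        unfolding off_diagonal_remainder_def using \<rho> nn[of w] by (intro divide_nonneg_nonneg mult_nonneg_nonneg[of \<rho>]) auto
    qed
    moreover have "2 * \<bar>off_diagonal_form w' \<omega>\<bar>
        \<le> \<rho> * (v * (\<Sum>j=1..n. (w' j)\<^sup>2)) + off_diagonal_remainder \<rho> w' \<omega>"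
      unfolding off_diagonal_remainder_def v_def
      using young_quotient[OF \<rho>(1) nn off_diagonal_form_zero, of w'] .
    ultimately show ?thesis by linarith
  qed
  have bias: "\<bar>bias_form w' \<omega>\<bar> \<le> varrho_bar 1 n \<Lambda> * v" if "w' \<in> \<Lambda>" for w'
    unfolding v_def using bias_form_le[OF \<Lambda>(2) that] .
  have var: "(2 * Lw + \<rho> * Qw) * e - (2 * Lu + \<rho> * Qu) * e \<le> (2 + \<rho>) * varrho n \<Lambda> * variance_error m \<omega>"
  proof -
    \<comment> \<open>Both quantities lie between 0 and \<open>varrho\<close>, so a difference costs
      \<open>varrho\<close> only once.\<close>
    have "\<bar>Lw - Lu\<bar> \<le> varrho n \<Lambda>" "\<bar>Qw - Qu\<bar> \<le> varrho n \<Lambda>"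
      using wb ub unfolding Lw_def Lu_def Qw_def Qu_def by linarith+
    then have "\<bar>2 * (Lw - Lu) + \<rho> * (Qw - Qu)\<bar> \<le> 2 * varrho n \<Lambda> + \<rho> * varrho n \<Lambda>"
      using \<rho> by (intro order_trans[OF abs_triangle_ineq] add_mono) (auto simp: abs_mult)
    then have "\<bar>2 * (Lw - Lu) + \<rho> * (Qw - Qu)\<bar> * \<bar>e\<bar> \<le> (2 * varrho n \<Lambda> + \<rho> * varrho n \<Lambda>) * \<bar>e\<bar>"
      by (intro mult_right_mono) auto
    moreover have "(2 * (Lw - Lu) + \<rho> * (Qw - Qu)) * e \<le> \<bar>2 * (Lw - Lu) + \<rho> * (Qw - Qu)\<bar> * \<bar>e\<bar>"
      by (metis abs_ge_self abs_mult)
    ultimately show ?thesis unfolding variance_error_def v_def[symmetric] e_def[symmetric] by (simp add: algebra_simps)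
  qed
  note id = loss_cost_identity[where \<rho> = \<rho> and m = m and \<omega> = \<omega>, folded v_def, folded e_def]
  have d: "loss w \<omega> - loss u \<omega> \<le> 2 * (\<Sum>j=1..n. (w j - u j) * theta j * zeta \<omega> j)
      + 2 * (diagonal_form w \<omega> - diagonal_form u \<omega>) + 2 * (off_diagonal_form w \<omega> - off_diagonal_form u \<omega>)
      + 2 * (bias_form w \<omega> - bias_form u \<omega>)
      + ((2 * Lw + \<rho> * Qw) * e - (2 * Lu + \<rho> * Qu) * e) - \<rho> * Qw * v + \<rho> * Qu * v"
    unfolding id[of w] id[of u] lin_diff Lw_def Lu_def Qw_def Qu_def using cost by (simp add: algebra_simps)
  have dd: "2 * (diagonal_form w \<omega> - diagonal_form u \<omega>) \<le> 4 * dsum"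
    using abs_le_D1[OF diag[OF w]] abs_le_D2[OF diag[OF u]] by (simp add: algebra_simps)
  \<comment> \<open>The penalty of \<open>w\<close> produced here cancels the last term of
    \<open>loss_cost_identity\<close> for \<open>w\<close>, while that of \<open>u\<close> adds to
    its own and becomes the term with 2 \<rho>.\<close>
  have oo: "2 * (off_diagonal_form w \<omega> - off_diagonal_form u \<omega>)
      \<le> \<rho> * Qw * v + \<rho> * Qu * v + 2 * (\<Sum>w\<in>\<Lambda>. off_diagonal_remainder \<rho> w \<omega>)"
    using offd[OF w] offd[OF u] unfolding Qw_def[symmetric] Qu_def[symmetric]
    by (simp add: mult_ac)
  have bb: "2 * (bias_form w \<omega> - bias_form u \<omega>) \<le> 4 * (varrho_bar 1 n \<Lambda> * v)"
    using abs_le_D1[OF bias[OF w]] abs_le_D2[OF bias[OF u]] by (simp add: algebra_simps)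
  have "loss w \<omega> - loss u \<omega> \<le> 2 * \<rho> / (1 - \<rho>) * (loss w \<omega> + loss u \<omega>) + (\<Sum>w\<in>\<Lambda>. linear_remainder \<rho> u w \<omega>)
      + 4 * dsum + 2 * (\<Sum>w\<in>\<Lambda>. off_diagonal_remainder \<rho> w \<omega>)
      + 4 * (varrho_bar 1 n \<Lambda> * v) + (2 + \<rho>) * varrho n \<Lambda> * variance_error m \<omega> + 2 * (\<rho> * Qu * v)"
    using d lin dd oo bb var by linarith
  then show ?thesis unfolding v_def[symmetric] Qu_def[symmetric] dsum_def[symmetric] by (simp add: left_diff_distrib distrib_right distrib_left)
qed

section \<open>Expectations of the remainders\<close>

lemma linear_remainder_expectation:
  assumes wb: "\<And>j. j \<in> {1..n} \<Longrightarrow> 0 \<le> w j \<and> w j \<le> 1" and ub: "\<And>j. j \<in> {1..n} \<Longrightarrow> 0 \<le> u j \<and> u j \<le> 1"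
    and \<rho>: "0 < \<rho>" "\<rho> < 1"
  shows "integrable M (linear_remainder \<rho> u w)"
    and "expectation (linear_remainder \<rho> u w) \<le> sigma_star / n / (\<rho> * (1 - \<rho>))"
proof -
  define s where "s = (\<Sum>j=1..n. (w j - u j)\<^sup>2 * (theta j)\<^sup>2)"
  have s0: "0 \<le> s" unfolding s_def by (intro sum_nonneg) auto
  have c0: "0 \<le> sigma_star / n" using sigma_star_pos by simp
  let ?a = "\<lambda>j. (w j - u j) * theta j" and ?b = "\<lambda>j. (w j - u j)\<^sup>2 * theta j"
  note Z = zeta_combination_second_moment
  show int: "integrable M (linear_remainder \<rho> u w)"
    unfolding linear_remainder_def[abs_def] using Z(1)[of ?a] Z(1)[of ?b] by simp
  have "expectation (\<lambda>\<omega>. (\<Sum>j=1..n. ?a j * zeta \<omega> j)\<^sup>2) \<le> sigma_star / n * s"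
    using Z(2)[of ?a] by (simp add: s_def power_mult_distrib)
  then have 1: "expectation (\<lambda>\<omega>. (\<Sum>j=1..n. ?a j * zeta \<omega> j)\<^sup>2) / (\<rho> * s) \<le> sigma_star / n / \<rho>"
    using s0 \<rho> c0 by (intro ratio_le) auto
  \<comment> \<open>Weights in [0, 1] differ by at most 1, so the extra power of w - u only
    decreases the sum and one normaliser serves both quotients.\<close>
  have "(\<Sum>j=1..n. (?b j)\<^sup>2) \<le> s"
    unfolding s_def
  proof (rule sum_mono)
    fix j assume "j \<in> {1..n}"
    then have "\<bar>w j - u j\<bar> \<le> 1" using wb ub by (smt (verit))
    then have "(w j - u j)\<^sup>2 \<le> 1" by (simp add: abs_square_le_1)
    then have "(w j - u j)\<^sup>2 * ((w j - u j)\<^sup>2 * (theta j)\<^sup>2) \<le> (w j - u j)\<^sup>2 * (theta j)\<^sup>2"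
      by (intro mult_left_le_one_le) auto
    then show "(?b j)\<^sup>2 \<le> (w j - u j)\<^sup>2 * (theta j)\<^sup>2" by (simp add: power2_eq_square mult_ac)
  qed
  then have "sigma_star / n * (\<Sum>j=1..n. (?b j)\<^sup>2) \<le> sigma_star / n * s" by (intro mult_left_mono c0)
  then have "expectation (\<lambda>\<omega>. (\<Sum>j=1..n. ?b j * zeta \<omega> j)\<^sup>2) \<le> sigma_star / n * s"
    using Z(2)[of ?b] by linarith
  then have 2: "expectation (\<lambda>\<omega>. (\<Sum>j=1..n. ?b j * zeta \<omega> j)\<^sup>2) / ((1 - \<rho>) * s) \<le> sigma_star / n / (1 - \<rho>)"
    using s0 \<rho> c0 by (intro ratio_le) auto
  have "expectation (linear_remainder \<rho> u w)
      = expectation (\<lambda>\<omega>. (\<Sum>j=1..n. ?a j * zeta \<omega> j)\<^sup>2) / (\<rho> * s)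
        + expectation (\<lambda>\<omega>. (\<Sum>j=1..n. ?b j * zeta \<omega> j)\<^sup>2) / ((1 - \<rho>) * s)"
    unfolding linear_remainder_def[abs_def] s_def[symmetric] using Z(1)[of ?a] Z(1)[of ?b] by simp
  also have "\<dots> \<le> sigma_star / n / \<rho> + sigma_star / n / (1 - \<rho>)" using 1 2 by linarith
  also have "\<dots> = sigma_star / n / (\<rho> * (1 - \<rho>))"
    using \<rho> n_pos by (simp add: field_simps)
  finally show "expectation (linear_remainder \<rho> u w) \<le> sigma_star / n / (\<rho> * (1 - \<rho>))" .
qed

text \<open>The diagonal of \<open>kernel\<close> is the sum of the weights plus a
  \<open>trig_bar\<close> sum, hence bounded by \<open>varrho\<close> plus
  \<open>varrho_bar 1\<close>. The centred squares are orthogonal, so averaging over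
  \<open>n\<close> points gains the factor 1 / sqrt n.\<close>

lemma diagonal_form_expectation:
  assumes \<Lambda>: "\<Lambda> \<subseteq> weight_cube n" "finite \<Lambda>" and w: "w \<in> \<Lambda>"
  shows "integrable M (\<lambda>\<omega>. \<bar>diagonal_form w \<omega>\<bar>)"
    and "expectation (\<lambda>\<omega>. \<bar>diagonal_form w \<omega>\<bar>)
      \<le> sigma_star / n * (xi_bar xi_star / sqrt n) * (varrho n \<Lambda> + varrho_bar 1 n \<Lambda>)"
proof -
  define R where "R = varrho n \<Lambda> + varrho_bar 1 n \<Lambda>"
  have k: "\<bar>kernel w l l\<bar> \<le> R" if l: "l \<in> {1..n}" for l
  proof -
    have "kernel w l l = (\<Sum>j=1..n. w j ^ 1 * trig_bar j (design n l)) + (\<Sum>j=1..n. w j)"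
      by (simp add: kernel_def trig_bar_def sum.distrib[symmetric] power2_eq_square algebra_simps)
    then show ?thesis
      using varrho_bar_ge[OF \<Lambda>(2) w design_in_unit[OF l], where n = n and i = 1] weight_bounds(2,3)[OF \<Lambda> w]
      unfolding R_def by linarith
  qed
  have R0: "0 \<le> R" using k[OF one_in] by linarith
  have meas: "diagonal_form w \<in> borel_measurable M"
    unfolding diagonal_form_def[abs_def] using sigma_measurable xi_measurable
    by (intro borel_measurable_sum borel_measurable_times borel_measurable_diff borel_measurable_power borel_measurable_const) auto
  have int: "integrable M (\<lambda>\<omega>. (diagonal_form w \<omega>)\<^sup>2)"
    unfolding diagonal_form_def by (rule centered_square_form_second_moment)
  have "(\<Sum>l=1..n. (kernel w l l / (real n)\<^sup>2)\<^sup>2) \<le> (\<Sum>l=1..n. (R / (real n)\<^sup>2)\<^sup>2)"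
  proof (rule sum_mono)
    fix l assume "l \<in> {1..n}"
    then have "\<bar>kernel w l l / (real n)\<^sup>2\<bar> \<le> R / (real n)\<^sup>2" using k by (simp add: divide_right_mono)
    then show "(kernel w l l / (real n)\<^sup>2)\<^sup>2 \<le> (R / (real n)\<^sup>2)\<^sup>2"
      by (metis abs_ge_zero power2_abs power_mono)
  qed
  also have "\<dots> = R\<^sup>2 / real n ^ 3" using n_pos by (simp add: power_divide power2_eq_square power3_eq_cube)
  finally have "(xi_star - 1) * sigma_star\<^sup>2 * (\<Sum>l=1..n. (kernel w l l / (real n)\<^sup>2)\<^sup>2)
      \<le> (xi_star - 1) * sigma_star\<^sup>2 * (R\<^sup>2 / real n ^ 3)"
    using xi_star_ge_1 by (intro mult_left_mono) auto
  then have "expectation (\<lambda>\<omega>. (diagonal_form w \<omega>)\<^sup>2) \<le> (xi_star - 1) * sigma_star\<^sup>2 * (R\<^sup>2 / real n ^ 3)"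
    using centered_square_form_second_moment(2)[of "\<lambda>l. kernel w l l / (real n)\<^sup>2"]
    unfolding diagonal_form_def by linarith
  also have "\<dots> = (sigma_star / n * (xi_bar xi_star / sqrt n) * R)\<^sup>2"
    using xi_star_ge_1
    by (simp add: power_mult_distrib power_divide xi_bar_def power2_eq_square[of "real n"] power3_eq_cube)
  finally have "expectation (\<lambda>\<omega>. (diagonal_form w \<omega>)\<^sup>2) \<le> (sigma_star / n * (xi_bar xi_star / sqrt n) * R)\<^sup>2" .
  note * = expectation_abs_le_sqrt[OF meas int this]
  show "integrable M (\<lambda>\<omega>. \<bar>diagonal_form w \<omega>\<bar>)" by (rule *)
  have "0 \<le> sigma_star / n * (xi_bar xi_star / sqrt n) * R"
    using R0 sigma_star_pos xi_star_ge_1 by (simp add: xi_bar_def)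
  then show "expectation (\<lambda>\<omega>. \<bar>diagonal_form w \<omega>\<bar>) \<le> sigma_star / n * (xi_bar xi_star / sqrt n) * (varrho n \<Lambda> + varrho_bar 1 n \<Lambda>)"
    using *(2) unfolding R_def[symmetric] by simp
qed

lemma kernel_row_energy:
  fixes w :: "nat \<Rightarrow> real"
  assumes l: "l \<in> {1..n}"
  shows "(\<Sum>k=1..n. (kernel w l k)\<^sup>2) \<le> 2 * n * (\<Sum>j=1..n. (w j)\<^sup>2)"
proof -
  have "(\<Sum>k=1..n. (kernel w l k)\<^sup>2) = n * (\<Sum>j=1..n. (w j * trig j (design n l))\<^sup>2)"
    unfolding kernel_def by (rule trig_synthesis_normsq[OF n_odd])
  also have "\<dots> \<le> real n * (\<Sum>j=1..n. 2 * (w j)\<^sup>2)"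
  proof (intro mult_left_mono sum_mono)
    fix j
    have "(trig j (design n l))\<^sup>2 \<le> 2" using abs_trig_bar_le[of j "design n l"] unfolding trig_bar_def by linarith
    then have "(w j)\<^sup>2 * (trig j (design n l))\<^sup>2 \<le> (w j)\<^sup>2 * 2" by (intro mult_left_mono) auto
    then show "(w j * trig j (design n l))\<^sup>2 \<le> 2 * (w j)\<^sup>2" by (simp add: power_mult_distrib mult.commute)
  qed simp
  finally show ?thesis by (simp add: sum_distrib_left[symmetric])
qed

lemma off_diagonal_remainder_expectation:
  assumes \<rho>: "0 < \<rho>"
  shows "integrable M (off_diagonal_remainder \<rho> w)"
    and "expectation (off_diagonal_remainder \<rho> w) \<le> 8 * sigma_star / (\<rho> * n)"
proof -
  define Q where "Q = (\<Sum>j=1..n. (w j)\<^sup>2)"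
  have Q0: "0 \<le> Q" unfolding Q_def by (intro sum_nonneg) auto
  \<comment> \<open>The square of 2 / n^2 times the row energy 2 n Q.\<close>
  define C where "C = 8 * Q / real n ^ 3"
  define V where "V \<omega> = (\<Sum>i=1..n. (\<sigma> i \<omega>)\<^sup>2)" for \<omega>
  let ?c = "\<lambda>(l, k). 2 * kernel w l k / (real n)\<^sup>2"
  have C: "(\<Sum>k=1..n. (?c (l, k))\<^sup>2) \<le> C" if l: "l \<in> {1..n}" for l
  proof -
    have "(\<Sum>k=1..n. (?c (l, k))\<^sup>2) = 4 / real n ^ 4 * (\<Sum>k=1..n. (kernel w l k)\<^sup>2)"
      by (simp add: power_divide power_mult_distrib sum_distrib_left sum_divide_distrib power_mult[symmetric])
    also have "\<dots> \<le> 4 / real n ^ 4 * (2 * n * Q)"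
      using kernel_row_energy[OF l] unfolding Q_def by (intro mult_left_mono) auto
    also have "\<dots> = C" using n_pos by (simp add: C_def power4_eq_xxxx power3_eq_cube)
    finally show ?thesis .
  qed
  note O = off_diagonal_form_second_moment[of ?c C, OF C, folded V_def]
  have eq: "off_diagonal_remainder \<rho> w = (\<lambda>\<omega>. (real n)\<^sup>2 / (\<rho> * Q) * ((off_diagonal_form w \<omega>)\<^sup>2 / V \<omega>))"
    unfolding off_diagonal_remainder_def noise_level_def Q_def V_def by (auto simp: mult_ac)
  have int: "integrable M (\<lambda>\<omega>. (off_diagonal_form w \<omega>)\<^sup>2 / V \<omega>)"
    and E: "expectation (\<lambda>\<omega>. (off_diagonal_form w \<omega>)\<^sup>2 / V \<omega>) \<le> sigma_star * C"
    using O unfolding off_diagonal_form_def by simp_all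
  show "integrable M (off_diagonal_remainder \<rho> w)"
    unfolding eq using int by (rule integrable_mult_right)
  have "expectation (off_diagonal_remainder \<rho> w) = (real n)\<^sup>2 / (\<rho> * Q) * expectation (\<lambda>\<omega>. (off_diagonal_form w \<omega>)\<^sup>2 / V \<omega>)"
    unfolding eq by (rule integral_mult_right_zero)
  also have "\<dots> \<le> (real n)\<^sup>2 / (\<rho> * Q) * (sigma_star * C)"
    using E \<rho> Q0 by (intro mult_left_mono) auto
  \<comment> \<open>\<open>Q\<close> cancels; for Q = 0 the prefactor is 0 by division by
    zero.\<close>
  also have "\<dots> \<le> 8 * sigma_star / (\<rho> * n)"
    using \<rho> n_pos sigma_star_pos
    by (cases "Q = 0") (auto simp: C_def power2_eq_square power3_eq_cube mult.commute)
  finally show "expectation (off_diagonal_remainder \<rho> w) \<le> 8 * sigma_star / (\<rho> * n)" .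
qed

text \<open>The mean square of each \<open>zeta\<close> is the mean noise level plus a weighted sum
  of \<open>trig_bar\<close>. Thus the variance part of the risk is the left-hand side up to a
  correction controlled by \<open>varrho_bar 2\<close>.\<close>

lemma penalty_le_risk:
  assumes \<Lambda>: "finite \<Lambda>" and w: "w \<in> \<Lambda>"
  shows "(\<Sum>j=1..n. (w j)\<^sup>2) * expectation noise_level \<le> expectation (loss w) + varrho_bar 2 n \<Lambda> * (sigma_star / n)"
proof -
  define s where "s l = expectation (\<lambda>\<omega>. (\<sigma> l \<omega>)\<^sup>2) / (real n)\<^sup>2" for l
  have s0: "0 \<le> s l" for l unfolding s_def by simp
  have v: "expectation noise_level = (\<Sum>l=1..n. s l)"
    by (simp add: noise_level_moments(2) s_def sum_divide_distrib)
  have R0: "0 \<le> varrho_bar 2 n \<Lambda>" using varrho_bar_ge[OF \<Lambda> w, of 0 2 n] by (simp add: order_trans[OF abs_ge_zero])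
  have "(\<Sum>j=1..n. (w j)\<^sup>2 * expectation (\<lambda>\<omega>. (zeta \<omega> j)\<^sup>2))
      = (\<Sum>j=1..n. \<Sum>l=1..n. s l * (w j)\<^sup>2 + s l * ((w j)\<^sup>2 * trig_bar j (design n l)))"
    unfolding zeta_moments(4) sum_distrib_left s_def trig_bar_def
    by (intro sum.cong refl) (simp add: algebra_simps diff_divide_distrib)
  also have "\<dots> = (\<Sum>l=1..n. s l * (\<Sum>j=1..n. (w j)\<^sup>2) + s l * (\<Sum>j=1..n. (w j)\<^sup>2 * trig_bar j (design n l)))"
    by (subst sum.swap) (simp add: sum.distrib sum_distrib_left)
  also have "\<dots> \<ge> (\<Sum>l=1..n. s l * (\<Sum>j=1..n. (w j)\<^sup>2) + s l * (- varrho_bar 2 n \<Lambda>))"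
  proof (intro sum_mono add_left_mono mult_left_mono s0)
    fix l assume "l \<in> {1..n}"
    from varrho_bar_ge[OF \<Lambda> w design_in_unit[OF this], where n = n and i = 2]
    show "- varrho_bar 2 n \<Lambda> \<le> (\<Sum>j=1..n. (w j)\<^sup>2 * trig_bar j (design n l))" by linarith
  qed
  finally have "expectation noise_level * (\<Sum>j=1..n. (w j)\<^sup>2) - expectation noise_level * varrho_bar 2 n \<Lambda>
      \<le> (\<Sum>j=1..n. (w j)\<^sup>2 * expectation (\<lambda>\<omega>. (zeta \<omega> j)\<^sup>2))"
    unfolding v by (simp add: sum.distrib sum_distrib_right sum_subtractf)
  moreover have "0 \<le> (\<Sum>j=1..n. ((1 - w j) * theta j)\<^sup>2)" by (intro sum_nonneg) auto
  moreover have "expectation noise_level * varrho_bar 2 n \<Lambda> \<le> sigma_star / n * varrho_bar 2 n \<Lambda>"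
    using noise_level_moments(3) R0 by (intro mult_right_mono)
  ultimately show ?thesis unfolding loss_moments(2) by (simp only: mult.commute)
qed

text \<open>The noise energy at indices above \<open>m\<close> is the total minus the first
  \<open>m\<close> terms. Parseval turns the total into an average of squared noise variables, so no
  off-diagonal products of errors appear.\<close>

lemma varsigma_hat_decomposition:
  assumes "m \<le> n"
  shows "varsigma_hat n m (observation n S \<sigma> \<xi> \<omega>) - n * noise_level \<omega>
    = (\<Sum>j=m+1..n. (theta j)\<^sup>2) + 2 * (\<Sum>j=1..n. (if m < j then theta j else 0) * zeta \<omega> j)
      + (\<Sum>l=1..n. 1 / n * (\<sigma> l \<omega>)\<^sup>2 * ((\<xi> l \<omega>)\<^sup>2 - 1)) - (\<Sum>j=1..m. (zeta \<omega> j)\<^sup>2)"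
proof -
  have split: "(\<Sum>j=1..n. f j) = (\<Sum>j=1..m. f j) + (\<Sum>j=m+1..n. f j)" for f :: "nat \<Rightarrow> real"
  proof -
    have "{1..n} = {1..m} \<union> {m+1..n}" using assms by auto
    then show ?thesis by (simp add: sum.union_disjoint)
  qed
  have lin: "(\<Sum>j=1..n. (if m < j then theta j else 0) * zeta \<omega> j) = (\<Sum>j=m+1..n. theta j * zeta \<omega> j)"
  proof -
    have "(\<Sum>j=1..m. (if m < j then theta j else 0) * zeta \<omega> j) = 0" by (intro sum.neutral) auto
    moreover have "(\<Sum>j=m+1..n. (if m < j then theta j else 0) * zeta \<omega> j) = (\<Sum>j=m+1..n. theta j * zeta \<omega> j)"
      by (intro sum.cong) auto
    ultimately show ?thesis unfolding split by simp
  qed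
  have "(\<Sum>j=1..n. (zeta \<omega> j)\<^sup>2) = 1 / n * (\<Sum>l=1..n. (\<sigma> l \<omega> * \<xi> l \<omega>)\<^sup>2)"
  proof -
    have "zeta \<omega> j = 1 / n * (\<Sum>l=1..n. \<sigma> l \<omega> * \<xi> l \<omega> * trig j (design n l))" for j
      by (simp add: zeta_def sum_distrib_left mult_ac)
    then show ?thesis by (simp only: trig_parseval[OF n_odd])
  qed
  moreover have "real n * noise_level \<omega> = 1 / n * (\<Sum>l=1..n. (\<sigma> l \<omega>)\<^sup>2)"
    using n_pos by (simp add: noise_level_def power2_eq_square)
  moreover have "(\<Sum>l=1..n. 1 / n * (\<sigma> l \<omega>)\<^sup>2 * ((\<xi> l \<omega>)\<^sup>2 - 1))
      = 1 / n * (\<Sum>l=1..n. (\<sigma> l \<omega> * \<xi> l \<omega>)\<^sup>2) - 1 / n * (\<Sum>l=1..n. (\<sigma> l \<omega>)\<^sup>2)"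
    by (simp add: right_diff_distrib sum_subtractf sum_distrib_left power_mult_distrib diff_divide_distrib)
  moreover have "varsigma_hat n m (observation n S \<sigma> \<xi> \<omega>)
      = (\<Sum>j=m+1..n. (theta j)\<^sup>2) + 2 * (\<Sum>j=m+1..n. theta j * zeta \<omega> j) + (\<Sum>j=m+1..n. (zeta \<omega> j)\<^sup>2)"
    unfolding varsigma_hat_def theta_hat_eq power2_sum
    by (simp add: sum.distrib sum_distrib_left mult_ac)
  ultimately show ?thesis unfolding lin using split[of "\<lambda>j. (zeta \<omega> j)\<^sup>2"] by linarith
qed

text \<open>After multiplication by n sqrt n, the four terms of the decomposition have these orders:
  r sqrt n / m^2 for the tail \<open>T\<close>, sqrt (r sigma_star) / m for the cross term
  \<open>Q\<close>, whose variance is at most sigma_star T / n, a constant for \<open>R\<close>, and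
  m sigma_star / sqrt n for \<open>Z\<close>.\<close>

lemma variance_error_expectation:
  assumes S: "S \<in> sobolev_ball r" and r: "0 < r" and m: "1 \<le> m" "m \<le> n"
  shows "integrable M (variance_error m)"
    and "expectation (variance_error m) \<le> (sigma_bar xi_star sigma_star + varsigma_star n m sigma_star r) / (n * sqrt n)"
proof -
  define T where "T = (\<Sum>j=m+1..n. (theta j)\<^sup>2)"
  define Q where "Q \<omega> = (\<Sum>j=1..n. (if m < j then theta j else 0) * zeta \<omega> j)" for \<omega>
  define R where "R \<omega> = (\<Sum>l=1..n. 1 / n * (\<sigma> l \<omega>)\<^sup>2 * ((\<xi> l \<omega>)\<^sup>2 - 1))" for \<omega>
  define Z where "Z \<omega> = (\<Sum>j=1..m. (zeta \<omega> j)\<^sup>2)" for \<omega>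
  have n0: "0 < real n" using n_pos by simp
  have T0: "0 \<le> T" unfolding T_def by (intro sum_nonneg) auto
  have "(real m)\<^sup>2 * T \<le> r / 4"
    unfolding T_def theta_def by (rule sobolev_tail_le[OF S n_odd])
  then have T: "T \<le> r / 4 / (real m)\<^sup>2" using m by (simp add: pos_le_divide_eq mult.commute)
  have ve: "variance_error m = (\<lambda>\<omega>. \<bar>T + 2 * Q \<omega> + R \<omega> - Z \<omega>\<bar> / n)"
  proof
    fix \<omega>
    have "variance_error m \<omega> = \<bar>(varsigma_hat n m (observation n S \<sigma> \<xi> \<omega>) - n * noise_level \<omega>) / n\<bar>"
      using n0 by (simp add: variance_error_def diff_divide_distrib abs_minus_commute)
    then show "variance_error m \<omega> = \<bar>T + 2 * Q \<omega> + R \<omega> - Z \<omega>\<bar> / n"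
      unfolding varsigma_hat_decomposition[OF m(2)] T_def Q_def R_def Z_def by simp
  qed
  have Qm: "Q \<in> borel_measurable M"
    unfolding Q_def[abs_def] using zeta_measurable by (intro borel_measurable_sum borel_measurable_times) auto
  have Rm: "R \<in> borel_measurable M"
    unfolding R_def[abs_def] using sigma_measurable xi_measurable
    by (intro borel_measurable_sum borel_measurable_times borel_measurable_diff borel_measurable_power borel_measurable_const) auto
  have Q2: "integrable M (\<lambda>\<omega>. (Q \<omega>)\<^sup>2)" "expectation (\<lambda>\<omega>. (Q \<omega>)\<^sup>2) \<le> sigma_star / n * T"
  proof -
    have "(\<Sum>j=1..n. (if m < j then theta j else 0)\<^sup>2) = T"
      unfolding T_def using m by (intro sum.mono_neutral_cong_right) auto
    then show "integrable M (\<lambda>\<omega>. (Q \<omega>)\<^sup>2)" "expectation (\<lambda>\<omega>. (Q \<omega>)\<^sup>2) \<le> sigma_star / n * T"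
      using zeta_combination_second_moment[of "\<lambda>j. if m < j then theta j else 0"] unfolding Q_def by simp_all
  qed
  have R2: "integrable M (\<lambda>\<omega>. (R \<omega>)\<^sup>2)" "expectation (\<lambda>\<omega>. (R \<omega>)\<^sup>2) \<le> (xi_star - 1) * sigma_star\<^sup>2 / n"
    using centered_square_form_second_moment[of "\<lambda>l. 1 / n"] n0 unfolding R_def
    by (simp_all add: power2_eq_square)
  note Qa = expectation_abs_le_sqrt[OF Qm Q2] and Ra = expectation_abs_le_sqrt[OF Rm R2]
  have Qi: "integrable M Q" and Ri: "integrable M R" 
    by (rule integrable_abs_cancel[OF Qa(1) Qm], rule integrable_abs_cancel[OF Ra(1) Rm])
  have Zi: "integrable M Z" unfolding Z_def[abs_def] using zeta_moments(3) by (intro Bochner_Integration.integrable_sum)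
  have Z0: "0 \<le> Z \<omega>" for \<omega> unfolding Z_def by (intro sum_nonneg) auto
  have ZE: "expectation Z \<le> m * (sigma_star / n)"
  proof -
    have "expectation Z = (\<Sum>j=1..m. expectation (\<lambda>\<omega>. (zeta \<omega> j)\<^sup>2))"
      unfolding Z_def[abs_def] using zeta_moments(3) by (intro Bochner_Integration.integral_sum)
    also have "\<dots> \<le> (\<Sum>j=1..m. sigma_star / n)"
      using zeta_sq_le m by (intro sum_mono) auto
    finally show ?thesis by simp
  qed
  show int: "integrable M (variance_error m)"
    unfolding ve using Qi Ri Zi by simp
  have "expectation (variance_error m) \<le> expectation (\<lambda>\<omega>. (T + 2 * \<bar>Q \<omega>\<bar> + \<bar>R \<omega>\<bar> + Z \<omega>) / n)"
  proof (rule integral_mono[OF int])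
    show "integrable M (\<lambda>\<omega>. (T + 2 * \<bar>Q \<omega>\<bar> + \<bar>R \<omega>\<bar> + Z \<omega>) / n)" using Qa(1) Ra(1) Zi by simp
    show "variance_error m \<omega> \<le> (T + 2 * \<bar>Q \<omega>\<bar> + \<bar>R \<omega>\<bar> + Z \<omega>) / n" for \<omega>
    proof -
      have "\<bar>T + 2 * Q \<omega> + R \<omega> - Z \<omega>\<bar> \<le> T + 2 * \<bar>Q \<omega>\<bar> + \<bar>R \<omega>\<bar> + Z \<omega>"
        using Z0[of \<omega>] T0 by linarith
      then show ?thesis unfolding ve using n0 by (intro divide_right_mono) auto
    qed
  qed
  also have "\<dots> = (T + 2 * expectation (\<lambda>\<omega>. \<bar>Q \<omega>\<bar>) + expectation (\<lambda>\<omega>. \<bar>R \<omega>\<bar>) + expectation Z) / n"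
    using Qa(1) Ra(1) Zi by (simp add: prob_space)
  also have "\<dots> \<le> (4 * r / (real m)\<^sup>2 + 4 * sqrt (r * sigma_star) / (m * sqrt n)
      + 2 * (xi_bar xi_star * sigma_star) / sqrt n + m * (sigma_star / n)) / n"
  proof (intro divide_right_mono add_mono ZE)
    have "r / 4 / (real m)\<^sup>2 \<le> 4 * r / (real m)\<^sup>2" using r by (intro divide_right_mono) auto
    then show "T \<le> 4 * r / (real m)\<^sup>2" using T by linarith
    have "sigma_star / n * T \<le> sigma_star / n * (r / 4 / (real m)\<^sup>2)"
      using T sigma_star_pos n0 by (intro mult_left_mono) auto
    also have "\<dots> = (sqrt (r * sigma_star) / (2 * m * sqrt n))\<^sup>2"
      using r sigma_star_pos n0 by (simp add: power_divide power_mult_distrib mult_ac)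
    finally have "sqrt (sigma_star / n * T) \<le> sqrt (r * sigma_star) / (2 * m * sqrt n)"
      using r sigma_star_pos by (intro real_le_lsqrt) auto
    then have "2 * expectation (\<lambda>\<omega>. \<bar>Q \<omega>\<bar>) \<le> 2 * (sqrt (r * sigma_star) / (2 * m * sqrt n))"
      using Qa(2) by linarith
    also have "\<dots> = 1 * sqrt (r * sigma_star) / (m * sqrt n)" by simp
    also have "\<dots> \<le> 4 * sqrt (r * sigma_star) / (m * sqrt n)"
      using r sigma_star_pos by (intro divide_right_mono mult_right_mono) auto
    finally show "2 * expectation (\<lambda>\<omega>. \<bar>Q \<omega>\<bar>) \<le> 4 * sqrt (r * sigma_star) / (m * sqrt n)" .
    have "sqrt ((xi_star - 1) * sigma_star\<^sup>2 / n) = xi_bar xi_star * sigma_star / sqrt n"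
      using sigma_star_pos by (simp add: xi_bar_def real_sqrt_divide real_sqrt_mult)
    also have "\<dots> \<le> 2 * (xi_bar xi_star * sigma_star) / sqrt n"
      using xi_star_ge_1 sigma_star_pos by (intro divide_right_mono) (auto simp: xi_bar_def)
    finally show "expectation (\<lambda>\<omega>. \<bar>R \<omega>\<bar>) \<le> 2 * (xi_bar xi_star * sigma_star) / sqrt n"
      using Ra(2) by linarith
  qed (use n0 in auto)
  also have "\<dots> \<le> (sigma_bar xi_star sigma_star + varsigma_star n m sigma_star r) / (n * sqrt n)"
  proof -
    have sq: "sqrt n * sqrt n = real n" by simp
    have "4 * r / (real m)\<^sup>2 + 4 * sqrt (r * sigma_star) / (m * sqrt n)
        + 2 * (xi_bar xi_star * sigma_star) / sqrt n + m * (sigma_star / n)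
      = (2 * (xi_bar xi_star * sigma_star) + 4 * r * sqrt n / (real m)\<^sup>2 + 4 * sqrt (r * sigma_star) / m
        + m * sigma_star / sqrt n) / sqrt n"
      using n0 by (simp add: add_divide_distrib sq)
    also have "\<dots> \<le> (sigma_bar xi_star sigma_star + varsigma_star n m sigma_star r) / sqrt n"
    proof (intro divide_right_mono)
      have "0 \<le> 2 * sqrt 2 * sigma_star" "0 \<le> 2 * sigma_star / sqrt n" using sigma_star_pos by auto
      then show "2 * (xi_bar xi_star * sigma_star) + 4 * r * sqrt n / (real m)\<^sup>2 + 4 * sqrt (r * sigma_star) / m
        + m * sigma_star / sqrt n \<le> sigma_bar xi_star sigma_star + varsigma_star n m sigma_star r"
        unfolding sigma_bar_def varsigma_star_def by (simp add: algebra_simps add_divide_distrib)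
    qed simp
    finally have "(4 * r / (real m)\<^sup>2 + 4 * sqrt (r * sigma_star) / (m * sqrt n)
        + 2 * (xi_bar xi_star * sigma_star) / sqrt n + m * (sigma_star / n)) / n
      \<le> (sigma_bar xi_star sigma_star + varsigma_star n m sigma_star r) / sqrt n / n"
      using n0 by (intro divide_right_mono) auto
    then show ?thesis by (simp only: divide_divide_eq_left mult.commute)
  qed
  finally show "expectation (variance_error m) \<le> (sigma_bar xi_star sigma_star + varsigma_star n m sigma_star r) / (n * sqrt n)" .
qed

section \<open>Integrating the pointwise comparison\<close>

lemma selected_loss_integrable:
  assumes \<Lambda>: "finite \<Lambda>" and lam: "lam \<in> measurable M (count_space \<Lambda>)"
  shows "integrable M (\<lambda>\<omega>. loss (lam \<omega>) \<omega>)"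
proof (rule Bochner_Integration.integrable_bound)
  show "integrable M (\<lambda>\<omega>. \<Sum>w\<in>\<Lambda>. loss w \<omega>)" using loss_moments(1) by simp
  show "(\<lambda>\<omega>. loss (lam \<omega>) \<omega>) \<in> borel_measurable M"
    by (rule measurable_compose_countable'[OF _ lam, where f = loss])
       (use borel_measurable_integrable[OF loss_moments(1)] \<Lambda> in \<open>auto simp: countable_finite\<close>)
  show "AE \<omega> in M. norm (loss (lam \<omega>) \<omega>) \<le> norm (\<Sum>w\<in>\<Lambda>. loss w \<omega>)"
  proof (rule AE_I2)
    fix \<omega> assume "\<omega> \<in> space M"
    then have "lam \<omega> \<in> \<Lambda>" using measurable_space[OF lam] by simp
    then have "loss (lam \<omega>) \<omega> \<le> (\<Sum>w\<in>\<Lambda>. loss w \<omega>)"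
      using \<Lambda> loss_nonneg by (intro member_le_sum) auto
    then show "norm (loss (lam \<omega>) \<omega>) \<le> norm (\<Sum>w\<in>\<Lambda>. loss w \<omega>)" using loss_nonneg[of "lam \<omega>" \<omega>] by simp
  qed
qed

text \<open>Proved against an arbitrary fixed \<open>u\<close> in \<open>\<Lambda>\<close>; choosing
  \<open>u\<close> of minimal risk is left to the end.\<close>

lemma expected_oracle_inequality:
  assumes \<Lambda>: "\<Lambda> \<subseteq> weight_cube n" "finite \<Lambda>" and u: "u \<in> \<Lambda>"
    and \<rho>: "0 < \<rho>" "\<rho> < 1 / 3"
    and sel: "selects_weights M n m \<rho> (observation n S \<sigma> \<xi>) \<Lambda> lam"
    and S: "S \<in> sobolev_ball r" and r: "0 < r" and m: "1 \<le> m" "m \<le> n"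
  shows "expectation (\<lambda>\<omega>. loss (lam \<omega>) \<omega>)
    \<le> (1 + kappa \<rho>) * expectation (loss u) + 1 / n * D_const n m \<Lambda> xi_star sigma_star \<rho> r"
proof -
  have lam: "lam \<in> measurable M (count_space \<Lambda>)"
    and min: "\<And>\<omega>. \<omega> \<in> space M \<Longrightarrow> is_arg_min (cost n m \<rho> (observation n S \<sigma> \<xi> \<omega>)) (\<lambda>w. w \<in> \<Lambda>) (lam \<omega>)"
    using sel unfolding selects_weights_def by blast+
  have n0: "0 < real n" using n_pos by simp
  have \<rho>1: "\<rho> < 1" using \<rho> by simp
  define \<nu> where "\<nu> = real (card \<Lambda>)"
  define x where "x = xi_bar xi_star / sqrt n"
  define s where "s = sigma_star"
  define R R1 R2 where "R = varrho n \<Lambda>" and "R1 = varrho_bar 1 n \<Lambda>" and "R2 = varrho_bar 2 n \<Lambda>"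
  define G where "G = (sigma_bar xi_star sigma_star + varsigma_star n m sigma_star r) / sqrt n"
  define E0 E1 where "E0 = expectation (loss u)" and "E1 = expectation (\<lambda>\<omega>. loss (lam \<omega>) \<omega>)"
  define Q where "Q = (\<Sum>j=1..n. (u j)\<^sup>2)"
  have R0: "0 \<le> R" "0 \<le> R1"
    unfolding R_def R1_def using weight_bounds(2,3)[OF \<Lambda> u] varrho_bar_ge[OF \<Lambda>(2) u, of 0 1 n]
    by (simp, simp add: order_trans[OF abs_ge_zero])
  note LI = linear_remainder_expectation[OF weight_bounds(1)[OF \<Lambda>] weight_bounds(1)[OF \<Lambda> u] \<rho>(1) \<rho>1]
  note DI = diagonal_form_expectation[OF \<Lambda>]
  note OI = off_diagonal_remainder_expectation[OF \<rho>(1)]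
  note VI = variance_error_expectation[OF S r m]
  have "expectation (\<lambda>\<omega>. (1 - 2 * \<rho> / (1 - \<rho>)) * loss (lam \<omega>) \<omega>)
     \<le> expectation (\<lambda>\<omega>. (1 + 2 * \<rho> / (1 - \<rho>)) * loss u \<omega>
    + (\<Sum>w\<in>\<Lambda>. linear_remainder \<rho> u w \<omega>) + 4 * (\<Sum>w\<in>\<Lambda>. \<bar>diagonal_form w \<omega>\<bar>)
    + 2 * (\<Sum>w\<in>\<Lambda>. off_diagonal_remainder \<rho> w \<omega>)
    + 4 * varrho_bar 1 n \<Lambda> * noise_level \<omega> + (2 + \<rho>) * varrho n \<Lambda> * variance_error m \<omega>
    + 2 * \<rho> * (\<Sum>j=1..n. (u j)\<^sup>2) * noise_level \<omega>)"
  proof (rule integral_mono)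
    show "integrable M (\<lambda>\<omega>. (1 - 2 * \<rho> / (1 - \<rho>)) * loss (lam \<omega>) \<omega>)"
      using selected_loss_integrable[OF \<Lambda>(2) lam] by simp
    show "integrable M (\<lambda>\<omega>. (1 + 2 * \<rho> / (1 - \<rho>)) * loss u \<omega>
    + (\<Sum>w\<in>\<Lambda>. linear_remainder \<rho> u w \<omega>) + 4 * (\<Sum>w\<in>\<Lambda>. \<bar>diagonal_form w \<omega>\<bar>)
    + 2 * (\<Sum>w\<in>\<Lambda>. off_diagonal_remainder \<rho> w \<omega>)
    + 4 * varrho_bar 1 n \<Lambda> * noise_level \<omega> + (2 + \<rho>) * varrho n \<Lambda> * variance_error m \<omega>
    + 2 * \<rho> * (\<Sum>j=1..n. (u j)\<^sup>2) * noise_level \<omega>)"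
      using loss_moments(1) LI(1) DI(1) OI(1) noise_level_moments(1) VI(1)
      by (intro Bochner_Integration.integrable_add integrable_mult_right Bochner_Integration.integrable_sum) auto
    fix \<omega> assume \<omega>: "\<omega> \<in> space M"
    have w: "lam \<omega> \<in> \<Lambda>" and le: "cost n m \<rho> (observation n S \<sigma> \<xi> \<omega>) (lam \<omega>) \<le> cost n m \<rho> (observation n S \<sigma> \<xi> \<omega>) u"
      using min[OF \<omega>] u by (auto simp: is_arg_min_linorder)
    show "(1 - 2 * \<rho> / (1 - \<rho>)) * loss (lam \<omega>) \<omega> \<le> (1 + 2 * \<rho> / (1 - \<rho>)) * loss u \<omega>
    + (\<Sum>w\<in>\<Lambda>. linear_remainder \<rho> u w \<omega>) + 4 * (\<Sum>w\<in>\<Lambda>. \<bar>diagonal_form w \<omega>\<bar>)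
    + 2 * (\<Sum>w\<in>\<Lambda>. off_diagonal_remainder \<rho> w \<omega>)
    + 4 * varrho_bar 1 n \<Lambda> * noise_level \<omega> + (2 + \<rho>) * varrho n \<Lambda> * variance_error m \<omega>
    + 2 * \<rho> * (\<Sum>j=1..n. (u j)\<^sup>2) * noise_level \<omega>"
      by (rule pointwise_oracle_inequality[OF \<Lambda> w u \<rho>(1) \<rho>1 le])
  qed
  also have "\<dots> = (1 + 2 * \<rho> / (1 - \<rho>)) * E0
    + (\<Sum>w\<in>\<Lambda>. expectation (linear_remainder \<rho> u w)) + 4 * (\<Sum>w\<in>\<Lambda>. expectation (\<lambda>\<omega>. \<bar>diagonal_form w \<omega>\<bar>))
    + 2 * (\<Sum>w\<in>\<Lambda>. expectation (off_diagonal_remainder \<rho> w))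
    + 4 * R1 * expectation noise_level + (2 + \<rho>) * R * expectation (variance_error m)
    + 2 * \<rho> * (Q * expectation noise_level)"
  proof -
    have s1: "integrable M (\<lambda>\<omega>. \<Sum>w\<in>\<Lambda>. linear_remainder \<rho> u w \<omega>)"
        "expectation (\<lambda>\<omega>. \<Sum>w\<in>\<Lambda>. linear_remainder \<rho> u w \<omega>) = (\<Sum>w\<in>\<Lambda>. expectation (linear_remainder \<rho> u w))"
      using LI(1) by (auto intro!: Bochner_Integration.integrable_sum Bochner_Integration.integral_sum)
    have s2: "integrable M (\<lambda>\<omega>. \<Sum>w\<in>\<Lambda>. \<bar>diagonal_form w \<omega>\<bar>)"
        "expectation (\<lambda>\<omega>. \<Sum>w\<in>\<Lambda>. \<bar>diagonal_form w \<omega>\<bar>) = (\<Sum>w\<in>\<Lambda>. expectation (\<lambda>\<omega>. \<bar>diagonal_form w \<omega>\<bar>))"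
      using DI(1) by (intro Bochner_Integration.integrable_sum Bochner_Integration.integral_sum; simp)+
    have s3: "integrable M (\<lambda>\<omega>. \<Sum>w\<in>\<Lambda>. off_diagonal_remainder \<rho> w \<omega>)"
        "expectation (\<lambda>\<omega>. \<Sum>w\<in>\<Lambda>. off_diagonal_remainder \<rho> w \<omega>) = (\<Sum>w\<in>\<Lambda>. expectation (off_diagonal_remainder \<rho> w))"
      using OI(1) by (auto intro!: Bochner_Integration.integrable_sum Bochner_Integration.integral_sum)
    show ?thesis
      using s1 s2 s3 loss_moments(1) noise_level_moments(1) VI(1)
      by (simp add: E0_def R1_def R_def Q_def)
  qed
  also have "\<dots> \<le> (1 + 2 * \<rho> / (1 - \<rho>)) * E0
    + \<nu> * (s / n / (\<rho> * (1 - \<rho>))) + 4 * (\<nu> * (s / n * x * (R + R1)))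
    + 2 * (\<nu> * (8 * s / (\<rho> * n)))
    + 4 * R1 * (s / n) + (2 + \<rho>) * R * (G / n)
    + 2 * \<rho> * (E0 + R2 * (s / n))"
  proof (intro add_mono mult_left_mono order_refl)
    show "(\<Sum>w\<in>\<Lambda>. expectation (linear_remainder \<rho> u w)) \<le> \<nu> * (s / n / (\<rho> * (1 - \<rho>)))"
      unfolding \<nu>_def s_def using LI(2) by (intro sum_bounded_above) auto
    show "(\<Sum>w\<in>\<Lambda>. expectation (\<lambda>\<omega>. \<bar>diagonal_form w \<omega>\<bar>)) \<le> \<nu> * (s / n * x * (R + R1))"
      unfolding \<nu>_def s_def x_def R_def R1_def using DI(2) by (intro sum_bounded_above) auto
    show "(\<Sum>w\<in>\<Lambda>. expectation (off_diagonal_remainder \<rho> w)) \<le> \<nu> * (8 * s / (\<rho> * n))"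
      unfolding \<nu>_def s_def using OI(2) by (intro sum_bounded_above) auto
    show "expectation noise_level \<le> s / n" unfolding s_def by (rule noise_level_moments)
    show "expectation (variance_error m) \<le> G / n" using VI(2) unfolding G_def by (simp add: mult.commute)
    show "Q * expectation noise_level \<le> E0 + R2 * (s / n)"
      unfolding Q_def E0_def R2_def s_def by (rule penalty_le_risk[OF \<Lambda>(2) u])
  qed (use R0 \<rho> in auto)
  finally have main: "(1 - 2 * \<rho> / (1 - \<rho>)) * E1 \<le> (1 + 2 * \<rho> / (1 - \<rho>)) * E0
    + \<nu> * (s / n / (\<rho> * (1 - \<rho>))) + 4 * (\<nu> * (s / n * x * (R + R1)))
    + 2 * (\<nu> * (8 * s / (\<rho> * n)))
    + 4 * R1 * (s / n) + (2 + \<rho>) * R * (G / n)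
    + 2 * \<rho> * (E0 + R2 * (s / n))" (is "_ \<le> ?rhs") by (simp add: E1_def)
  define U where "U = 16 * \<nu> / \<rho> + 4 * R1 * (1 + \<nu> * x) + 4 * \<nu> * R * x"
  \<comment> \<open>The factor 1 - \<rho> clears the denominators and leaves 1 - 3 \<rho> on the
    left, positive exactly for \<rho> < 1/3.\<close>
  have "(1 - \<rho>) * ((1 - 2 * \<rho> / (1 - \<rho>)) * E1) \<le> (1 - \<rho>) * ?rhs"
    using main \<rho>1 by (intro mult_left_mono) auto
  also have "(1 - \<rho>) * ((1 - 2 * \<rho> / (1 - \<rho>)) * E1) = (1 - 3 * \<rho>) * E1"
    using \<rho>1 by (simp add: field_simps)
  \<comment> \<open>The coefficient of \<open>E0\<close> is (1 - \<rho>) + 2 \<rho> + 2 \<rho> (1 -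
    \<rho>), the last part being the penalty of \<open>u\<close> charged to its risk. In
    \<open>U\<close>, 16 is twice the constant 8 of the off-diagonal remainder.\<close>
  also have "(1 - \<rho>) * ?rhs = (1 + 3 * \<rho> - 2 * \<rho>\<^sup>2) * E0 + 1 / n * (\<nu> * s / \<rho> + (1 - \<rho>) * U * s
      + (1 - \<rho>) * (2 + \<rho>) * (R * G) + 2 * \<rho> * (1 - \<rho>) * R2 * s)"
    using \<rho> \<rho>1 n0 unfolding U_def by (simp add: divide_simps power2_eq_square) (simp add: algebra_simps)
  also have "\<dots> \<le> (1 + 3 * \<rho> - 2 * \<rho>\<^sup>2) * E0 + 1 / n * (2 * \<nu> * s / \<rho> + (1 - \<rho>) * U * s
      + 4 * (1 - \<rho>\<^sup>2) * (R * G) + 2 * \<rho> * (1 - \<rho>) * R2 * s)"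
  proof -
    have "0 \<le> \<nu> * s / \<rho>" using \<rho> sigma_star_pos by (simp add: \<nu>_def s_def)
    then have 1: "\<nu> * s / \<rho> \<le> 2 * \<nu> * s / \<rho>" by simp
    have "4 * (1 - \<rho>\<^sup>2) - (1 - \<rho>) * (2 + \<rho>) = (1 - \<rho>) * (2 + 3 * \<rho>)" by (simp add: power2_eq_square algebra_simps)
    moreover have "0 \<le> (1 - \<rho>) * (2 + 3 * \<rho>)" using \<rho> by simp
    ultimately have 2: "(1 - \<rho>) * (2 + \<rho>) \<le> 4 * (1 - \<rho>\<^sup>2)" by linarith
    have "0 \<le> sigma_bar xi_star sigma_star + varsigma_star n m sigma_star r"
      using xi_star_ge_1 sigma_star_pos r unfolding sigma_bar_def varsigma_star_def xi_bar_def by simp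
    then have "0 \<le> R * G" using R0 unfolding G_def by simp
    note 1 mult_right_mono[OF 2 this]
    then show ?thesis using n0 by (intro add_left_mono mult_left_mono) auto
  qed
  also have "\<dots> = (1 - 3 * \<rho>) * ((1 + kappa \<rho>) * E0 + 1 / n * D_const n m \<Lambda> xi_star sigma_star \<rho> r)"
  proof -
    have c: "1 - 3 * \<rho> \<noteq> 0" using \<rho> by simp
    have k: "(1 - 3 * \<rho>) * (1 + kappa \<rho>) = 1 + 3 * \<rho> - 2 * \<rho>\<^sup>2"
      using c by (simp add: kappa_def distrib_left)
    have ks: "(1 - 3 * \<rho>) * kappa_star \<rho> = 4 * (1 - \<rho>\<^sup>2)" using c by (simp add: kappa_star_def)
    have P: "(1 - 3 * \<rho>) * Psi n \<Lambda> xi_star sigma_star \<rho> = 2 * \<nu> * s / \<rho> + (1 - \<rho>) * U * s + 2 * \<rho> * (1 - \<rho>) * R2 * s"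
    proof -
      have "Upsilon_star n \<Lambda> xi_star \<rho> = U" unfolding Upsilon_star_def U_def \<nu>_def R1_def R_def x_def by simp
      then have "(1 - 3 * \<rho>) * Psi n \<Lambda> xi_star sigma_star \<rho> = (\<rho> * (1 - \<rho>) * U + 2 * \<nu> + 2 * \<rho>\<^sup>2 * (1 - \<rho>) * R2) / \<rho> * s"
        using c \<rho> unfolding Psi_def \<nu>_def R2_def s_def by simp
      also have "\<dots> = 2 * \<nu> * s / \<rho> + (1 - \<rho>) * U * s + 2 * \<rho> * (1 - \<rho>) * R2 * s"
        using \<rho> by (simp add: add_divide_distrib distrib_right power2_eq_square)
      finally show ?thesis .
    qed
    have D: "D_const n m \<Lambda> xi_star sigma_star \<rho> r = Psi n \<Lambda> xi_star sigma_star \<rho> + kappa_star \<rho> * (R * G)"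
      unfolding D_const_def G_def R_def by simp
    have "(1 - 3 * \<rho>) * ((1 + kappa \<rho>) * E0 + 1 / n * D_const n m \<Lambda> xi_star sigma_star \<rho> r)
        = ((1 - 3 * \<rho>) * (1 + kappa \<rho>)) * E0
          + 1 / n * ((1 - 3 * \<rho>) * Psi n \<Lambda> xi_star sigma_star \<rho> + ((1 - 3 * \<rho>) * kappa_star \<rho>) * (R * G))"
      unfolding D by algebra
    then show ?thesis unfolding k ks P by simp
  qed
  finally have "E1 \<le> (1 + kappa \<rho>) * E0 + 1 / n * D_const n m \<Lambda> xi_star sigma_star \<rho> r"
    using \<rho> by (simp add: mult_le_cancel_left_pos)
  then show ?thesis unfolding E0_def E1_def .
qed

end

section \<open>Pinsker weights\<close>

text \<open>The numerator is at most (4 \<beta> + 2) \<beta>, and 4 \<beta> + 2 is beaten by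
  9^\<beta> <= pi^(2 \<beta>).\<close>

lemma pinsker_A_bounds:
  assumes "1 \<le> \<beta>"
  shows "0 < pinsker_A \<beta>" "pinsker_A \<beta> \<le> 1"
proof -
  have nine: "4 * real b + 2 \<le> 9 ^ b" if "1 \<le> b" for b
    using that by (induction b rule: nat_induct_at_least) auto
  have "9 \<le> pi\<^sup>2" using pi_gt3 power_mono[of 3 pi 2] by simp
  then have pi: "9 ^ \<beta> \<le> pi ^ (2 * \<beta>)" unfolding power_mult by (intro power_mono) auto
  have "(real \<beta> + 1) * (2 * real \<beta> + 1) \<le> (2 * real \<beta>) * (2 * real \<beta> + 1)"
    using assms by (intro mult_right_mono) auto
  also have "\<dots> = (4 * real \<beta> + 2) * real \<beta>" by (simp add: algebra_simps)
  also have "\<dots> \<le> pi ^ (2 * \<beta>) * real \<beta>" using nine[OF assms] pi by (intro mult_right_mono) auto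
  finally show "pinsker_A \<beta> \<le> 1" using assms unfolding pinsker_A_def by (simp add: divide_le_eq_1)
  show "0 < pinsker_A \<beta>" using assms unfolding pinsker_A_def by simp
qed

text \<open>\<beta> >= 1 makes the exponent at most 1/3 while the base n / e is at least 1, so the
  bound is uniform over the smoothness and over \<open>t\<close>.\<close>

lemma pinsker_omega_bounds:
  assumes \<beta>: "1 \<le> \<beta>" and t: "0 < t" "t \<le> 1 / e" and e: "0 < e" "e \<le> 1" and n: "0 < n"
  shows "0 < pinsker_omega n (\<beta>, t)" "pinsker_omega n (\<beta>, t) \<le> (real n / e) powr (1 / 3)"
proof -
  have At: "0 < pinsker_A \<beta> * t * real n" using pinsker_A_bounds[OF \<beta>] t n by simp
  then show "0 < pinsker_omega n (\<beta>, t)"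
    using less_imp_neq[OF At] n by (simp add: pinsker_omega_def)
  have "pinsker_A \<beta> * t \<le> 1 * (1 / e)" using pinsker_A_bounds[OF \<beta>] t by (intro mult_mono) auto
  then have "pinsker_A \<beta> * t * real n \<le> 1 / e * real n" by (intro mult_right_mono) auto
  then have "pinsker_omega n (\<beta>, t) \<le> (real n / e) powr (1 / (2 * real \<beta> + 1))"
    using At unfolding pinsker_omega_def by (simp add: powr_mono2)
  also have "\<dots> \<le> (real n / e) powr (1 / 3)"
  proof (rule powr_mono)
    show "1 / (2 * real \<beta> + 1) \<le> 1 / 3" using \<beta> by (intro divide_left_mono) auto
    show "1 \<le> real n / e" using n e by (simp add: pos_le_divide_eq order_trans[OF e(2)])
  qed
  finally show "pinsker_omega n (\<beta>, t) \<le> (real n / e) powr (1 / 3)" .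
qed

lemma ln_ge_1: "3 \<le> n \<Longrightarrow> 1 \<le> ln (real n)"
  using exp_le by (subst ln_ge_iff) auto

text \<open>n >= 3 gives ln n >= 1, so the plateau ends no later than the cutoff
  \<open>pinsker_omega\<close> and the cases are ordered.\<close>

lemma pinsker_weight_cases:
  assumes n: "3 \<le> n" and pos: "0 < pinsker_omega n \<alpha>" and j: "j \<in> {1..n}"
  shows "pinsker_weight n \<alpha> j = (if j \<le> pinsker_j0 n \<alpha> then 1
    else if real j \<le> pinsker_omega n \<alpha> then 1 - (real j / pinsker_omega n \<alpha>) ^ fst \<alpha> else 0)"
    and "j \<le> pinsker_j0 n \<alpha> \<Longrightarrow> real j \<le> pinsker_omega n \<alpha>"
proof -
  show "pinsker_weight n \<alpha> j = (if j \<le> pinsker_j0 n \<alpha> then 1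
    else if real j \<le> pinsker_omega n \<alpha> then 1 - (real j / pinsker_omega n \<alpha>) ^ fst \<alpha> else 0)"
    using j by (auto simp: pinsker_weight_def)
  have "pinsker_omega n \<alpha> / ln (real n) \<le> pinsker_omega n \<alpha> / 1"
    using ln_ge_1[OF n] pos by (intro divide_left_mono) auto
  moreover have "0 \<le> pinsker_omega n \<alpha> / ln (real n)" using ln_ge_1[OF n] pos by simp
  then have "real (pinsker_j0 n \<alpha>) = of_int \<lfloor>pinsker_omega n \<alpha> / ln (real n)\<rfloor>"
    unfolding pinsker_j0_def by simp
  ultimately have "real (pinsker_j0 n \<alpha>) \<le> pinsker_omega n \<alpha>"
    using of_int_floor_le[of "pinsker_omega n \<alpha> / ln (real n)"] by linarith
  then show "j \<le> pinsker_j0 n \<alpha> \<Longrightarrow> real j \<le> pinsker_omega n \<alpha>" by linarith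
qed

lemma pinsker_weight_unit:
  assumes n: "3 \<le> n" and pos: "0 < pinsker_omega n \<alpha>" and j: "j \<in> {1..n}"
  shows "0 \<le> pinsker_weight n \<alpha> j" "pinsker_weight n \<alpha> j \<le> of_bool (real j \<le> pinsker_omega n \<alpha>)"
  using pinsker_weight_cases[OF assms] pos by (auto simp: power_le_one)

lemma pinsker_weight_antimono:
  assumes n: "3 \<le> n" and pos: "0 < pinsker_omega n \<alpha>" and "1 \<le> i" "i \<le> j" "j \<le> n"
  shows "pinsker_weight n \<alpha> j \<le> pinsker_weight n \<alpha> i"
proof -
  have i: "i \<in> {1..n}" and j: "j \<in> {1..n}" using assms by auto
  note C = pinsker_weight_cases[OF n pos i] pinsker_weight_cases[OF n pos j]
  have "(real i / pinsker_omega n \<alpha>) ^ fst \<alpha> \<le> (real j / pinsker_omega n \<alpha>) ^ fst \<alpha>"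
    using pos assms by (intro power_mono divide_right_mono) auto
  moreover have "(real i / pinsker_omega n \<alpha>) ^ fst \<alpha> \<le> 1" if "real i \<le> pinsker_omega n \<alpha>"
    using pos that by (intro power_le_one) auto
  moreover have "0 \<le> (real j / pinsker_omega n \<alpha>) ^ fst \<alpha>" using pos by simp
  ultimately show ?thesis using C assms(3,4) by (auto split: if_splits)
qed

lemma pinsker_weight_sum_le:
  assumes n: "3 \<le> n" and pos: "0 < pinsker_omega n \<alpha>"
  shows "(\<Sum>j=1..n. pinsker_weight n \<alpha> j) \<le> pinsker_omega n \<alpha>"
proof -
  have "(\<Sum>j=1..n. pinsker_weight n \<alpha> j) \<le> (\<Sum>j=1..n. of_bool (real j \<le> pinsker_omega n \<alpha>))"
    using pinsker_weight_unit(2)[OF n pos] by (intro sum_mono)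
  also have "\<dots> = real (card ({1..n} \<inter> {j. real j \<le> pinsker_omega n \<alpha>}))" by simp
  also have "\<dots> \<le> real (card {1..nat \<lfloor>pinsker_omega n \<alpha>\<rfloor>})"
    by (intro of_nat_mono card_mono) (auto simp: le_nat_floor)
  also have "\<dots> \<le> pinsker_omega n \<alpha>" using pos by simp
  finally show ?thesis .
qed

text \<open>\<open>trig_bar\<close> vanishes at index 1 and takes opposite values \<open>\<plusminus> cos (4 \<pi> k x)\<close> at the indices
  \<open>2 k\<close> and \<open>2 k + 1\<close>, so a sum with monotone coefficients telescopes.\<close>

lemma trig_bar_sum_antimono:
  assumes n: "odd n" and anti: "\<And>i j. 1 \<le> i \<Longrightarrow> i \<le> j \<Longrightarrow> j \<le> n \<Longrightarrow> a j \<le> a i"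
    and bnd: "\<And>j. j \<in> {1..n} \<Longrightarrow> 0 \<le> a j \<and> a j \<le> (1 :: real)"
  shows "\<bar>\<Sum>j=1..n. a j * trig_bar j x\<bar> \<le> 1"
proof -
  obtain p where p: "n = 2 * p + 1" using n oddE by blast
  have opp: "trig_bar (2 * k + 1) x = - trig_bar (2 * k) x" if "1 \<le> k" for k
    unfolding trig_bar_def trig_even[OF that] trig_odd[OF that]
    by (simp add: power_mult_distrib sin_squared_eq)
  \<comment> \<open>Only every second decrement is summed; the skipped ones are nonnegative, so the
    total drop is an upper bound.\<close>
  have tele: "(\<Sum>k=1..q. a (2 * k) - a (2 * k + 1)) \<le> a 1 - a (2 * q + 1)" if "q \<le> p" for q
    using that
  proof (induction q)
    case (Suc q)
    moreover have "a (2 * Suc q) \<le> a (2 * q + 1)" using Suc.prems p by (intro anti) auto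
    ultimately show ?case by simp
  qed simp
  have "(\<Sum>j=1..n. a j * trig_bar j x) = (\<Sum>k=1..p. (a (2 * k) - a (2 * k + 1)) * trig_bar (2 * k) x)"
  proof -
    have "trig_bar 1 x = 0" by (simp add: trig_bar_def trig_def)
    then have "(\<Sum>j=1..n. a j * trig_bar j x)
        = (\<Sum>k=1..p. a (2 * k) * trig_bar (2 * k) x + a (2 * k + 1) * trig_bar (2 * k + 1) x)"
      unfolding p sum_pairs_odd by simp
    also have "\<dots> = (\<Sum>k=1..p. (a (2 * k) - a (2 * k + 1)) * trig_bar (2 * k) x)"
      using opp by (intro sum.cong) (auto simp: left_diff_distrib)
    finally show ?thesis .
  qed
  also have "\<bar>\<dots>\<bar> \<le> (\<Sum>k=1..p. (a (2 * k) - a (2 * k + 1)) * 1)"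
  proof (intro order_trans[OF sum_abs] sum_mono)
    fix k assume "k \<in> {1..p}"
    then have "a (2 * k + 1) \<le> a (2 * k)" using p by (intro anti) auto
    then show "\<bar>(a (2 * k) - a (2 * k + 1)) * trig_bar (2 * k) x\<bar> \<le> (a (2 * k) - a (2 * k + 1)) * 1"
      using abs_trig_bar_le[of "2 * k" x] by (simp add: abs_mult mult_left_le)
  qed
  also have "\<dots> \<le> a 1 - a (2 * p + 1)" using tele[of p] by simp
  also have "\<dots> \<le> 1" using bnd[of 1] bnd[of n] p by simp
  finally show ?thesis .
qed

section \<open>Bounds uniform over the Pinsker family\<close>

context
  fixes n :: nat and k e :: real
  assumes n: "odd n" "3 \<le> n" and k: "1 \<le> k" and e: "0 < e" "e \<le> 1"
begin

text \<open>The grid stops at i <= 1 / e^2, hence t = i e <= 1 / e.\<close>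

lemma pinsker_index_omega:
  assumes "\<alpha> \<in> pinsker_index k e"
  shows "0 < pinsker_omega n \<alpha>" "pinsker_omega n \<alpha> \<le> (real n / e) powr (1 / 3)"
proof -
  obtain \<beta> t where \<beta>t: "\<alpha> = (\<beta>, t)" "1 \<le> \<beta>" "t \<in> (\<lambda>i. real i * e) ` {1..nat \<lfloor>1 / e\<^sup>2\<rfloor>}"
    using assms unfolding pinsker_index_def by blast
  then obtain i where "t = real i * e" "i \<in> {1..nat \<lfloor>1 / e\<^sup>2\<rfloor>}" by blast
  with \<beta>t have \<alpha>: "\<alpha> = (\<beta>, real i * e)" "1 \<le> \<beta>" "1 \<le> i" "i \<le> nat \<lfloor>1 / e\<^sup>2\<rfloor>" by auto
  have "real i \<le> 1 / e\<^sup>2" using \<alpha>(3,4) by (simp add: le_nat_iff le_floor_iff)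
  then have "real i * e \<le> 1 / e\<^sup>2 * e" using e by (intro mult_right_mono) auto
  then have "real i * e \<le> 1 / e" using e by (simp add: power2_eq_square)
  moreover have "0 < real i * e" using \<alpha> e by simp
  ultimately show "0 < pinsker_omega n \<alpha>" "pinsker_omega n \<alpha> \<le> (real n / e) powr (1 / 3)"
    using pinsker_omega_bounds[OF \<alpha>(2) _ _ e] n unfolding \<alpha>(1) by simp_all
qed

lemma pinsker_index_finite:
  "finite (pinsker_index k e)" "pinsker_index k e \<noteq> {}" "real (card (pinsker_index k e)) \<le> k / e\<^sup>2"
proof -
  have sub: "{\<beta>::nat. 1 \<le> \<beta> \<and> real \<beta> \<le> k} \<subseteq> {1..nat \<lfloor>k\<rfloor>}" by (auto simp: le_nat_floor)
  then have fin: "finite {\<beta>::nat. 1 \<le> \<beta> \<and> real \<beta> \<le> k}" by (rule finite_subset) simp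
  show "finite (pinsker_index k e)" unfolding pinsker_index_def using fin by simp
  have "1 \<le> 1 / e\<^sup>2" using e by (simp add: power_le_one)
  then have "1 \<le> nat \<lfloor>1 / e\<^sup>2\<rfloor>" by (simp add: le_nat_iff le_floor_iff)
  then have "(1, real 1 * e) \<in> pinsker_index k e" unfolding pinsker_index_def using k by fastforce
  then show "pinsker_index k e \<noteq> {}" by blast
  have "real (card {\<beta>::nat. 1 \<le> \<beta> \<and> real \<beta> \<le> k}) \<le> real (nat \<lfloor>k\<rfloor>)"
    using card_mono[OF _ sub] by simp
  also have "\<dots> \<le> k" using k by simp
  finally have c1: "real (card {\<beta>::nat. 1 \<le> \<beta> \<and> real \<beta> \<le> k}) \<le> k" .
  have "real (card ((\<lambda>i. real i * e) ` {1..nat \<lfloor>1 / e\<^sup>2\<rfloor>})) \<le> real (card {1..nat \<lfloor>1 / e\<^sup>2\<rfloor>})"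
    by (intro of_nat_mono card_image_le) simp
  also have "\<dots> \<le> 1 / e\<^sup>2" by simp
  finally show "real (card (pinsker_index k e)) \<le> k / e\<^sup>2"
    unfolding pinsker_index_def card_cartesian_product of_nat_mult
    using mult_mono[OF c1] k by fastforce
qed

lemma pinsker_weights_finite:
  "finite (pinsker_weights n k e)" "pinsker_weights n k e \<noteq> {}"
  "real (card (pinsker_weights n k e)) \<le> k / e\<^sup>2"
proof -
  show "finite (pinsker_weights n k e)" "pinsker_weights n k e \<noteq> {}"
    using pinsker_index_finite unfolding pinsker_weights_def by auto
  have "real (card (pinsker_weights n k e)) \<le> real (card (pinsker_index k e))"
    unfolding pinsker_weights_def using card_image_le[OF pinsker_index_finite(1)] by simp
  then show "real (card (pinsker_weights n k e)) \<le> k / e\<^sup>2" using pinsker_index_finite(3) by linarith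
qed

lemma pinsker_varrho_bounds:
  "0 \<le> varrho n (pinsker_weights n k e)" "varrho n (pinsker_weights n k e) \<le> (real n / e) powr (1 / 3)"
proof -
  obtain \<alpha> where \<alpha>: "\<alpha> \<in> pinsker_index k e" using pinsker_index_finite by blast
  have "0 \<le> (\<Sum>j=1..n. pinsker_weight n \<alpha> j)"
    using pinsker_weight_unit(1)[OF n(2) pinsker_index_omega(1)[OF \<alpha>]] by (intro sum_nonneg)
  also have "\<dots> \<le> varrho n (pinsker_weights n k e)"
    using \<alpha> pinsker_weights_finite by (intro varrho_ge) (auto simp: pinsker_weights_def)
  finally show "0 \<le> varrho n (pinsker_weights n k e)" .
  have "(\<Sum>j=1..n. pinsker_weight n \<alpha> j) \<le> (real n / e) powr (1 / 3)" if "\<alpha> \<in> pinsker_index k e" for \<alpha>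
    using pinsker_weight_sum_le[OF n(2) pinsker_index_omega(1)[OF that]] pinsker_index_omega(2)[OF that] by linarith
  then show "varrho n (pinsker_weights n k e) \<le> (real n / e) powr (1 / 3)"
    unfolding varrho_def using pinsker_weights_finite
    by (intro Max.boundedI) (auto simp: pinsker_weights_def)
qed

text \<open>Powers of nonincreasing weights in [0, 1] are again nonincreasing and in [0, 1], so
  \<open>trig_bar_sum_antimono\<close> covers every exponent.\<close>

lemma pinsker_varrho_bar_bounds:
  "0 \<le> varrho_bar i n (pinsker_weights n k e)" "varrho_bar i n (pinsker_weights n k e) \<le> 1"
proof -
  obtain w where "w \<in> pinsker_weights n k e" using pinsker_weights_finite by blast
  from varrho_bar_ge[OF pinsker_weights_finite(1) this, of 0 i n]
  show "0 \<le> varrho_bar i n (pinsker_weights n k e)" by (simp add: order_trans[OF abs_ge_zero])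
  have "(SUP x\<in>{0..1}. \<bar>\<Sum>j=1..n. (pinsker_weight n \<alpha> j) ^ i * trig_bar j x\<bar>) \<le> 1"
    if \<alpha>: "\<alpha> \<in> pinsker_index k e" for \<alpha>
  proof (rule cSUP_least)
    fix x :: real
    note pos = pinsker_index_omega(1)[OF \<alpha>]
    show "\<bar>\<Sum>j=1..n. (pinsker_weight n \<alpha> j) ^ i * trig_bar j x\<bar> \<le> 1"
    proof (rule trig_bar_sum_antimono[OF n(1)])
      show "pinsker_weight n \<alpha> j ^ i \<le> pinsker_weight n \<alpha> l ^ i" if "1 \<le> l" "l \<le> j" "j \<le> n" for l j
        using pinsker_weight_antimono[OF n(2) pos that] pinsker_weight_unit(1)[OF n(2) pos, of j] that
        by (intro power_mono) auto
      show "0 \<le> pinsker_weight n \<alpha> j ^ i \<and> pinsker_weight n \<alpha> j ^ i \<le> 1" if "j \<in> {1..n}" for j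
      proof -
        have "pinsker_weight n \<alpha> j \<le> 1"
          by (rule order_trans[OF pinsker_weight_unit(2)[OF n(2) pos that]]) simp
        then show ?thesis using pinsker_weight_unit(1)[OF n(2) pos that] by (simp add: power_le_one)
      qed
    qed
  qed simp
  then show "varrho_bar i n (pinsker_weights n k e) \<le> 1"
    unfolding varrho_bar_def using pinsker_weights_finite
    by (intro Max.boundedI) (auto simp: pinsker_weights_def)
qed

end

text \<open>The cardinality is at most k / \<epsilon>^2 and hence negligible against every power of
  \<open>n\<close>, \<open>varrho\<close> is o(sqrt n), and \<open>varrho_bar\<close> is at most 1.
  The two growth conditions on \<open>m\<close> make the rest of \<open>varsigma_star\<close>
  harmless.\<close>

lemma pinsker_D_const_limit:
  fixes m :: "nat \<Rightarrow> nat"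
  assumes m_range: "\<And>n. odd n \<Longrightarrow> 3 \<le> n \<Longrightarrow> 1 \<le> m n \<and> m n \<le> n"
    and m_upper: "((\<lambda>n. real (m n) / sqrt (real n)) \<longlongrightarrow> 0) odd_sequentially"
    and m_lower: "filterlim (\<lambda>n. (real (m n))\<^sup>2 / sqrt (real n)) at_top odd_sequentially"
    and pk: "pinsker_sequences k \<epsilon>" and \<delta>: "0 < \<delta>" and \<rho>: "0 < \<rho>" "\<rho> < 1 / 3"
  shows "((\<lambda>n. D_const n (m n) (pinsker_weights n (k n) (\<epsilon> n)) xi_star sigma_star \<rho> r
                   / real n powr \<delta>) \<longlongrightarrow> 0) odd_sequentially"
proof -
  let ?F = odd_sequentially
  let ?L = "\<lambda>n. pinsker_weights n (k n) (\<epsilon> n)"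
  have le: "?F \<le> sequentially" unfolding odd_sequentially_def by simp
  have range: "1 \<le> k n" "0 < \<epsilon> n" "\<epsilon> n \<le> 1" if "odd n" "3 \<le> n" for n
    using pk that unfolding pinsker_sequences_def by auto
  have kln: "((\<lambda>n. k n / ln (real n)) \<longlongrightarrow> 0) ?F"
    and \<epsilon>inf: "\<And>\<delta>. 0 < \<delta> \<Longrightarrow> filterlim (\<lambda>n. real n powr \<delta> * \<epsilon> n) at_top ?F"
    using pk unfolding pinsker_sequences_def by auto
  have ev: "\<forall>\<^sub>F n in ?F. odd n \<and> 3 \<le> n"
    unfolding odd_sequentially_def eventually_inf_principal
    using eventually_ge_at_top[of 3] by eventually_elim auto
  note tends = tendsto_mono[OF le]
  define N where "N n = real (card (?L n))" for n
  define u where "u n = N n / real n powr \<delta>" for n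
  define z where "z n = varrho n (?L n) / sqrt (real n)" for n
  define R where "R i n = varrho_bar i n (?L n)" for i n
  define h where "h n = 1 / sqrt (real n)" for n :: nat
  define q where "q n = 1 / real n powr \<delta>" for n :: nat
  define s where "s n = sqrt (real n) / (real (m n))\<^sup>2" for n
  define g where "g n = real (m n) / sqrt (real n)" for n
  define X where "X = xi_bar xi_star"
  have q0: "(q \<longlongrightarrow> 0) ?F"
  proof (rule tends)
    show "(q \<longlongrightarrow> 0) sequentially" unfolding q_def[abs_def] using \<delta> by real_asymp
  qed
  have h0: "(h \<longlongrightarrow> 0) ?F"
  proof (rule tends)
    show "(h \<longlongrightarrow> 0) sequentially" unfolding h_def[abs_def] by real_asymp
  qed
  have g0: "(g \<longlongrightarrow> 0) ?F" unfolding g_def by (rule m_upper)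
  have s0: "(s \<longlongrightarrow> 0) ?F"
    using tendsto_inverse_0_at_top[OF m_lower] unfolding s_def by simp
  have u0: "(u \<longlongrightarrow> 0) ?F"
  proof (rule tendsto_sandwich[of "\<lambda>_. 0" _ _ "\<lambda>n. (k n / ln (real n)) * (ln (real n) / real n powr (\<delta> / 2))
        * (inverse (real n powr (\<delta> / 4) * \<epsilon> n))\<^sup>2"])
    show "\<forall>\<^sub>F n in ?F. 0 \<le> u n" by (simp add: u_def N_def)
    show "\<forall>\<^sub>F n in ?F. u n \<le> (k n / ln (real n)) * (ln (real n) / real n powr (\<delta> / 2))
        * (inverse (real n powr (\<delta> / 4) * \<epsilon> n))\<^sup>2"
      using ev
    proof eventually_elim
      case (elim n)
      then have on: "odd n" "3 \<le> n" by auto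
      have ln: "0 < ln (real n)" using ln_ge_1[OF on(2)] by linarith
      have "u n \<le> k n / (\<epsilon> n)\<^sup>2 / real n powr \<delta>"
        unfolding u_def N_def using pinsker_weights_finite(3)[OF on range[OF on]] by (intro divide_right_mono) auto
      \<comment> \<open>One half of the exponent absorbs ln n, hence \<open>k n\<close>; two
        quarters absorb the two factors 1 / \<epsilon>.\<close>
      also have "real n powr \<delta> = real n powr (\<delta> / 2) * (real n powr (\<delta> / 4))\<^sup>2"
        using on by (simp add: power2_eq_square powr_add[symmetric])
      finally show ?case using ln by (simp add: field_simps)
    qed
    have "((\<lambda>n. ln (real n) / real n powr (\<delta> / 2)) \<longlongrightarrow> 0) sequentially" using \<delta> by real_asymp
    then have l: "((\<lambda>n. ln (real n) / real n powr (\<delta> / 2)) \<longlongrightarrow> 0) ?F" by (rule tends)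
    have "((\<lambda>n. inverse (real n powr (\<delta> / 4) * \<epsilon> n)) \<longlongrightarrow> 0) ?F"
      using \<delta> by (intro tendsto_inverse_0_at_top \<epsilon>inf) simp
    from tendsto_mult[OF tendsto_mult[OF kln l] tendsto_power[OF this, of 2]]
    show "((\<lambda>n. (k n / ln (real n)) * (ln (real n) / real n powr (\<delta> / 2))
        * (inverse (real n powr (\<delta> / 4) * \<epsilon> n))\<^sup>2) \<longlongrightarrow> 0) ?F" by simp
  qed simp
  have z_nonneg: "\<forall>\<^sub>F n in ?F. 0 \<le> z n"
    using ev by eventually_elim (use pinsker_varrho_bounds(1) range in \<open>simp add: z_def\<close>)
  have z0: "(z \<longlongrightarrow> 0) ?F"
  proof (rule tendsto_sandwich[OF z_nonneg, where h = "\<lambda>n. (real n powr (1 / 2) * \<epsilon> n) powr (- 1 / 3)"])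
    show "\<forall>\<^sub>F n in ?F. z n \<le> (real n powr (1 / 2) * \<epsilon> n) powr (- 1 / 3)"
      using ev
    proof eventually_elim
      case (elim n)
      then have on: "odd n" "3 \<le> n" by auto
      note rg = range[OF on]
      have "z n \<le> (real n / \<epsilon> n) powr (1 / 3) / sqrt (real n)"
        unfolding z_def using pinsker_varrho_bounds(2)[OF on rg] by (intro divide_right_mono) auto
      \<comment> \<open>The exponents 1/3 - 1/2 = -1/6 of \<open>n\<close> and -1/3 of \<epsilon>
        combine into one power of sqrt n * \<epsilon>, which tends to infinity.\<close>
      also have "\<dots> = real n powr (1 / 3) * real n powr (- 1 / 2) * \<epsilon> n powr (- 1 / 3)"
        using on rg by (simp add: powr_divide powr_minus powr_half_sqrt field_simps)
      also have "\<dots> = (real n powr (1 / 2) * \<epsilon> n) powr (- 1 / 3)"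
        using on rg by (simp add: powr_mult powr_powr powr_add[symmetric])
      finally show ?case .
    qed
    show "((\<lambda>n. (real n powr (1 / 2) * \<epsilon> n) powr (- 1 / 3)) \<longlongrightarrow> 0) ?F"
      by (rule tendsto_neg_powr[OF _ \<epsilon>inf]) simp_all
  qed simp
  have R01: "\<forall>\<^sub>F n in ?F. 0 \<le> R i n \<and> R i n \<le> 1" for i
    using ev by eventually_elim (use pinsker_varrho_bar_bounds range in \<open>simp add: R_def\<close>)
  have q_nonneg: "0 \<le> q n" and u_nonneg: "0 \<le> u n" for n by (simp_all add: q_def u_def N_def)
  have Rq: "((\<lambda>n. R i n * q n) \<longlongrightarrow> 0) ?F" for i
  proof (rule tendsto_sandwich[OF _ _ tendsto_const q0])
    show "\<forall>\<^sub>F n in ?F. 0 \<le> R i n * q n" "\<forall>\<^sub>F n in ?F. R i n * q n \<le> q n"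
      using R01[of i] q_nonneg by (auto elim!: eventually_mono intro: mult_left_le_one_le)
  qed
  have Ru: "((\<lambda>n. R i n * u n) \<longlongrightarrow> 0) ?F" for i
  proof (rule tendsto_sandwich[OF _ _ tendsto_const u0])
    show "\<forall>\<^sub>F n in ?F. 0 \<le> R i n * u n" "\<forall>\<^sub>F n in ?F. R i n * u n \<le> u n"
      using R01[of i] u_nonneg by (auto elim!: eventually_mono intro: mult_left_le_one_le)
  qed
  have zm: "((\<lambda>n. z n / real (m n)) \<longlongrightarrow> 0) ?F"
  proof (rule tendsto_sandwich[OF _ _ tendsto_const z0])
    show "\<forall>\<^sub>F n in ?F. 0 \<le> z n / real (m n)" using z_nonneg by eventually_elim simp
    show "\<forall>\<^sub>F n in ?F. z n / real (m n) \<le> z n"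
      using ev z_nonneg by eventually_elim (use m_range in \<open>auto simp: divide_le_eq mult_le_cancel_left1\<close>)
  qed
  \<comment> \<open>The quotient is regrouped so that the sequences occur only in products already
    known to tend to 0; the merely bounded \<open>R i n\<close> always comes paired with
    \<open>q n\<close> or \<open>u n\<close>.\<close>
  let ?E = "\<lambda>n. sigma_star / (\<rho> * (1 - 3 * \<rho>)) *
      (\<rho> * (1 - \<rho>) * (16 / \<rho> * u n + 4 * (R 1 n * q n) + 4 * X * ((R 1 n * u n) * h n) + 4 * X * (u n * z n))
        + 2 * u n + 2 * \<rho>\<^sup>2 * (1 - \<rho>) * (R 2 n * q n))
      + kappa_star \<rho> * q n * (sigma_bar xi_star sigma_star * z n + 4 * r * (s n * z n)
        + 4 * sqrt (r * sigma_star) * (z n / real (m n)) + 2 * sigma_star * (h n * z n) + sigma_star * (g n * z n))"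
  have "(?E \<longlongrightarrow> sigma_star / (\<rho> * (1 - 3 * \<rho>)) *
      (\<rho> * (1 - \<rho>) * (16 / \<rho> * 0 + 4 * 0 + 4 * X * (0 * 0) + 4 * X * (0 * 0))
        + 2 * 0 + 2 * \<rho>\<^sup>2 * (1 - \<rho>) * 0)
      + kappa_star \<rho> * 0 * (sigma_bar xi_star sigma_star * 0 + 4 * r * (0 * 0)
        + 4 * sqrt (r * sigma_star) * 0 + 2 * sigma_star * (0 * 0) + sigma_star * (0 * 0))) ?F"
    by (intro tendsto_add tendsto_mult tendsto_const u0 z0 q0 h0 s0 g0 Rq Ru zm)
  then have E0: "(?E \<longlongrightarrow> 0) ?F" by simp
  have eq: "D_const n (m n) (?L n) xi_star sigma_star \<rho> r / real n powr \<delta> = ?E n" for n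
  proof -
    have U: "Upsilon_star n (?L n) xi_star \<rho>
        = 16 * N n / \<rho> + 4 * R 1 n * (1 + N n * (X * h n)) + 4 * N n * (X * z n)"
      unfolding Upsilon_star_def N_def R_def X_def h_def z_def by simp
    have P: "Psi n (?L n) xi_star sigma_star \<rho> * q n = sigma_star / (\<rho> * (1 - 3 * \<rho>)) *
      (\<rho> * (1 - \<rho>) * (16 / \<rho> * u n + 4 * (R 1 n * q n) + 4 * X * ((R 1 n * u n) * h n) + 4 * X * (u n * z n))
        + 2 * u n + 2 * \<rho>\<^sup>2 * (1 - \<rho>) * (R 2 n * q n))"
    proof -
      define c where "c = 16 / \<rho>"
      have u: "u n = N n * q n" by (simp add: u_def q_def)
      have c: "16 * N n / \<rho> = c * N n" by (simp add: c_def)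
      have "(\<rho> * (1 - \<rho>) * (c * N n + 4 * R 1 n * (1 + N n * (X * h n)) + 4 * N n * (X * z n))
            + 2 * N n + 2 * \<rho>\<^sup>2 * (1 - \<rho>) * R 2 n) * q n
          = \<rho> * (1 - \<rho>) * (c * u n + 4 * (R 1 n * q n) + 4 * X * ((R 1 n * u n) * h n) + 4 * X * (u n * z n))
            + 2 * u n + 2 * \<rho>\<^sup>2 * (1 - \<rho>) * (R 2 n * q n)"
        unfolding u by algebra
      moreover have "a / d * sigma_star * q n = sigma_star / d * (a * q n)" for a d by simp
      ultimately show ?thesis unfolding Psi_def U c N_def[symmetric] R_def[symmetric] c_def[symmetric] by simp
    qed
    have V: "varsigma_star n (m n) sigma_star r
        = 4 * r * s n + 4 * sqrt (r * sigma_star) / real (m n) + (2 * h n + g n) * sigma_star"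
      unfolding varsigma_star_def s_def h_def g_def by (simp add: algebra_simps add_divide_distrib)
    have "D_const n (m n) (?L n) xi_star sigma_star \<rho> r / real n powr \<delta>
      = Psi n (?L n) xi_star sigma_star \<rho> * q n
        + kappa_star \<rho> * (sigma_bar xi_star sigma_star + varsigma_star n (m n) sigma_star r) * z n * q n"
      unfolding D_const_def z_def q_def by (simp add: add_divide_distrib)
    then show ?thesis unfolding P V by (simp add: algebra_simps)
  qed
  show ?thesis unfolding eq by (rule E0)
qed

theorem theorem3p2:
  fixes r xi_star sigma_star :: real
    and S :: "real \<Rightarrow> real"
    and m :: "nat \<Rightarrow> nat"
  assumes r_pos: "0 < r"
    and S_class: "S \<in> sobolev_ball r"
    and sigma_star: "1 \<le> sigma_star"
    and m_range: "\<And>n. odd n \<Longrightarrow> 3 \<le> n \<Longrightarrow> 1 \<le> m n \<and> m n \<le> n"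
    and m_upper: "((\<lambda>n. real (m n) / sqrt (real n)) \<longlongrightarrow> 0) odd_sequentially"
    and m_lower: "filterlim (\<lambda>n. (real (m n))\<^sup>2 / sqrt (real n)) at_top odd_sequentially"
  shows
    "(\<forall>n (M :: 'a measure) \<sigma> \<xi> \<Lambda> \<rho> lam_hat.
        odd n \<longrightarrow> 3 \<le> n \<longrightarrow>
        regression_noise M n \<sigma> \<xi> xi_star sigma_star \<longrightarrow>
        finite \<Lambda> \<longrightarrow> \<Lambda> \<noteq> {} \<longrightarrow> \<Lambda> \<subseteq> weight_cube n \<longrightarrow>
        0 < \<rho> \<longrightarrow> \<rho> < 1/3 \<longrightarrow>
        selects_weights M n (m n) \<rho> (observation n S \<sigma> \<xi>) \<Lambda> lam_hat \<longrightarrow>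
        (\<integral>\<omega>. normsq_n n (\<lambda>x. S_hat n (observation n S \<sigma> \<xi> \<omega>) (lam_hat \<omega>) x - S x) \<partial>M)
        \<le> (1 + kappa \<rho>)
            * Min ((\<lambda>w. \<integral>\<omega>. normsq_n n (\<lambda>x. S_hat n (observation n S \<sigma> \<xi> \<omega>) w x - S x) \<partial>M) ` \<Lambda>)
          + 1 / real n * D_const n (m n) \<Lambda> xi_star sigma_star \<rho> r)
     \<and>
     (\<forall>k \<epsilon>. pinsker_sequences k \<epsilon> \<longrightarrow>
        (\<forall>\<delta> \<rho>. 0 < \<delta> \<longrightarrow> 0 < \<rho> \<longrightarrow> \<rho> < 1/3 \<longrightarrow>
           ((\<lambda>n. D_const n (m n) (pinsker_weights n (k n) (\<epsilon> n)) xi_star sigma_star \<rho> r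
                   / real n powr \<delta>) \<longlongrightarrow> 0) odd_sequentially))"
proof (intro conjI allI impI)
  fix n and M :: "'a measure" and \<sigma> \<xi> \<Lambda> \<rho> lam_hat
  assume n: "odd n" "3 \<le> n" and noise: "regression_noise M n \<sigma> \<xi> xi_star sigma_star"
    and \<Lambda>: "finite \<Lambda>" "\<Lambda> \<noteq> {}" "\<Lambda> \<subseteq> weight_cube n" and \<rho>: "0 < \<rho>" "\<rho> < 1/3"
    and sel: "selects_weights M n (m n) \<rho> (observation n S \<sigma> \<xi>) \<Lambda> lam_hat"
  interpret regression_model M n \<sigma> \<xi> xi_star sigma_star S
    using noise n(1) by (intro regression_model.intro odd_regression_noise.intro odd_regression_noise_axioms.intro)
  \<comment> \<open>The minimum over the finite nonempty set is attained, which supplies the fixed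
    comparison weight.\<close>
  have "Min ((\<lambda>w. expectation (loss w)) ` \<Lambda>) \<in> (\<lambda>w. expectation (loss w)) ` \<Lambda>"
    using \<Lambda> by (intro Min_in) auto
  then obtain u where u: "u \<in> \<Lambda>" "Min ((\<lambda>w. expectation (loss w)) ` \<Lambda>) = expectation (loss u)" by blast
  have "expectation (\<lambda>\<omega>. loss (lam_hat \<omega>) \<omega>)
      \<le> (1 + kappa \<rho>) * Min ((\<lambda>w. expectation (loss w)) ` \<Lambda>) + 1 / n * D_const n (m n) \<Lambda> xi_star sigma_star \<rho> r"
    unfolding u(2) using m_range[OF n]
    by (intro expected_oracle_inequality[OF \<Lambda>(3,1) u(1) \<rho> sel S_class r_pos]) auto
  then show "(\<integral>\<omega>. normsq_n n (\<lambda>x. S_hat n (observation n S \<sigma> \<xi> \<omega>) (lam_hat \<omega>) x - S x) \<partial>M)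
        \<le> (1 + kappa \<rho>)
            * Min ((\<lambda>w. \<integral>\<omega>. normsq_n n (\<lambda>x. S_hat n (observation n S \<sigma> \<xi> \<omega>) w x - S x) \<partial>M) ` \<Lambda>)
          + 1 / real n * D_const n (m n) \<Lambda> xi_star sigma_star \<rho> r"
    unfolding loss_def .
next
  fix k \<epsilon> and \<delta> \<rho> :: real
  assume "pinsker_sequences k \<epsilon>" "0 < \<delta>" "0 < \<rho>" "\<rho> < 1/3"
  then show "((\<lambda>n. D_const n (m n) (pinsker_weights n (k n) (\<epsilon> n)) xi_star sigma_star \<rho> r
                   / real n powr \<delta>) \<longlongrightarrow> 0) odd_sequentially"
    by (intro pinsker_D_const_limit m_range m_upper m_lower)
qed

end
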